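(* Let $(a_1,\dots,a_k)\in\mathcal{A}$ and fix any positive integer $j$. Then $$\lim_{\delta\to0}\lim_{n\to\infty}\mathbb{P}\big((X_1,\dots,X_j)\in\cdot\ \big|\ C_n^\delta\big)=(\lambda^* )^{\otimes j}$$ (weak convergence), where $\lambda^*\in\mathcal{M}_1((0,\infty))$ is characterized as follows. When $(a_1,\dots,a_{k-1})\in\mathcal{S}_1$ and $a_k\ge g_2(a_1,\dots,a_{k-1})$, $$\lambda^*=\frac1Z e^{p_1\phi_1+\dots+p_{k-1}\phi_{k-1}}dx$$ for $p_1,\dots,p_{k-1}$ satisfying $\int\phi_i\,d\lambda^*=a_i$ for $1\le i\le k-1$. On the other hand, either in the case (i) $(a_1,\dots,a_{k-1})\in\mathcal{S}_2$, or (ii) $(a_1,\dots,a_{k-1})\in\mathcal{S}_1$ and $a_k<g_2(a_1,\dots,a_{k-1})$, $$\lambda^*=\frac1Z e^{p_1\phi_1+\dots+p_{k-1}\phi_{k-1}+p_k\phi_k}dx$$ for $p_1,\dots,p_k$ satisfying $p_k<0$ and $\int\phi_i\,d\lambda^*=a_i$ for $1\le i\le k$. Here $Z$ denotes the respective normalizing constant.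
   Context: Fix an integer $k\ge2$ and functions $\phi_1,\dots,\phi_k:(0,\infty)\to(0,\infty)$ such that: (C1) each $\phi_i$ is $C^1$, increasing, and $\lim_{x\to\infty}\phi_i(x)=\infty$; (C2) for each $i$ and any $c>0$, $\int_0^\infty e^{-c\phi_i}dx<\infty$; (C3) there exists $\kappa>1$ such that for each $1\le i\le k-1$, $\phi_i(x)^\kappa<\phi_{i+1}(x)$ for all sufficiently large $x$; (C4) there exist $C,M>0$ such that $x>C$ implies $\frac1C\phi_i(x)^{-M}<\phi_i'(x)<C\phi_i(x)^M$ for each $i$. $\mathcal{M}_1((0,\infty))$ is the space of Borel probability measures on $(0,\infty)$ with the weak topology, and $\int$ means integration over $(0,\infty)$. Let $\lambda=\frac1Z e^{-\phi_1}dx$ be a probability measure on $(0,\infty)$. On $\Omega=(0,\infty)^{\mathbb{N}}$ with coordinate projections $X_i$, let $\mathbb{P}=\lambda^{\otimes\mathbb{N}}$. Put $S_n^i=\frac1n(\phi_i(X_1)+\dots+\phi_i(X_n))$ and $C_n^\delta=\bigcap_{i=1}^k\{|S_n^i-a_i|\le\delta\}$ for $\delta>0$. The differential entropy is $h(\mu)=-\int\frac{d\mu}{dx}\log\big(\frac{d\mu}{dx}\big)dx$ if $\mu\ll dx$ and $h(\mu)=-\infty$ otherwise. Let $\mathcal{A}_1$ be the interior of the set of $(v_1,\dots,v_{k-1})\in(0,\infty)^{k-1}$ for which there is $\mu\in\mathcal{M}_1((0,\infty))$ with $h(\mu)\ne-\infty$, $\int\phi_i\,d\mu=v_i$ for $1\le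 i\le k-1$, and $\int\phi_k\,d\mu<\infty$. For $(v_1,\dots,v_{k-1})\in\mathcal{A}_1$ let $g_1(v_1,\dots,v_{k-1})=\inf\{\int\phi_k\,d\mu : \mu\in\mathcal{M}_1((0,\infty)),\ h(\mu)\ne-\infty,\ \int\phi_i\,d\mu=v_i\ (1\le i\le k-1)\}$. It is assumed that $g_1:\mathcal{A}_1\to\mathbb{R}$ is continuous. The admissible set is $\mathcal{A}=\{(v_1,\dots,v_k): (v_1,\dots,v_{k-1})\in\mathcal{A}_1,\ v_k>g_1(v_1,\dots,v_{k-1})\}$. Let $H(p_1,\dots,p_k)=\log\int e^{p_1\phi_1+\dots+p_k\phi_k}d\lambda\in(-\infty,\infty]$ on $\mathbb{R}^k$, a convex function with subdifferential $\partial H$. Let $\pi_1(v_1,\dots,v_k)=(v_1,\dots,v_{k-1})$ and $\pi_2(v_1,\dots,v_k)=v_k$. $\mathcal{S}_1\subset\mathcal{A}_1$ is the set of $(v_1,\dots,v_{k-1})\in\mathcal{A}_1$ such that $(v_1,\dots,v_{k-1})\in\pi_1(\partial H(p_1,\dots,p_{k-1},0))$ for some $p_1,\dots,p_{k-1}\in\mathbb{R}$ (such $p$'s are then unique); for these $p$'s, $g_2(v_1,\dots,v_{k-1})=\inf\pi_2(\partial H(p_1,\dots,p_{k-1},0))$. Finally $\mathcal{S}_2=\mathcal{A}_1\setminus\mathcal{S}_1$. *)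

theory Defs
  imports "HOL-Probability.Probability"
begin

text \<open>
  Indices run over \<open>{1..k}\<close>; a vector of \<open>\<real>\<^sup>I\<close> is an element of \<open>I \<rightarrow>\<^sub>E UNIV\<close>
  (value \<open>undefined\<close> outside \<open>I\<close>).  The functions \<open>\<phi> i\<close> are total in HOL, but only their values
  on \<open>{0<..}\<close> matter.
\<close>

definition borel_pos :: "real measure" where
  "borel_pos = restrict_space borel {0<..}"

definition leb_pos :: "real measure" where
  "leb_pos = restrict_space lborel {0<..}"

definition probs :: "'a measure \<Rightarrow> 'a measure set" where
  "probs N = {\<mu>. prob_space \<mu> \<and> sets \<mu> = sets N}"

text \<open>
  The negative and the positive part of \<open>f log f\<close> are integrated separately; the Bochner integral
  would give \<open>0\<close> whenever \<open>f log f\<close> is not integrable, hiding the value \<open>-\<infinity>\<close>.  (If both parts have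
  infinite integral the entropy is undefined; \<open>\<infinity> - \<infinity> = \<infinity>\<close> then holds by convention.  For measures
  with finite \<open>\<phi>\<^sub>1\<close>-moment this does not occur.)
\<close>
definition diff_entropy :: "real measure \<Rightarrow> ereal" where
  "diff_entropy \<mu> =
     (if absolutely_continuous leb_pos \<mu> then
        (let f = (\<lambda>x. enn2real (RN_deriv leb_pos \<mu> x)) in
           enn2ereal (\<integral>\<^sup>+x. ennreal (- (f x * ln (f x))) \<partial>leb_pos)
         - enn2ereal (\<integral>\<^sup>+x. ennreal (f x * ln (f x)) \<partial>leb_pos))
      else - \<infinity>)"

text \<open>
  The measure \<open>1/Z w dx\<close>.  If \<open>w\<close> is not integrable then \<open>Z = 0\<close> and this is the zero measure,
  hence not an element of \<open>probs borel_pos\<close>.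
\<close>
definition normalized :: "(real \<Rightarrow> real) \<Rightarrow> real measure" where
  "normalized w = density leb_pos (\<lambda>x. ennreal (w x / (\<integral>y. w y \<partial>leb_pos)))"

definition base_law :: "(nat \<Rightarrow> real \<Rightarrow> real) \<Rightarrow> real measure" where
  "base_law \<phi> = normalized (\<lambda>x. exp (- \<phi> 1 x))"

definition euclid :: "nat set \<Rightarrow> (nat \<Rightarrow> real) topology" where
  "euclid I = product_topology (\<lambda>_. euclideanreal) I"

definition A1_set :: "nat \<Rightarrow> (nat \<Rightarrow> real \<Rightarrow> real) \<Rightarrow> (nat \<Rightarrow> real) set" where
  "A1_set k \<phi> = euclid {1..<k} interior_of
     {v \<in> {1..<k} \<rightarrow>\<^sub>E {0<..}. \<exists>\<mu> \<in> probs borel_pos.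
        diff_entropy \<mu> \<noteq> - \<infinity> \<and>
        (\<forall>i\<in>{1..<k}. has_bochner_integral \<mu> (\<phi> i) (v i)) \<and>
        integrable \<mu> (\<phi> k)}"

text \<open>The infimum is taken in \<open>[0,\<infinity>]\<close>; on \<open>A1_set k \<phi>\<close> it is finite.\<close>
definition g1 :: "nat \<Rightarrow> (nat \<Rightarrow> real \<Rightarrow> real) \<Rightarrow> (nat \<Rightarrow> real) \<Rightarrow> real" where
  "g1 k \<phi> v = enn2real (INF \<mu> \<in> {\<mu> \<in> probs borel_pos.
        diff_entropy \<mu> \<noteq> - \<infinity> \<and>
        (\<forall>i\<in>{1..<k}. has_bochner_integral \<mu> (\<phi> i) (v i))}.
      \<integral>\<^sup>+x. ennreal (\<phi> k x) \<partial>\<mu>)"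

definition proj1 :: "nat \<Rightarrow> (nat \<Rightarrow> real) \<Rightarrow> (nat \<Rightarrow> real)" where
  "proj1 k v = restrict v {1..<k}"

definition proj2 :: "nat \<Rightarrow> (nat \<Rightarrow> real) \<Rightarrow> real" where
  "proj2 k v = v k"

definition admissible :: "nat \<Rightarrow> (nat \<Rightarrow> real \<Rightarrow> real) \<Rightarrow> (nat \<Rightarrow> real) set" where
  "admissible k \<phi> = {v \<in> {1..k} \<rightarrow>\<^sub>E UNIV. proj1 k v \<in> A1_set k \<phi> \<and> v k > g1 k \<phi> (proj1 k v)}"

definition log_mgf :: "nat \<Rightarrow> (nat \<Rightarrow> real \<Rightarrow> real) \<Rightarrow> (nat \<Rightarrow> real) \<Rightarrow> ereal" where
  "log_mgf k \<phi> p =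
     (let m = (\<integral>\<^sup>+x. ennreal (exp (\<Sum>i\<in>{1..k}. p i * \<phi> i x)) \<partial>base_law \<phi>)
      in if m = \<infinity> then \<infinity> else ereal (ln (enn2real m)))"

definition subdiff :: "nat \<Rightarrow> ((nat \<Rightarrow> real) \<Rightarrow> ereal) \<Rightarrow> (nat \<Rightarrow> real) \<Rightarrow> (nat \<Rightarrow> real) set" where
  "subdiff k F p = {v \<in> {1..k} \<rightarrow>\<^sub>E UNIV. \<forall>q \<in> {1..k} \<rightarrow>\<^sub>E UNIV.
      F p + ereal (\<Sum>i\<in>{1..k}. v i * (q i - p i)) \<le> F q}"

text \<open>The parameters \<open>p\<^sub>1, \<dots>, p\<^sub>k\<^sub>-\<^sub>1\<close> with \<open>v \<in> \<pi>\<^sub>1 (\<partial>H (p\<^sub>1, \<dots>, p\<^sub>k\<^sub>-\<^sub>1, 0))\<close>.\<close>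
definition S1_params :: "nat \<Rightarrow> (nat \<Rightarrow> real \<Rightarrow> real) \<Rightarrow> (nat \<Rightarrow> real) \<Rightarrow> (nat \<Rightarrow> real) set" where
  "S1_params k \<phi> v =
     {p \<in> {1..<k} \<rightarrow>\<^sub>E UNIV. v \<in> proj1 k ` subdiff k (log_mgf k \<phi>) (p(k := 0))}"

definition S1_set :: "nat \<Rightarrow> (nat \<Rightarrow> real \<Rightarrow> real) \<Rightarrow> (nat \<Rightarrow> real) set" where
  "S1_set k \<phi> = {v \<in> A1_set k \<phi>. S1_params k \<phi> v \<noteq> {}}"

definition S2_set :: "nat \<Rightarrow> (nat \<Rightarrow> real \<Rightarrow> real) \<Rightarrow> (nat \<Rightarrow> real) set" where
  "S2_set k \<phi> = A1_set k \<phi> - S1_set k \<phi>"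

text \<open>Meaningful for \<open>v \<in> S1_set k \<phi>\<close>, where the chosen parameter vector is the unique one.\<close>
definition g2 :: "nat \<Rightarrow> (nat \<Rightarrow> real \<Rightarrow> real) \<Rightarrow> (nat \<Rightarrow> real) \<Rightarrow> real" where
  "g2 k \<phi> v = (let p = (SOME p. p \<in> S1_params k \<phi> v)
     in Inf (proj2 k ` subdiff k (log_mgf k \<phi>) (p(k := 0))))"

definition emp_mean :: "(nat \<Rightarrow> real \<Rightarrow> real) \<Rightarrow> nat \<Rightarrow> nat \<Rightarrow> (nat \<Rightarrow> real) \<Rightarrow> real" where
  "emp_mean \<phi> i n \<omega> = (\<Sum>m\<in>{1..n}. \<phi> i (\<omega> m)) / real n"

text \<open>Sequences are indexed by \<open>{1..}\<close>, so the coordinate projection \<open>X\<^sub>m\<close> is \<open>\<lambda>\<omega>. \<omega> m\<close>.\<close>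
definition iid_law :: "(nat \<Rightarrow> real \<Rightarrow> real) \<Rightarrow> (nat \<Rightarrow> real) measure" where
  "iid_law \<phi> = PiM {1..} (\<lambda>_. base_law \<phi>)"

definition cond_event ::
  "nat \<Rightarrow> (nat \<Rightarrow> real \<Rightarrow> real) \<Rightarrow> (nat \<Rightarrow> real) \<Rightarrow> nat \<Rightarrow> real \<Rightarrow> (nat \<Rightarrow> real) set" where
  "cond_event k \<phi> a n \<delta> =
     {\<omega> \<in> space (iid_law \<phi>). \<forall>i\<in>{1..k}. \<bar>emp_mean \<phi> i n \<omega> - a i\<bar> \<le> \<delta>}"

definition borel_pos_pow :: "nat \<Rightarrow> (nat \<Rightarrow> real) measure" where
  "borel_pos_pow j = PiM {1..j} (\<lambda>_. borel_pos)"

text \<open>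
  The conditional law of \<open>(X\<^sub>1, \<dots>, X\<^sub>j)\<close>.  It is the zero measure if the conditioning event is null.
\<close>
definition cond_law ::
  "nat \<Rightarrow> (nat \<Rightarrow> real \<Rightarrow> real) \<Rightarrow> (nat \<Rightarrow> real) \<Rightarrow> nat \<Rightarrow> nat \<Rightarrow> real \<Rightarrow> (nat \<Rightarrow> real) measure" where
  "cond_law k \<phi> a j n \<delta> =
     distr (uniform_measure (iid_law \<phi>) (cond_event k \<phi> a n \<delta>)) (borel_pos_pow j)
       (\<lambda>\<omega>. restrict \<omega> {1..j})"

definition weak_limit ::
  "'b topology \<Rightarrow> ('a \<Rightarrow> 'b measure) \<Rightarrow> 'b measure \<Rightarrow> 'a filter \<Rightarrow> bool" where
  "weak_limit T M N F \<longleftrightarrow>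
     (\<forall>f. continuous_map T euclideanreal f \<and> bounded (f ` topspace T) \<longrightarrow>
        ((\<lambda>t. \<integral>x. f x \<partial>M t) \<longlongrightarrow> (\<integral>x. f x \<partial>N)) F)"

definition pos_pow_top :: "nat \<Rightarrow> (nat \<Rightarrow> real) topology" where
  "pos_pow_top j = product_topology (\<lambda>_. top_of_set {0<..}) {1..j}"

text \<open>
  \<open>lim\<^sub>\<delta>\<^sub>\<rightarrow>\<^sub>0 lim\<^sub>n\<^sub>\<rightarrow>\<^sub>\<infinity> M n \<delta> = N\<close>: for all small \<open>\<delta> > 0\<close> the inner weak limit exists as a probability
  measure \<open>\<nu> \<delta>\<close>, and these inner limits converge weakly to \<open>N\<close>.
\<close>
definition iterated_weak_limit ::
  "nat \<Rightarrow> (nat \<Rightarrow> real \<Rightarrow> (nat \<Rightarrow> real) measure) \<Rightarrow> (nat \<Rightarrow> real) measure \<Rightarrow> bool" where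
  "iterated_weak_limit j M N \<longleftrightarrow>
     (\<exists>\<nu>. (\<forall>\<^sub>F \<delta> in at_right 0. \<nu> \<delta> \<in> probs (borel_pos_pow j) \<and>
              weak_limit (pos_pow_top j) (\<lambda>n. M n \<delta>) (\<nu> \<delta>) sequentially) \<and>
          weak_limit (pos_pow_top j) \<nu> N (at_right 0))"

definition is_limit_law ::
  "nat \<Rightarrow> (nat \<Rightarrow> real \<Rightarrow> real) \<Rightarrow> (nat \<Rightarrow> real) \<Rightarrow> real measure \<Rightarrow> bool" where
  "is_limit_law k \<phi> a \<mu> \<longleftrightarrow>
     \<mu> \<in> probs borel_pos \<and>
     (proj1 k a \<in> S1_set k \<phi> \<and> a k \<ge> g2 k \<phi> (proj1 k a) \<longrightarrow>
        (\<exists>p :: nat \<Rightarrow> real.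
           \<mu> = normalized (\<lambda>x. exp (\<Sum>i\<in>{1..<k}. p i * \<phi> i x)) \<and>
           (\<forall>i\<in>{1..<k}. has_bochner_integral \<mu> (\<phi> i) (a i)))) \<and>
     (proj1 k a \<in> S2_set k \<phi> \<or> (proj1 k a \<in> S1_set k \<phi> \<and> a k < g2 k \<phi> (proj1 k a)) \<longrightarrow>
        (\<exists>p :: nat \<Rightarrow> real. p k < 0 \<and>
           \<mu> = normalized (\<lambda>x. exp (\<Sum>i\<in>{1..k}. p i * \<phi> i x)) \<and>
           (\<forall>i\<in>{1..k}. has_bochner_integral \<mu> (\<phi> i) (a i))))"

end

theory Submission
  imports Defs "HOL-Real_Asymp.Real_Asymp"
begin

text \<open>
  Write \<open>\<lambda>\<close> for the base law and, for a parameter vector \<open>p\<close> and a window size \<open>d \<ge> 0\<close>, let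
  \<open>F\<^sub>d(p) = \<integral> exp (\<Sum>i. p\<^sub>i (\<phi>\<^sub>i - a\<^sub>i) + d \<bar>p\<^sub>i\<bar>) d\<lambda>\<close>.  The logarithm of \<open>F\<^sub>d\<close> is the negative of the
  dual objective of the problem of minimizing relative entropy with respect to \<open>\<lambda>\<close> under the
  constraints \<open>\<bar>\<integral> \<phi>\<^sub>i d\<mu> - a\<^sub>i\<bar> \<le> d\<close>.  The whole proof is organized around a minimizer \<open>p\<close> of \<open>F\<^sub>d\<close>
  and the tilted law \<open>exp (\<Sum>i. p\<^sub>i (\<phi>\<^sub>i - a\<^sub>i) + d \<bar>p\<^sub>i\<bar>) d\<lambda> / F\<^sub>d(p)\<close>.

  \<^emph>\<open>Minimizers.\<close>  Since \<open>\<phi>\<^sub>k\<close> dominates every other \<open>\<phi>\<^sub>i\<close>, \<open>F\<^sub>d(p) = \<infinity>\<close> when \<open>p\<^sub>k > 0\<close>.  Around an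
  admissible point there are measures of finite entropy whose first \<open>k - 1\<close> moments are those of \<open>a\<close>,
  or differ from them by \<open>\<plusminus> r\<close> in one coordinate, and whose \<open>k\<close>-th moment is below \<open>a\<^sub>k\<close>; here
  openness of the moment set and continuity of \<open>g1\<close> enter.  Jensen's inequality for these finitely
  many measures gives \<open>F\<^sub>d(p) \<ge> c exp (r \<bar>p\<^sub>i\<bar>)\<close> uniformly in \<open>d\<close> (\<open>admissible_coercive\<close>), so
  minimizers exist (\<open>minimizer_exists\<close>).  Differentiating along rays gives the first-order conditions
  \<open>minimizer_moments\<close>: the tilted means lie in the window, the \<open>k\<close>-th one possibly below it, and
  complementary slackness holds.

  \<^emph>\<open>Lower bound.\<close>  The conditioning event has probability at least \<open>F\<^sub>d(p)\<^sup>n e\<^sup>-\<^sup>o\<^sup>(\<^sup>n\<^sup>)\<close>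
  (\<open>cond_event_probability\<close>).  Under the tilted law of a slightly smaller window the empirical means
  are close to the tilted means by the law of large numbers.  The only thing that may be missing is a
  part of the \<open>k\<close>-th mean, and it is supplied by a single coordinate with \<open>\<phi>\<^sub>k\<close> of order \<open>n\<close>.  Such a
  value costs only \<open>e\<^sup>-\<^sup>o\<^sup>(\<^sup>n\<^sup>)\<close>, because \<open>\<phi>\<^sub>1\<close>, and with it the exponent of \<open>\<lambda>\<close>, is then \<open>o(n)\<close>; for
  the same reason the other means do not notice it (\<open>jump_probability\<close>).

  \<^emph>\<open>Fixed window.\<close>  On the conditioning event the product of the unnormalized tilting factors is at
  least \<open>1\<close>.  Hence exponential moments of block sums under the conditional law are at most
  \<open>e\<^sup>o\<^sup>(\<^sup>n\<^sup>)\<close> times the corresponding ones for independent tilted variables.  Exchangeability and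
  Jensen's inequality turn this into convergence of the conditional law of \<open>j\<close> coordinates to the
  product of the tilted law (\<open>cond_law_weak_limit\<close>).

  \<^emph>\<open>Shrinking window.\<close>  \<open>F\<^sub>0\<close> at the midpoint of two parameters bounds the Hellinger affinity of the
  tilted laws from below, so minimality alone yields continuity in \<open>d\<close> at \<open>0\<close>
  (\<open>minimizer_affinity\<close>, \<open>tilted_weak_limit\<close>).

  \<^emph>\<open>Identification.\<close>  A vector \<open>v\<close> is a subgradient of the logarithmic moment generating function at
  \<open>p\<close> exactly when \<open>p\<close> minimizes \<open>F\<^sub>0\<close> with \<open>v\<close> in place of \<open>a\<close>.  With \<open>p\<^sub>k = 0\<close> this holds for all \<open>v\<close>
  whose first \<open>k - 1\<close> coordinates are the tilted means and whose last one is at least the \<open>k\<close>-th tilted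
  mean, which is therefore the value of \<open>g2\<close>.  So a minimizer for \<open>a\<close> with \<open>p\<^sub>k = 0\<close> exists precisely
  in the first case of the theorem.
\<close>

section \<open>Product measures, blocks and test functions\<close>

lemma PiM_density:
  fixes u :: "'a \<Rightarrow> real"
  assumes M: "prob_space M" and u[measurable]: "u \<in> borel_measurable M" and nn: "\<And>x. 0 \<le> u x"
    and D: "prob_space (density M (\<lambda>x. ennreal (u x)))" and fin: "finite I"
  shows "PiM I (\<lambda>_. density M (\<lambda>x. ennreal (u x)))
    = density (PiM I (\<lambda>_. M)) (\<lambda>x. ennreal (\<Prod>i\<in>I. u (x i)))"
proof -
  interpret M: prob_space M by fact
  interpret D: prob_space "density M (\<lambda>x. ennreal (u x))" by fact
  interpret PD: product_sigma_finite "\<lambda>_. density M (\<lambda>x. ennreal (u x))"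
    by (simp add: product_sigma_finite_def D.sigma_finite_measure_axioms)
  interpret PM: product_sigma_finite "\<lambda>_. M"
    by (simp add: product_sigma_finite_def M.sigma_finite_measure_axioms)
  show ?thesis
  proof (rule PD.PiM_eqI[symmetric, OF fin])
    show "sets (density (PiM I (\<lambda>_. M)) (\<lambda>x. ennreal (\<Prod>i\<in>I. u (x i))))
      = sets (PiM I (\<lambda>_. density M (\<lambda>x. ennreal (u x))))"
      by (simp cong: sets_PiM_cong)
  next
    fix A assume A: "\<And>i. i \<in> I \<Longrightarrow> A i \<in> sets (density M (\<lambda>x. ennreal (u x)))"
    have meas: "Pi\<^sub>E I A \<in> sets (PiM I (\<lambda>_. M))"
      using A by (intro sets_PiM_I_finite fin) auto
    have "emeasure (density (PiM I (\<lambda>_. M)) (\<lambda>x. ennreal (\<Prod>i\<in>I. u (x i)))) (Pi\<^sub>E I A)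
      = (\<integral>\<^sup>+x. ennreal (\<Prod>i\<in>I. u (x i)) * indicator (Pi\<^sub>E I A) x \<partial>PiM I (\<lambda>_. M))"
      using meas by (subst emeasure_density) auto
    also have "\<dots> = (\<integral>\<^sup>+x. (\<Prod>i\<in>I. ennreal (u (x i)) * indicator (A i) (x i)) \<partial>PiM I (\<lambda>_. M))"
    proof (rule nn_integral_cong)
      fix x assume x: "x \<in> space (PiM I (\<lambda>_. M))"
      have ind: "(indicator (Pi\<^sub>E I A) x :: ennreal) = (\<Prod>i\<in>I. indicator (A i) (x i))"
        using x fin by (auto simp: indicator_def space_PiM PiE_iff prod_zero_iff split: if_splits)
      show "ennreal (\<Prod>i\<in>I. u (x i)) * indicator (Pi\<^sub>E I A) x
        = (\<Prod>i\<in>I. ennreal (u (x i)) * indicator (A i) (x i))"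
        unfolding ind prod.distrib by (simp add: prod_ennreal nn)
    qed
    also have "\<dots> = (\<Prod>i\<in>I. \<integral>\<^sup>+x. ennreal (u x) * indicator (A i) x \<partial>M)"
      using A fin by (intro PM.product_nn_integral_prod) auto
    also have "\<dots> = (\<Prod>i\<in>I. emeasure (density M (\<lambda>x. ennreal (u x))) (A i))"
      using A by (intro prod.cong refl) (auto simp: emeasure_density)
    finally show "emeasure (density (PiM I (\<lambda>_. M)) (\<lambda>x. ennreal (\<Prod>i\<in>I. u (x i)))) (Pi\<^sub>E I A)
      = (\<Prod>i\<in>I. emeasure (density M (\<lambda>x. ennreal (u x))) (A i))" .
  qed
qed

lemma indep_vars_coordinates:
  assumes M: "prob_space M" and I: "I \<noteq> {}"
  shows "prob_space.indep_vars (PiM I (\<lambda>_. M)) (\<lambda>_. M) (\<lambda>i x. x i) I"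
proof -
  interpret P: prob_space "PiM I (\<lambda>_. M)" by (intro prob_space_PiM M)
  have "distr (PiM I (\<lambda>_. M)) (PiM I (\<lambda>_. M)) (\<lambda>x. \<lambda>i\<in>I. x i) = PiM I (\<lambda>_. M)"
    by (subst distr_cong[where g="\<lambda>x. x"]) (auto simp: space_PiM intro!: distr_id)
  also have "\<dots> = PiM I (\<lambda>i. distr (PiM I (\<lambda>_. M)) M (\<lambda>x. x i))"
    by (intro PiM_cong refl distr_PiM_component[symmetric] M)
  finally show ?thesis
    using I by (subst P.indep_vars_iff_distr_eq_PiM') auto
qed

lemma integral_PiM_component:
  fixes g :: "'a \<Rightarrow> real"
  assumes M: "prob_space M" and i: "i \<in> I" and g: "integrable M g"
  shows "integrable (PiM I (\<lambda>_. M)) (\<lambda>x. g (x i))"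
    and "(\<integral>x. g (x i) \<partial>PiM I (\<lambda>_. M)) = integral\<^sup>L M g"
proof -
  have d: "distr (PiM I (\<lambda>_. M)) M (\<lambda>x. x i) = M"
    using i M by (intro distr_PiM_component) auto
  have [measurable]: "g \<in> borel_measurable M" using g by auto
  have [measurable]: "(\<lambda>x. x i) \<in> measurable (PiM I (\<lambda>_. M)) M"
    using i by auto
  show "integrable (PiM I (\<lambda>_. M)) (\<lambda>x. g (x i))"
    using g by (subst (asm) d[symmetric], subst (asm) integrable_distr_eq) auto
  show "(\<integral>x. g (x i) \<partial>PiM I (\<lambda>_. M)) = integral\<^sup>L M g"
    by (subst (2) d[symmetric], subst integral_distr) auto
qed

lemma nn_integral_PiM_reindex:
  assumes M: "prob_space M" and f: "inj_on f I" "f \<in> I \<rightarrow> K"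
    and G[measurable]: "G \<in> borel_measurable (PiM I (\<lambda>_. M))"
  shows "(\<integral>\<^sup>+\<omega>. G (\<lambda>i\<in>I. \<omega> (f i)) \<partial>PiM K (\<lambda>_. M)) = (\<integral>\<^sup>+x. G x \<partial>PiM I (\<lambda>_. M))"
proof -
  have [measurable]: "(\<lambda>\<omega>. \<lambda>i\<in>I. \<omega> (f i)) \<in> measurable (PiM K (\<lambda>_. M)) (PiM I (\<lambda>_. M))"
    using f(2) by (intro measurable_restrict measurable_component_singleton) auto
  have "distr (PiM K (\<lambda>_. M)) (PiM I (\<lambda>_. M)) (\<lambda>\<omega>. \<lambda>i\<in>I. \<omega> (f i)) = PiM I (\<lambda>_. M)"
    using distr_PiM_reindex[of K "\<lambda>_. M" f I] M f by simp
  then have "(\<integral>\<^sup>+x. G x \<partial>PiM I (\<lambda>_. M))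
    = (\<integral>\<^sup>+x. G x \<partial>distr (PiM K (\<lambda>_. M)) (PiM I (\<lambda>_. M)) (\<lambda>\<omega>. \<lambda>i\<in>I. \<omega> (f i)))" by simp
  also have "\<dots> = (\<integral>\<^sup>+\<omega>. G (\<lambda>i\<in>I. \<omega> (f i)) \<partial>PiM K (\<lambda>_. M))"
    by (rule nn_integral_distr) auto
  finally show ?thesis by simp
qed

lemma integral_PiM_permute:
  fixes F :: "(nat \<Rightarrow> 'a) \<Rightarrow> real"
  assumes M: "prob_space M" and \<pi>: "inj_on \<pi> {1..}" "\<pi> \<in> {1..} \<rightarrow> {1..}"
    and F: "F \<in> borel_measurable (PiM {1..} (\<lambda>_. M))"
  shows "(\<integral>\<omega>. F (\<lambda>i\<in>{1..}. \<omega> (\<pi> i)) \<partial>PiM {1..} (\<lambda>_. M)) = (\<integral>\<omega>. F \<omega> \<partial>PiM {1..} (\<lambda>_. M))"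
proof -
  have m: "(\<lambda>\<omega>. \<lambda>i\<in>{1..}. \<omega> (\<pi> i)) \<in> measurable (PiM {1..} (\<lambda>_. M)) (PiM {1..} (\<lambda>_. M))"
    using \<pi>(2) by (intro measurable_restrict measurable_component_singleton) auto
  have "distr (PiM {1..} (\<lambda>_. M)) (PiM {1..} (\<lambda>_. M)) (\<lambda>\<omega>. \<lambda>i\<in>{1..}. \<omega> (\<pi> i)) = PiM {1..} (\<lambda>_. M)"
    using distr_PiM_reindex[of "{1..}" "\<lambda>_. M" \<pi> "{1..}"] M \<pi> by simp
  then show ?thesis using integral_distr[OF m F] by simp
qed

lemma sum_blocks:
  fixes f :: "nat \<Rightarrow> real"
  shows "(\<Sum>l\<in>{1..m * j + r}. f l) = (\<Sum>b<m. \<Sum>i\<in>{1..j}. f (b * j + i)) + (\<Sum>l\<in>{m * j + 1..m * j + r}. f l)"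
proof -
  have shift: "(\<Sum>i\<in>{1..j}. f (c + i)) = (\<Sum>l\<in>{c + 1..c + j}. f l)" for c
    by (rule sum.reindex_bij_witness[of _ "\<lambda>l. l - c" "\<lambda>i. c + i"]) auto
  have split: "(\<Sum>l\<in>{1..c + s}. f l) = (\<Sum>l\<in>{1..c}. f l) + (\<Sum>l\<in>{c + 1..c + s}. f l)" for c s
  proof -
    have "{1..c + s} = {1..c} \<union> {c + 1..c + s}" by auto
    then show ?thesis by (simp only:) (intro sum.union_disjoint, auto)
  qed
  have "(\<Sum>b<m. \<Sum>i\<in>{1..j}. f (b * j + i)) = (\<Sum>l\<in>{1..m * j}. f l)"
  proof (induction m)
    case (Suc m)
    have "(\<Sum>l\<in>{1..Suc m * j}. f l) = (\<Sum>l\<in>{1..m * j + j}. f l)" by (simp add: add.commute)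
    then show ?case using Suc split[of "m * j" j] shift[of "m * j"] by simp
  qed simp
  then show ?thesis using split[of "m * j" r] by simp
qed

text \<open>
  The first \<open>m * j + r\<close> coordinates are cut into \<open>m\<close> blocks of length \<open>j\<close> and a remainder of length
  \<open>r\<close>; these are independent, and each block is distributed like the first one.
\<close>
lemma nn_integral_PiM_blocks:
  fixes G :: "(nat \<Rightarrow> 'a) \<Rightarrow> real" and g :: "'a \<Rightarrow> real"
  assumes M: "prob_space M"
    and G[measurable]: "G \<in> borel_measurable (PiM {1..j} (\<lambda>_. M))"
    and g[measurable]: "g \<in> borel_measurable M"
    and G0: "\<And>x. 0 \<le> G x" and g0: "\<And>x. 0 \<le> g x"
  shows "(\<integral>\<^sup>+\<omega>. ennreal ((\<Prod>b<m. G (\<lambda>i\<in>{1..j}. \<omega> (b * j + i))) * (\<Prod>l\<in>{m * j + 1..m * j + r}. g (\<omega> l)))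
      \<partial>PiM {1..} (\<lambda>_. M))
    = (\<integral>\<^sup>+x. ennreal (G x) \<partial>PiM {1..j} (\<lambda>_. M)) ^ m * (\<integral>\<^sup>+x. ennreal (g x) \<partial>M) ^ r"
proof -
  interpret M: prob_space M by fact
  interpret PM: product_sigma_finite "\<lambda>_. M"
    by (simp add: product_sigma_finite_def M.sigma_finite_measure_axioms)
  let ?P = "PiM {1::nat..} (\<lambda>_. M)"
  interpret P: prob_space ?P by (intro prob_space_PiM M)
  define K where "K b = (if b < m then {b * j + 1..b * j + j} else {m * j + 1..m * j + r})" for b :: nat
  have sub: "K b \<subseteq> {1..}" for b by (auto simp: K_def)
  have disj: "disjoint_family_on K {..m}"
  proof (unfold disjoint_family_on_def, intro ballI impI)
    fix b c assume bc: "b \<in> {..m}" "c \<in> {..m}" "b \<noteq> c"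
    have *: "K b \<inter> K c = {}" if "b < c" "c \<le> m" for b c
    proof -
      have "(b + 1) * j \<le> c * j" using that by (intro mult_right_mono) auto
      then show ?thesis using that by (auto simp: K_def)
    qed
    show "K b \<inter> K c = {}"
      using *[of b c] *[of c b] bc by (cases b c rule: linorder_cases) auto
  qed
  define F where "F b z = (if b < m then G (\<lambda>i\<in>{1..j}. z (b * j + i)) else (\<Prod>l\<in>{m * j + 1..m * j + r}. g (z l)))"
    for b and z :: "nat \<Rightarrow> 'a"
  have Fm: "F b \<in> borel_measurable (PiM (K b) (\<lambda>_. M))" for b
  proof (cases "b < m")
    case True
    have "(\<lambda>z. \<lambda>i\<in>{1..j}. z (b * j + i)) \<in> measurable (PiM (K b) (\<lambda>_. M)) (PiM {1..j} (\<lambda>_. M))"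
      using True by (intro measurable_restrict measurable_component_singleton) (auto simp: K_def)
    from measurable_compose[OF this G] show ?thesis using True unfolding F_def by simp
  next
    case False
    have "(\<lambda>z. z l) \<in> measurable (PiM (K b) (\<lambda>_. M)) M" if "l \<in> {m * j + 1..m * j + r}" for l
      using False that by (intro measurable_component_singleton) (auto simp: K_def)
    then show ?thesis using False unfolding F_def by (auto intro!: borel_measurable_prod)
  qed
  have ind: "P.indep_vars (\<lambda>_. borel) (\<lambda>b \<omega>. ennreal (F b (restrict (\<lambda>i. \<omega> i) (K b)))) {..m}"
    by (rule P.indep_vars_compose2[OF P.indep_vars_restrict[OF indep_vars_coordinates[OF M] _ disj]])
       (use sub Fm in auto)
  have Fr: "F b (restrict \<omega> (K b)) = F b \<omega>" for b \<omega>
    unfolding F_def K_def by (auto intro!: arg_cong[where f=G] prod.cong restrict_ext)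
  have F0: "0 \<le> F b z" for b z by (auto simp: F_def G0 g0 prod_nonneg)
  have "(\<integral>\<^sup>+\<omega>. ennreal ((\<Prod>b<m. G (\<lambda>i\<in>{1..j}. \<omega> (b * j + i))) * (\<Prod>l\<in>{m * j + 1..m * j + r}. g (\<omega> l))) \<partial>?P)
    = (\<integral>\<^sup>+\<omega>. (\<Prod>b\<le>m. ennreal (F b \<omega>)) \<partial>?P)"
    by (simp add: prod_ennreal F0, simp add: F_def lessThan_Suc_atMost[symmetric])
  also have "\<dots> = (\<Prod>b\<le>m. \<integral>\<^sup>+\<omega>. F b \<omega> \<partial>?P)"
    using P.indep_vars_nn_integral[OF _ ind] F0 by (simp add: Fr)
  also have "\<dots> = (\<Prod>b<m. \<integral>\<^sup>+\<omega>. F b \<omega> \<partial>?P) * (\<integral>\<^sup>+\<omega>. F m \<omega> \<partial>?P)"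
    by (simp add: lessThan_Suc_atMost[symmetric])
  also have "(\<Prod>b<m. \<integral>\<^sup>+\<omega>. F b \<omega> \<partial>?P) = (\<Prod>b<m. \<integral>\<^sup>+x. ennreal (G x) \<partial>PiM {1..j} (\<lambda>_. M))"
  proof (intro prod.cong refl)
    fix b assume b: "b \<in> {..<m}"
    show "(\<integral>\<^sup>+\<omega>. F b \<omega> \<partial>?P) = (\<integral>\<^sup>+x. ennreal (G x) \<partial>PiM {1..j} (\<lambda>_. M))"
      using b nn_integral_PiM_reindex[OF M, of "\<lambda>i. b * j + i" "{1..j}" "{1..}" "\<lambda>x. ennreal (G x)",
          OF _ _ measurable_compose[OF G measurable_ennreal]]
      by (auto simp: F_def)
  qed
  also have "(\<integral>\<^sup>+\<omega>. F m \<omega> \<partial>?P) = (\<integral>\<^sup>+x. ennreal (g x) \<partial>M) ^ r"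
  proof -
    let ?R = "{m * j + 1..m * j + r}"
    have "(\<integral>\<^sup>+\<omega>. F m \<omega> \<partial>?P) = (\<integral>\<^sup>+\<omega>. (\<lambda>z. \<Prod>l\<in>?R. ennreal (g (z l))) (\<lambda>i\<in>?R. \<omega> (id i)) \<partial>?P)"
      by (intro nn_integral_cong) (auto simp: F_def prod_ennreal g0 intro!: prod.cong)
    also have "\<dots> = (\<integral>\<^sup>+z. (\<Prod>l\<in>?R. ennreal (g (z l))) \<partial>PiM ?R (\<lambda>_. M))"
      by (rule nn_integral_PiM_reindex[OF M]) auto
    also have "\<dots> = (\<Prod>l\<in>?R. \<integral>\<^sup>+x. ennreal (g x) \<partial>M)"
      by (intro PM.product_nn_integral_prod) auto
    also have "\<dots> = (\<integral>\<^sup>+x. ennreal (g x) \<partial>M) ^ r" by simp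
    finally show ?thesis .
  qed
  finally show ?thesis by (simp only: prod_constant card_lessThan)
qed

lemma integral_uniform_measure:
  fixes g :: "'a \<Rightarrow> real"
  assumes P: "prob_space P" and C: "C \<in> sets P" "measure P C > 0" and g: "g \<in> borel_measurable P"
  shows "(\<integral>x. g x \<partial>uniform_measure P C) = (\<integral>x. indicator C x * g x \<partial>P) / measure P C"
proof -
  interpret prob_space P by fact
  have "uniform_measure P C = density P (\<lambda>x. ennreal (indicator C x / measure P C))"
    unfolding uniform_measure_def using C
    by (intro density_cong) (auto simp: emeasure_eq_measure divide_ennreal indicator_def
        ennreal_zero_divide simp flip: ennreal_1 intro!: borel_measurable_divide)
  then have "(\<integral>x. g x \<partial>uniform_measure P C) = (\<integral>x. (indicator C x / measure P C) * g x \<partial>P)"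
    using C g by (simp add: integral_density)
  also have "\<dots> = (\<integral>x. (indicator C x * g x) / measure P C \<partial>P)" by (simp add: field_simps)
  finally show ?thesis by simp
qed

text \<open>
  The finite power of \<open>(0,\<infinity>)\<close> is modelled by extensional functions, for which the product
  \<open>\<sigma>\<close>-algebra is not literally a Borel \<open>\<sigma>\<close>-algebra of a type.  Measurability is transported from the
  open set of functions on all of \<open>\<nat>\<close> that are positive on the first \<open>j\<close> indices.
\<close>
lemma continuous_map_pos_pow_measurable:
  assumes f: "continuous_map (pos_pow_top j) euclideanreal f"
  shows "f \<in> borel_measurable (borel_pos_pow j)"
proof -
  define S where "S = {y :: nat \<Rightarrow> real. \<forall>i\<in>{1..j}. y i > 0}"
  let ?r = "\<lambda>y :: nat \<Rightarrow> real. restrict y {1..j}"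
  have "continuous_map (top_of_set S) (pos_pow_top j) ?r"
    unfolding pos_pow_top_def continuous_map_componentwise
  proof (intro conjI ballI)
    fix i assume i: "i \<in> {1..j}"
    have "continuous_on S (\<lambda>y. y i)"
      by (rule continuous_on_subset[OF continuous_on_product_coordinates]) auto
    then have "continuous_map (top_of_set S) euclideanreal (\<lambda>y. y i)" by simp
    then have "continuous_map (top_of_set S) (top_of_set {0<..}) (\<lambda>y. y i)"
      using i by (auto simp: continuous_map_in_subtopology S_def)
    then show "continuous_map (top_of_set S) (top_of_set {0<..}) (\<lambda>y. ?r y i)" using i by simp
  qed auto
  from continuous_map_compose[OF this f] have "continuous_on S (f \<circ> ?r)" by simp
  then have g: "(f \<circ> ?r) \<in> borel_measurable (restrict_space borel S)"
    by (rule borel_measurable_continuous_on_restrict)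
  let ?E = "\<lambda>x i. if i \<in> {1..j} then x i else (1::real)"
  have "?E \<in> measurable (borel_pos_pow j) (restrict_space borel S)"
  proof (rule measurable_restrict_space2)
    show "?E \<in> space (borel_pos_pow j) \<rightarrow> S"
      by (auto simp: borel_pos_pow_def space_PiM S_def borel_pos_def space_restrict_space PiE_iff)
    show "?E \<in> borel_measurable (borel_pos_pow j)"
    proof (rule measurable_coordinatewise_then_product)
      fix i
      have id: "(\<lambda>x. x) \<in> borel_measurable borel_pos"
        unfolding borel_pos_def by (rule measurable_restrict_space1) simp
      show "(\<lambda>x. ?E x i) \<in> borel_measurable (borel_pos_pow j)"
      proof (cases "i \<in> {1..j}")
        case True
        have "(\<lambda>x. x i) \<in> measurable (borel_pos_pow j) borel_pos"
          unfolding borel_pos_pow_def using True by (rule measurable_component_singleton)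
        from measurable_compose[OF this id] show ?thesis using True by simp
      next
        case False
        then have "(\<lambda>x. ?E x i) = (\<lambda>_. 1)" by auto
        then show ?thesis by (simp only: borel_measurable_const)
      qed
    qed
  qed
  from measurable_compose[OF this g] have "(\<lambda>x. f (?r (?E x))) \<in> borel_measurable (borel_pos_pow j)"
    by (simp add: comp_def)
  moreover have "f (?r (?E x)) = f x" if "x \<in> space (borel_pos_pow j)" for x
  proof -
    have "x \<in> extensional {1..j}" using that by (simp add: borel_pos_pow_def space_PiM PiE_iff)
    then have "?r (?E x) = x" by (auto simp: fun_eq_iff extensional_def)
    then show ?thesis by simp
  qed
  ultimately show ?thesis by (subst (asm) measurable_cong) auto
qed

section \<open>Laws of large numbers and exponential inequalities\<close>

text \<open>
  Only a first moment is available: under a tilted law with vanishing last parameter, \<open>\<phi>\<^sub>k\<close> need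
  not have a second one.  The function is truncated at a level \<open>R\<close>; Hoeffding's inequality controls
  the truncated mean and Markov's inequality the mean of the excess.
\<close>
lemma weak_law_of_large_numbers:
  fixes g :: "'a \<Rightarrow> real"
  assumes M: "prob_space M" and g: "integrable M g" and nn: "\<And>x. x \<in> space M \<Longrightarrow> 0 \<le> g x"
    and \<eta>: "\<eta> > 0"
  shows "(\<lambda>n. measure (PiM {1..n} (\<lambda>_. M))
      {x \<in> space (PiM {1..n} (\<lambda>_. M)). \<bar>(\<Sum>m\<in>{1..n}. g (x m)) / real n - integral\<^sup>L M g\<bar> > \<eta>})
    \<longlonglongrightarrow> 0"
proof (rule LIMSEQ_I)
  fix \<epsilon> :: real assume \<epsilon>: "\<epsilon> > 0"
  interpret M: prob_space M by fact
  have [measurable]: "g \<in> borel_measurable M" using g by auto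
  define t where "t R x = min (g x) (real R)" for R :: nat and x
  have [measurable]: "t R \<in> borel_measurable M" for R unfolding t_def by measurable
  have ti: "integrable M (t R)" for R
    by (rule Bochner_Integration.integrable_bound[OF g]) (auto simp: t_def abs_if dest: nn)
  have "(\<lambda>R. integral\<^sup>L M (t R)) \<longlonglongrightarrow> integral\<^sup>L M g"
  proof (rule integral_dominated_convergence[OF _ _ g])
    show "AE x in M. (\<lambda>R. t R x) \<longlonglongrightarrow> g x"
    proof (rule AE_I2)
      fix x
      have "\<forall>\<^sub>F R in sequentially. t R x = g x"
        using eventually_ge_at_top[of "nat \<lceil>g x\<rceil>"]
        by eventually_elim (simp add: t_def min_def nat_le_iff ceiling_le_iff)
      then show "(\<lambda>R. t R x) \<longlonglongrightarrow> g x" by (rule tendsto_eventually)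
    qed
    show "AE x in M. norm (t R x) \<le> g x" for R
      using nn by (auto simp: t_def intro!: AE_I2)
  qed auto
  moreover define \<gamma> where "\<gamma> = min (\<eta> / 3) (\<eta> * \<epsilon> / 9)"
  have \<gamma>: "\<gamma> > 0" using \<eta> \<epsilon> by (auto simp: \<gamma>_def)
  \<comment> \<open>The constant \<open>\<gamma>\<close> makes the bias of the truncated mean at most \<open>\<eta> / 3\<close> and the Markov bound at most \<open>\<epsilon> / 3\<close>.\<close>
  ultimately have "\<forall>\<^sub>F R in sequentially. integral\<^sup>L M g - integral\<^sup>L M (t R) < \<gamma> \<and> R \<ge> 1"
    by (intro eventually_conj eventually_ge_at_top)
       (auto elim!: eventually_mono[OF tendstoD[of _ _ _ \<gamma>]] simp: dist_real_def abs_if split: if_splits)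
  then obtain R where R: "integral\<^sup>L M g - integral\<^sup>L M (t R) < \<gamma>" "R \<ge> 1"
    using eventually_happens'[OF sequentially_bot] by blast
  let ?v = "integral\<^sup>L M g" and ?w = "integral\<^sup>L M (t R)"
  have wv: "?w \<le> ?v" by (intro integral_mono ti g) (auto simp: t_def)
  let ?P = "\<lambda>n. PiM {1..n} (\<lambda>_. M)"
  let ?bad = "\<lambda>n. {x \<in> space (?P n). \<bar>(\<Sum>m\<in>{1..n}. g (x m)) / real n - ?v\<bar> > \<eta>}"
  let ?b1 = "\<lambda>n. {x \<in> space (?P n). \<bar>(\<Sum>m\<in>{1..n}. t R (x m)) / real n - ?w\<bar> \<ge> \<eta> / 3}"
  let ?b2 = "\<lambda>n. {x \<in> space (?P n). (\<Sum>m\<in>{1..n}. g (x m) - t R (x m)) / real n \<ge> \<eta> / 3}"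
  have main: "measure (?P n) (?bad n) \<le> 2 * exp (- 2 * real n * (\<eta> / 3)\<^sup>2 / (real R - 0)\<^sup>2) + \<epsilon> / 3"
    if n: "n \<ge> 1" for n
  proof -
    interpret P: prob_space "?P n" by (intro prob_space_PiM M)
    have ne: "{1..n} \<noteq> {}" using n by auto
    have "?bad n \<subseteq> ?b1 n \<union> ?b2 n"
    proof
      fix x assume x: "x \<in> ?bad n"
      let ?s = "(\<Sum>m\<in>{1..n}. g (x m)) / real n" and ?t = "(\<Sum>m\<in>{1..n}. t R (x m)) / real n"
      have d: "(\<Sum>m\<in>{1..n}. g (x m) - t R (x m)) / real n = ?s - ?t"
        by (simp add: sum_subtractf diff_divide_distrib)
      have ts: "?t \<le> ?s" by (intro divide_right_mono sum_mono) (auto simp: t_def)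
      have "\<eta> < \<bar>?s - ?v\<bar>" using x by simp
      then have "\<eta> / 3 \<le> \<bar>?t - ?w\<bar> \<or> \<eta> / 3 \<le> (\<Sum>m\<in>{1..n}. g (x m) - t R (x m)) / real n"
        unfolding d using R wv ts unfolding \<gamma>_def by linarith
      then show "x \<in> ?b1 n \<union> ?b2 n" using x by (auto simp only: Un_iff mem_Collect_eq)
    qed
    then have "P.prob (?bad n) \<le> P.prob (?b1 n \<union> ?b2 n)"
      by (intro P.finite_measure_mono) measurable
    also have "\<dots> \<le> P.prob (?b1 n) + P.prob (?b2 n)"
      by (intro measure_Un_le) measurable
    also have "P.prob (?b1 n) \<le> 2 * exp (- 2 * real (card {1..n}) * (\<eta> / 3)\<^sup>2 / (real R - 0)\<^sup>2)"
    proof -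
      have *: "Hoeffding_ineq_iid (?P n) {1..n} (\<lambda>m x. t R (x m)) (\<lambda>x. t R (x 1)) 0 (real R)"
      proof (unfold_locales)
        show "P.indep_vars (\<lambda>_. borel) (\<lambda>m x. t R (x m)) {1..n}"
          by (rule P.indep_vars_compose2[OF indep_vars_coordinates[OF M ne]]) auto
        have dm: "distr (?P n) borel (\<lambda>x. t R (x m)) = distr M borel (t R)" if m: "m \<in> {1..n}" for m
        proof -
          have "distr (?P n) borel (\<lambda>x. t R (x m)) = distr (distr (?P n) M (\<lambda>x. x m)) borel (t R)"
            using m by (subst distr_distr) (auto simp: comp_def)
          then show ?thesis using distr_PiM_component[of "{1..n}" "\<lambda>_. M" m] M m by simp
        qed
        show "distr (?P n) borel (\<lambda>x. t R (x m)) = distr (?P n) borel (\<lambda>x. t R (x 1))"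
          if m: "m \<in> {1..n}" for m
          using dm[OF m] dm[of 1] n by simp
        show "AE x in ?P n. t R (x 1) \<in> {0..real R}"
          using n nn by (intro AE_I2) (auto simp: t_def space_PiM PiE_iff)
        show "P.random_variable borel (\<lambda>x. t R (x 1))" using n by auto
      qed auto
      have e: "P.expectation (\<lambda>x. t R (x 1)) = ?w"
        using n by (intro integral_PiM_component M ti) auto
      show ?thesis
        using Hoeffding_ineq_iid.Hoeffding_ineq_abs_ge'[OF *, of "\<eta> / 3"] R n \<eta> ne
        unfolding e by simp
    qed
    also have "P.prob (?b2 n) \<le> \<epsilon> / 3"
    proof -
      let ?h = "\<lambda>x. (\<Sum>m\<in>{1..n}. g (x m) - t R (x m)) / real n"
      have ih: "integrable M (\<lambda>x. g x - t R x)" using g ti by auto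
      have ic: "integrable (?P n) (\<lambda>x. g (x m) - t R (x m))" if "m \<in> {1..n}" for m
        by (rule integral_PiM_component(1)[where g="\<lambda>y. g y - t R y", OF M that ih])
      have int: "integrable (?P n) ?h"
        by (intro integrable_divide_zero Bochner_Integration.integrable_sum ic)
      have E: "P.expectation ?h = ?v - ?w"
      proof -
        have "P.expectation ?h = (\<Sum>m\<in>{1..n}. P.expectation (\<lambda>x. g (x m) - t R (x m))) / real n"
          using ic by (subst integral_divide_zero, subst Bochner_Integration.integral_sum) auto
        also have "(\<Sum>m\<in>{1..n}. P.expectation (\<lambda>x. g (x m) - t R (x m))) = (\<Sum>m\<in>{1..n}. ?v - ?w)"
        proof (intro sum.cong refl)
          fix m assume m: "m \<in> {1..n}"
          show "P.expectation (\<lambda>x. g (x m) - t R (x m)) = ?v - ?w"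
            using integral_PiM_component(2)[where g="\<lambda>y. g y - t R y", OF M m ih] g ti[of R] by simp
        qed
        finally show ?thesis using n by simp
      qed
      have "P.prob (?b2 n) \<le> P.expectation ?h / (\<eta> / 3)"
        by (rule integral_Markov_inequality_measure[OF int, where A="{}"])
           (use \<eta> in \<open>auto simp: t_def intro!: AE_I2 divide_nonneg_nonneg sum_nonneg\<close>)
      also have "\<dots> \<le> (\<eta> * \<epsilon> / 9) / (\<eta> / 3)"
        unfolding E using R \<eta> by (intro divide_right_mono) (auto simp: \<gamma>_def)
      also have "\<dots> = \<epsilon> / 3" using \<eta> by simp
      finally show ?thesis .
    qed
    finally show ?thesis by simp
  qed
  have "(\<lambda>n. exp (- (2 * (\<eta> / 3)\<^sup>2 / (real R)\<^sup>2) * real n)) \<longlonglongrightarrow> 0"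
    using \<eta> R by (intro filterlim_compose[OF exp_at_bot] filterlim_tendsto_neg_mult_at_bot[OF tendsto_const]
      filterlim_real_sequentially) auto
  then have "\<forall>\<^sub>F n in sequentially. exp (- (2 * (\<eta> / 3)\<^sup>2 / (real R)\<^sup>2) * real n) < \<epsilon> / 4"
    using \<epsilon> by (intro order_tendstoD) auto
  then have "\<forall>\<^sub>F n in sequentially. measure (?P n) (?bad n) < \<epsilon>"
    using eventually_ge_at_top[of 1]
  proof eventually_elim
    case (elim n)
    have "- 2 * real n * (\<eta> / 3)\<^sup>2 / (real R - 0)\<^sup>2 = - (2 * (\<eta> / 3)\<^sup>2 / (real R)\<^sup>2) * real n"
      by simp
    then have "exp (- 2 * real n * (\<eta> / 3)\<^sup>2 / (real R - 0)\<^sup>2) < \<epsilon> / 4"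
      using elim(1) by (simp only:)
    then show ?case using main[OF elim(2)] \<epsilon> by linarith
  qed
  then show "\<exists>no. \<forall>n\<ge>no. norm (measure (?P n) (?bad n) - 0) < \<epsilon>"
    by (auto simp: eventually_sequentially)
qed

lemma exp_le_quadratic:
  fixes y :: real assumes "\<bar>y\<bar> \<le> 1" shows "exp y \<le> 1 + y + y\<^sup>2"
proof (cases "y \<ge> 0")
  case True then show ?thesis using assms exp_bound[of y] by simp
next
  case False
  define x where "x = - y"
  have x: "x > 0" "x \<le> 1" using False assms by (auto simp: x_def)
  have "exp (- x) = 1 / exp x" by (simp add: exp_minus inverse_eq_divide)
  also have "\<dots> \<le> 1 / (1 + x)" using exp_ge_add_one_self[of x] x by (intro divide_left_mono) auto
  also have "\<dots> \<le> 1 - x + x\<^sup>2"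
  proof -
    have "(1 - x + x\<^sup>2) * (1 + x) = 1 + x ^ 3" by (simp add: algebra_simps power2_eq_square power3_eq_cube)
    then have "1 \<le> (1 - x + x\<^sup>2) * (1 + x)" using x by simp
    then show ?thesis using x by (subst pos_divide_le_eq) auto
  qed
  finally show ?thesis by (simp add: x_def)
qed

text \<open>Jensen's inequality, in a form that also covers an infinite exponential moment.\<close>
lemma (in prob_space) exp_expectation_le:
  assumes Y: "integrable M Y"
  shows "ennreal (exp (expectation Y)) \<le> (\<integral>\<^sup>+x. ennreal (exp (Y x)) \<partial>M)"
proof (cases "(\<integral>\<^sup>+x. ennreal (exp (Y x)) \<partial>M) = \<infinity>")
  case False
  have [measurable]: "Y \<in> borel_measurable M" using Y by auto
  have iexp: "integrable M (\<lambda>x. exp (Y x))"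
    using False by (auto simp: integrable_iff_bounded top.not_eq_extremum)
  let ?c = "expectation Y"
  have "exp ?c = (\<integral>x. exp ?c * (1 + (Y x - ?c)) \<partial>M)"
    using Y by (simp add: prob_space)
  also have "\<dots> \<le> (\<integral>x. exp (Y x) \<partial>M)"
  proof (intro integral_mono iexp)
    fix x
    have "exp ?c * (1 + (Y x - ?c)) \<le> exp ?c * exp (Y x - ?c)"
      by (intro mult_left_mono exp_ge_add_one_self) auto
    then show "exp ?c * (1 + (Y x - ?c)) \<le> exp (Y x)" by (simp add: exp_diff)
  qed (use Y in auto)
  finally have "ennreal (exp ?c) \<le> ennreal (\<integral>x. exp (Y x) \<partial>M)" by (simp add: ennreal_le_iff)
  then show ?thesis by (simp add: nn_integral_eq_integral[OF iexp])
qed auto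

text \<open>
  One-sided differentiation of \<open>t \<mapsto> \<integral> exp (t Y)\<close> at \<open>0\<close>.  By convexity the difference quotients
  decrease to \<open>Y\<close> as \<open>t\<close> decreases to \<open>0\<close>, and the first of them is integrable, so Fatou's lemma
  applies.  That \<open>Y\<close> is integrable is part of the conclusion; this is what produces finite moments
  at a minimizer on the boundary of the domain.
\<close>
lemma (in prob_space) expectation_nonneg_if_exp_moments_ge_1:
  assumes Y[measurable]: "Y \<in> borel_measurable M" and t0: "t0 > 0"
    and int: "integrable M (\<lambda>x. exp (t0 * Y x))"
    and ge: "\<And>t. 0 < t \<Longrightarrow> t \<le> t0 \<Longrightarrow> 1 \<le> (\<integral>\<^sup>+x. ennreal (exp (t * Y x)) \<partial>M)"
  shows "integrable M Y" and "0 \<le> expectation Y"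
proof -
  define t where "t n = t0 / (real n + 1)" for n
  have tpos: "0 < t n" and tle: "t n \<le> t0" for n using t0 by (auto simp: t_def field_simps)
  have t00: "t 0 = t0" by (simp add: t_def)
  define Q where "Q n x = (exp (t n * Y x) - 1) / t n" for n x
  have [measurable]: "Q n \<in> borel_measurable M" for n unfolding Q_def by measurable
  have conv: "exp (t n * y) - 1 \<le> (t n / t0) * (exp (t0 * y) - 1)" for n y
  proof -
    have c: "convex_on UNIV (exp :: real \<Rightarrow> real)" by (rule exp_convex)
    have s: "0 \<le> t n / t0" "t n / t0 \<le> 1" using tle[of n] tpos[of n] t0 by auto
    have "exp ((1 - t n / t0) *\<^sub>R 0 + (t n / t0) *\<^sub>R (t0 * y)) \<le> (1 - t n / t0) * exp 0 + (t n / t0) * exp (t0 * y)"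
      by (rule convex_onD[OF c s]) auto
    then show ?thesis using t0 by (simp add: algebra_simps)
  qed
  \<comment> \<open>The difference quotients are squeezed between \<open>Y\<close> and the one at the largest step \<open>t0\<close>.\<close>
  have Qle: "Q n x \<le> Q 0 x" for n x
    using conv[of n "Y x"] tpos[of n] t0 unfolding Q_def t00 by (simp add: field_simps)
  have Yle: "Y x \<le> Q n x" for n x
    using exp_ge_add_one_self[of "t n * Y x"] tpos[of n] by (simp add: Q_def field_simps)
  have ie: "integrable M (\<lambda>x. exp (t n * Y x))" for n
  proof (rule Bochner_Integration.integrable_bound[where f="\<lambda>x. 1 + exp (t0 * Y x)"])
    show "AE x in M. norm (exp (t n * Y x)) \<le> norm (1 + exp (t0 * Y x))"
    proof (rule AE_I2)
      fix x
      have "exp (t n * Y x) \<le> 1 + exp (t0 * Y x)"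
      proof (cases "Y x \<ge> 0")
        case True
        then have "t n * Y x \<le> t0 * Y x" using tle by (intro mult_right_mono) auto
        then have "exp (t n * Y x) \<le> exp (t0 * Y x)" by (subst exp_le_cancel_iff)
        then show ?thesis by linarith
      next
        case False
        then have "exp (t n * Y x) \<le> 1" using tpos[of n] by (simp add: mult_le_0_iff)
        then show ?thesis using exp_gt_zero[of "t0 * Y x"] by linarith
      qed
      then show "norm (exp (t n * Y x)) \<le> norm (1 + exp (t0 * Y x))" by simp
    qed
  qed (use int in auto)
  have iQ: "integrable M (Q n)" for n unfolding Q_def using ie by auto
  have EQ: "0 \<le> expectation (Q n)" for n
  proof -
    have "ennreal 1 \<le> ennreal (expectation (\<lambda>x. exp (t n * Y x)))"
      using ge[OF tpos tle, of n] by (simp add: nn_integral_eq_integral[OF ie])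
    then have "1 \<le> expectation (\<lambda>x. exp (t n * Y x))"
      by (subst (asm) ennreal_le_iff) (auto intro!: integral_nonneg_AE)
    moreover have "expectation (Q n) = (expectation (\<lambda>x. exp (t n * Y x)) - 1) / t n"
      using ie[of n] by (simp add: Q_def[abs_def] prob_space)
    ultimately show ?thesis using tpos[of n] by simp
  qed
  have lim: "(\<lambda>n. Q n x) \<longlonglongrightarrow> Y x" for x
  proof -
    have d: "((\<lambda>h. (exp ((0 + h) * Y x) - exp (0 * Y x)) / h) \<longlongrightarrow> exp (0 * Y x) * Y x) (at 0)"
    proof -
      have "((\<lambda>s. exp (s * Y x)) has_field_derivative exp (0 * Y x) * Y x) (at 0)"
        by (auto intro!: derivative_eq_intros)
      then show ?thesis unfolding DERIV_def by simp
    qed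
    have "filterlim t (at 0) sequentially"
      unfolding filterlim_at
    proof
      show "\<forall>\<^sub>F n in sequentially. t n \<in> UNIV \<and> t n \<noteq> 0" using tpos by (auto simp: less_imp_neq[symmetric])
      show "t \<longlonglongrightarrow> 0" unfolding t_def by real_asymp
    qed
    from filterlim_compose[OF d this] show ?thesis by (simp add: Q_def)
  qed
  have "(\<integral>\<^sup>+x. ennreal (Q 0 x - Y x) \<partial>M) = (\<integral>\<^sup>+x. liminf (\<lambda>n. ennreal (Q 0 x - Q n x)) \<partial>M)"
  proof (rule nn_integral_cong)
    fix x
    have "(\<lambda>n. ennreal (Q 0 x - Q n x)) \<longlonglongrightarrow> ennreal (Q 0 x - Y x)"
      by (intro tendsto_ennrealI tendsto_diff tendsto_const lim)
    then show "ennreal (Q 0 x - Y x) = liminf (\<lambda>n. ennreal (Q 0 x - Q n x))"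
      by (simp add: lim_imp_Liminf)
  qed
  also have "\<dots> \<le> liminf (\<lambda>n. \<integral>\<^sup>+x. ennreal (Q 0 x - Q n x) \<partial>M)"
    by (rule nn_integral_liminf) measurable
  also have "\<dots> \<le> ennreal (expectation (Q 0))"
  proof -
    have "(\<integral>\<^sup>+x. ennreal (Q 0 x - Q n x) \<partial>M) \<le> ennreal (expectation (Q 0))" for n
    proof -
      have "(\<integral>\<^sup>+x. ennreal (Q 0 x - Q n x) \<partial>M) = ennreal (expectation (\<lambda>x. Q 0 x - Q n x))"
        using Qle iQ by (intro nn_integral_eq_integral) auto
      also have "\<dots> \<le> ennreal (expectation (Q 0))"
        using iQ EQ[of n] by (intro ennreal_leI) simp
      finally show ?thesis .
    qed
    then show ?thesis by (intro Liminf_le) (auto intro!: always_eventually)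
  qed
  finally have le: "(\<integral>\<^sup>+x. ennreal (Q 0 x - Y x) \<partial>M) \<le> ennreal (expectation (Q 0))" .
  have iD: "integrable M (\<lambda>x. Q 0 x - Y x)"
    using le Yle[of _ 0] by (auto simp: integrable_iff_bounded abs_of_nonneg intro: order.strict_trans1)
  have "integrable M (\<lambda>x. Q 0 x - (Q 0 x - Y x))" by (intro Bochner_Integration.integrable_diff iQ iD)
  then show iY: "integrable M Y" by simp
  have "ennreal (expectation (\<lambda>x. Q 0 x - Y x)) \<le> ennreal (expectation (Q 0))"
    using le nn_integral_eq_integral[OF iD] Yle[of _ 0] by simp
  then have "expectation (\<lambda>x. Q 0 x - Y x) \<le> expectation (Q 0)"
    using EQ[of 0] by (simp add: ennreal_le_iff)
  then show "0 \<le> expectation Y" using iQ iY by simp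
qed

text \<open>
  Jensen's inequality in both directions forces the common mean of \<open>Y\<close> to be \<open>0\<close>, and then
  \<open>exp Y - 1 - Y\<close> is a nonnegative function with integral \<open>0\<close>.
\<close>
lemma density_exp_eqI:
  assumes M: "prob_space M" and N: "prob_space N"
    and Y[measurable]: "Y \<in> borel_measurable M"
    and N_eq: "N = density M (\<lambda>x. ennreal (exp (Y x)))"
    and IM: "integrable M Y" and IN: "integrable N Y"
    and eq: "integral\<^sup>L M Y = integral\<^sup>L N Y"
  shows "N = M"
proof -
  interpret M: prob_space M by fact
  interpret N: prob_space N by fact
  have e1: "(\<integral>\<^sup>+x. ennreal (exp (Y x)) \<partial>M) = 1"
    using N.emeasure_space_1 unfolding N_eq by (simp add: emeasure_density cong: nn_integral_cong)
  then have ie: "integrable M (\<lambda>x. exp (Y x))" by (auto simp: integrable_iff_bounded)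
  have Ie: "(\<integral>x. exp (Y x) \<partial>M) = 1"
    using e1 by (simp add: integral_eq_nn_integral)
  have [measurable]: "Y \<in> borel_measurable N" using IN by auto
  have "(\<integral>\<^sup>+x. ennreal (exp (- Y x)) \<partial>N) = (\<integral>\<^sup>+x. ennreal (exp (Y x)) * ennreal (exp (- Y x)) \<partial>M)"
    unfolding N_eq by (subst nn_integral_density) auto
  also have "\<dots> = (\<integral>\<^sup>+x. 1 \<partial>M)"
    by (intro nn_integral_cong) (simp add: exp_minus flip: ennreal_mult)
  finally have n1: "(\<integral>\<^sup>+x. ennreal (exp (- Y x)) \<partial>N) = 1" by (simp add: M.emeasure_space_1)
  have "ennreal (exp (integral\<^sup>L M Y)) \<le> 1" using M.exp_expectation_le[OF IM] e1 by simp
  then have le: "integral\<^sup>L M Y \<le> 0"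
    by (metis ennreal_1 ennreal_le_iff exp_le_one_iff zero_le_one)
  have "ennreal (exp (integral\<^sup>L N (\<lambda>x. - Y x))) \<le> 1"
    using N.exp_expectation_le[of "\<lambda>x. - Y x"] IN n1 by simp
  then have "integral\<^sup>L N (\<lambda>x. - Y x) \<le> 0"
    by (metis ennreal_1 ennreal_le_iff exp_le_one_iff zero_le_one)
  then have 0: "integral\<^sup>L M Y = 0" using le eq by simp
  have "(\<integral>x. exp (Y x) - 1 - Y x \<partial>M) = 0"
    using ie IM by (simp add: Ie 0 M.prob_space)
  moreover have "integrable M (\<lambda>x. exp (Y x) - 1 - Y x)" using ie IM by auto
  moreover have nonneg: "exp y - 1 - y \<ge> 0" for y :: real using exp_ge_add_one_self[of y] by linarith
  ultimately have "AE x in M. exp (Y x) - 1 - Y x = 0"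
    by (subst (asm) integral_nonneg_eq_0_iff_AE) auto
  then have Y0: "AE x in M. Y x = 0"
  proof eventually_elim
    case (elim x)
    then show ?case
      using ln_eq_minus_one[of "exp (Y x)"] elim by simp
  qed
  have "density M (\<lambda>x. ennreal (exp (Y x))) = density M (\<lambda>x. 1)"
    using Y0 by (intro density_cong) auto
  then show ?thesis unfolding N_eq by (simp add: density_1)
qed

lemma sqrt_prod: "sqrt (\<Prod>i\<in>I. f i) = (\<Prod>i\<in>I. sqrt (f i))"
  by (induction I rule: infinite_finite_induct) (auto simp: real_sqrt_mult)

text \<open>
  The \<open>L\<^sup>1\<close> distance of two densities is bounded by their Hellinger distance: write
  \<open>\<bar>u - v\<bar> = \<bar>\<surd>u - \<surd>v\<bar> (\<surd>u + \<surd>v)\<close> and apply the Cauchy-Schwarz inequality.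
\<close>
lemma integral_density_diff_le:
  fixes u v f :: "'a \<Rightarrow> real"
  assumes [measurable]: "u \<in> borel_measurable M" "v \<in> borel_measurable M" "f \<in> borel_measurable M"
    and nn: "\<And>x. 0 \<le> u x" "\<And>x. 0 \<le> v x"
    and u1: "(\<integral>\<^sup>+x. ennreal (u x) \<partial>M) = 1" and v1: "(\<integral>\<^sup>+x. ennreal (v x) \<partial>M) = 1"
    and aff: "ennreal \<rho> \<le> (\<integral>\<^sup>+x. ennreal (sqrt (u x * v x)) \<partial>M)" and \<rho>: "0 \<le> \<rho>"
    and B: "\<And>x. x \<in> space M \<Longrightarrow> \<bar>f x\<bar> \<le> B"
  shows "\<bar>(\<integral>x. f x \<partial>density M (\<lambda>x. ennreal (u x))) - (\<integral>x. f x \<partial>density M (\<lambda>x. ennreal (v x)))\<bar>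
    \<le> 2 * B * sqrt (2 - 2 * \<rho>)"
proof -
  have iu: "integrable M u" and iv: "integrable M v"
    using u1 v1 nn by (auto simp: integrable_iff_bounded)
  have Iu: "integral\<^sup>L M u = 1" and Iv: "integral\<^sup>L M v = 1"
    using u1 v1 nn by (auto simp: integral_eq_nn_integral)
  have am: "sqrt (u x * v x) \<le> (u x + v x) / 2" for x
    using arith_geo_mean_sqrt[OF nn(1)[of x] nn(2)[of x]] .
  have isq: "integrable M (\<lambda>x. sqrt (u x * v x))"
    by (rule Bochner_Integration.integrable_bound[where f="\<lambda>x. (u x + v x) / 2"])
       (use iu iv am nn in \<open>auto simp: abs_of_nonneg add_nonneg_nonneg\<close>)
  define s where "s = (\<integral>x. sqrt (u x * v x) \<partial>M)"
  have s: "\<rho> \<le> s"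
    using aff \<rho> nn unfolding s_def
    by (subst (asm) nn_integral_eq_integral[OF isq]) (auto simp: ennreal_le_iff intro!: integral_nonneg_AE)
  have s1: "s \<le> 1"
  proof -
    have "s \<le> (\<integral>x. (u x + v x) / 2 \<partial>M)"
      unfolding s_def by (intro integral_mono isq am) (use iu iv in auto)
    also have "\<dots> = 1" using iu iv Iu Iv by simp
    finally show ?thesis .
  qed
  let ?d = "\<lambda>x. \<bar>sqrt (u x) - sqrt (v x)\<bar>" and ?e = "\<lambda>x. sqrt (u x) + sqrt (v x)"
  have de: "?d x * ?e x = \<bar>u x - v x\<bar>" for x
  proof -
    have "?d x * ?e x = \<bar>(sqrt (u x) - sqrt (v x)) * (sqrt (u x) + sqrt (v x))\<bar>"
      using nn by (simp add: abs_mult abs_of_nonneg)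
    also have "(sqrt (u x) - sqrt (v x)) * (sqrt (u x) + sqrt (v x)) = u x - v x"
      using nn by (simp add: algebra_simps)
    finally show ?thesis .
  qed
  have d2: "(?d x)\<^sup>2 = u x + v x - 2 * sqrt (u x * v x)" for x
    using nn by (simp add: power2_eq_square algebra_simps real_sqrt_mult)
  have e2: "(?e x)\<^sup>2 = u x + v x + 2 * sqrt (u x * v x)" for x
    using nn by (simp add: power2_eq_square algebra_simps real_sqrt_mult)
  have Id: "(\<integral>\<^sup>+x. (ennreal (?d x))\<^sup>2 \<partial>M) = ennreal (2 - 2 * s)"
  proof -
    have "(\<integral>\<^sup>+x. (ennreal (?d x))\<^sup>2 \<partial>M) = (\<integral>\<^sup>+x. ennreal (u x + v x - 2 * sqrt (u x * v x)) \<partial>M)"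
      by (intro nn_integral_cong) (simp add: ennreal_power d2[symmetric])
    also have "\<dots> = ennreal (\<integral>x. u x + v x - 2 * sqrt (u x * v x) \<partial>M)"
      by (intro nn_integral_eq_integral) (use iu iv isq am in \<open>auto simp: field_simps\<close>)
    also have "(\<integral>x. u x + v x - 2 * sqrt (u x * v x) \<partial>M) = 2 - 2 * s"
      using iu iv isq Iu Iv by (simp add: s_def)
    finally show ?thesis .
  qed
  have Ie: "(\<integral>\<^sup>+x. (ennreal (?e x))\<^sup>2 \<partial>M) = ennreal (2 + 2 * s)"
  proof -
    have "(\<integral>\<^sup>+x. (ennreal (?e x))\<^sup>2 \<partial>M) = (\<integral>\<^sup>+x. ennreal (u x + v x + 2 * sqrt (u x * v x)) \<partial>M)"
      by (intro nn_integral_cong) (simp add: ennreal_power e2[symmetric] nn del: ennreal_plus)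
    also have "\<dots> = ennreal (\<integral>x. u x + v x + 2 * sqrt (u x * v x) \<partial>M)"
      by (intro nn_integral_eq_integral) (use iu iv isq nn in auto)
    also have "(\<integral>x. u x + v x + 2 * sqrt (u x * v x) \<partial>M) = 2 + 2 * s"
      using iu iv isq Iu Iv by (simp add: s_def)
    finally show ?thesis .
  qed
  have iuv: "integrable M (\<lambda>x. \<bar>u x - v x\<bar>)" using iu iv by auto
  have L1: "(\<integral>x. \<bar>u x - v x\<bar> \<partial>M) \<le> 2 * sqrt (2 - 2 * \<rho>)"
  proof -
    have "(ennreal (\<integral>x. \<bar>u x - v x\<bar> \<partial>M))\<^sup>2 = (\<integral>\<^sup>+x. ennreal (?d x) * ennreal (?e x) \<partial>M)\<^sup>2"
      by (subst nn_integral_eq_integral[symmetric, OF iuv])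
         (auto simp: de[symmetric] ennreal_mult nn)
    also have "\<dots> \<le> (\<integral>\<^sup>+x. (ennreal (?d x))\<^sup>2 \<partial>M) * (\<integral>\<^sup>+x. (ennreal (?e x))\<^sup>2 \<partial>M)"
      by (intro Cauchy_Schwarz_nn_integral) auto
    also have "\<dots> = ennreal ((2 - 2 * s) * (2 + 2 * s))"
      unfolding Id Ie using s1 s \<rho> by (simp add: ennreal_mult)
    finally have "(\<integral>x. \<bar>u x - v x\<bar> \<partial>M)\<^sup>2 \<le> (2 - 2 * s) * (2 + 2 * s)"
      using s1 s \<rho> by (subst (asm) ennreal_power) (auto simp: ennreal_le_iff)
    also have "\<dots> \<le> (2 - 2 * \<rho>) * 4"
      using s s1 \<rho> by (intro mult_mono) auto
    also have "\<dots> = (2 * sqrt (2 - 2 * \<rho>))\<^sup>2"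
      using s s1 by (simp add: power_mult_distrib)
    finally have le: "(\<integral>x. \<bar>u x - v x\<bar> \<partial>M)\<^sup>2 \<le> (2 * sqrt (2 - 2 * \<rho>))\<^sup>2" .
    have "0 \<le> 2 * sqrt (2 - 2 * \<rho>)" using s s1 by simp
    with le show ?thesis by (rule power2_le_imp_le)
  qed
  have bd: "\<bar>w * f x\<bar> \<le> \<bar>w * B\<bar>" if "x \<in> space M" "0 \<le> w" for x w
    using B[OF that(1)] that(2) by (simp add: abs_mult mult_left_mono)
  have fu: "integrable M (\<lambda>x. u x * f x)"
    by (rule Bochner_Integration.integrable_bound[where f="\<lambda>x. u x * B"])
       (use iu bd[OF _ nn(1)] in \<open>auto intro!: AE_I2\<close>)
  have fv: "integrable M (\<lambda>x. v x * f x)"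
    by (rule Bochner_Integration.integrable_bound[where f="\<lambda>x. v x * B"])
       (use iv bd[OF _ nn(2)] in \<open>auto intro!: AE_I2\<close>)
  have B0: "B \<ge> 0 \<or> space M = {}" using B by (metis abs_ge_zero all_not_in_conv order.trans)
  have "\<bar>(\<integral>x. f x \<partial>density M (\<lambda>x. ennreal (u x))) - (\<integral>x. f x \<partial>density M (\<lambda>x. ennreal (v x)))\<bar>
    = \<bar>(\<integral>x. u x * f x - v x * f x \<partial>M)\<bar>"
    using fu fv nn by (simp add: integral_density)
  also have "\<dots> \<le> (\<integral>x. \<bar>u x * f x - v x * f x\<bar> \<partial>M)" by (rule integral_abs_bound)
  also have "\<dots> \<le> (\<integral>x. B * \<bar>u x - v x\<bar> \<partial>M)"
  proof (intro integral_mono)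
    fix x assume "x \<in> space M"
    have "\<bar>u x * f x - v x * f x\<bar> = \<bar>f x\<bar> * \<bar>u x - v x\<bar>"
      by (simp add: abs_mult[symmetric] algebra_simps)
    also have "\<dots> \<le> B * \<bar>u x - v x\<bar>" using B[OF \<open>x \<in> space M\<close>] by (intro mult_right_mono) auto
    finally show "\<bar>u x * f x - v x * f x\<bar> \<le> B * \<bar>u x - v x\<bar>" .
  qed (use fu fv iuv in auto)
  also have "\<dots> = B * (\<integral>x. \<bar>u x - v x\<bar> \<partial>M)" by simp
  also have "\<dots> \<le> B * (2 * sqrt (2 - 2 * \<rho>))"
  proof -
    have "space M \<noteq> {}" using u1 by (auto simp: nn_integral_empty)
    then show ?thesis using B0 L1 by (intro mult_left_mono) auto
  qed
  finally show ?thesis by simp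
qed

lemma nn_integral_less_top_if_integrable:
  fixes f :: "'b \<Rightarrow> real"
  assumes "integrable M f" shows "(\<integral>\<^sup>+x. ennreal (f x) \<partial>M) < \<infinity>"
proof -
  have "(\<integral>\<^sup>+x. ennreal (f x) \<partial>M) \<le> (\<integral>\<^sup>+x. ennreal (norm (f x)) \<partial>M)"
    by (intro nn_integral_mono ennreal_leI) simp
  also have "\<dots> < \<infinity>" using assms by (simp add: integrable_iff_bounded)
  finally show ?thesis .
qed

lemma bounded_componentwise_subsequence:
  fixes q :: "nat \<Rightarrow> 'b \<Rightarrow> real"
  assumes "finite I" and "\<And>n i. i \<in> I \<Longrightarrow> \<bar>q n i\<bar> \<le> K"
  shows "\<exists>r p. strict_mono r \<and> (\<forall>i\<in>I. (\<lambda>n. q (r n) i) \<longlonglongrightarrow> p i)"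
  using assms
proof (induction I)
  case empty
  then show ?case by (auto intro: exI[of _ id] simp: strict_mono_id)
next
  case (insert j I)
  then obtain r p where r: "strict_mono r" and p: "\<forall>i\<in>I. (\<lambda>n. q (r n) i) \<longlonglongrightarrow> p i" by blast
  have "bounded (range (\<lambda>n. q (r n) j))"
    using insert.prems by (auto simp: bounded_iff intro!: exI[of _ K])
  then obtain l r' where r': "strict_mono r'" "((\<lambda>n. q (r n) j) \<circ> r') \<longlonglongrightarrow> l"
    using bounded_imp_convergent_subsequence by blast
  have "(\<lambda>n. q ((r \<circ> r') n) i) \<longlonglongrightarrow> (p(j := l)) i" if i: "i \<in> insert j I" for i
  proof (cases "i = j")
    case True
    then show ?thesis using r' by (simp add: comp_def)
  next
    case False
    then show ?thesis
      using i p LIMSEQ_subseq_LIMSEQ[of "\<lambda>n. q (r n) i" "p i" r'] r' by (auto simp: comp_def)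
  qed
  moreover have "strict_mono (r \<circ> r')" using r r' by (simp add: strict_mono_o)
  ultimately show ?case by blast
qed

lemma real_subexponential:
  fixes z B M \<epsilon> \<eta> :: real
  assumes "z > 0" "B > 0" "\<epsilon> > 0" "\<eta> > 0" "M > 0"
  shows "\<forall>\<^sub>F n in sequentially. exp (- \<epsilon> * real n) \<le> real n * \<eta> / (z * (real n * B) powr M)
      * exp (- (\<epsilon> / 2 * real n))"
  using assms by real_asymp

section \<open>Growth of the constraint functions\<close>


locale growth_family =
  fixes k :: nat and \<phi> :: "nat \<Rightarrow> real \<Rightarrow> real"
  assumes k: "k \<ge> 2"
    and pos: "\<And>i x. i \<in> {1..k} \<Longrightarrow> x > 0 \<Longrightarrow> \<phi> i x > 0"
    and C1: "\<And>i. i \<in> {1..k} \<Longrightarrow>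
      \<phi> i C1_differentiable_on {0<..} \<and> mono_on {0<..} (\<phi> i) \<and> filterlim (\<phi> i) at_top at_top"
    and C2: "\<And>i c. i \<in> {1..k} \<Longrightarrow> c > 0 \<Longrightarrow> integrable leb_pos (\<lambda>x. exp (- c * \<phi> i x))"
    and C3: "\<exists>\<kappa>>1. \<forall>i\<in>{1..k-1}. \<forall>\<^sub>F x in at_top. \<phi> i x powr \<kappa> < \<phi> (i+1) x"
    and C4: "\<exists>C>0. \<exists>M>0. \<forall>x>C. \<forall>i\<in>{1..k}.
      1 / C * \<phi> i x powr (- M) < deriv (\<phi> i) x \<and> deriv (\<phi> i) x < C * \<phi> i x powr M"
begin

lemma k_mem: "1 \<in> {1..k}" "k \<in> {1..k}" using k by auto

lemma sum_split_top: "(\<Sum>i\<in>{1..k}. f i) = (\<Sum>i\<in>{1..<k}. f i) + (f k :: real)"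
proof -
  have "{1..k} = insert k {1..<k}" using k by auto
  then show ?thesis by simp
qed

lemma phi_continuous: "i \<in> {1..k} \<Longrightarrow> continuous_on {0<..} (\<phi> i)"
  using C1[of i] C1_differentiable_imp_continuous_on by blast

lemma space_leb_pos: "space leb_pos = {0<..}" and sets_leb_pos: "sets leb_pos = sets borel_pos"
  and space_borel_pos: "space borel_pos = {0<..}"
  by (simp_all add: leb_pos_def borel_pos_def space_restrict_space sets_restrict_space)

lemma pos_in_borel_pos[simp]: "{0<..} \<in> sets borel_pos"
  using sets.top[of borel_pos] by (simp add: space_borel_pos)

lemma phi_measurable[measurable]: "i \<in> {1..k} \<Longrightarrow> \<phi> i \<in> borel_measurable borel_pos"
  unfolding borel_pos_def by (intro borel_measurable_continuous_on_restrict phi_continuous)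

lemma phi1_measurable[measurable]:
  "\<phi> 1 \<in> borel_measurable borel_pos" "\<phi> (Suc 0) \<in> borel_measurable borel_pos"
  using phi_measurable[of 1] k by auto

lemma phi_mono: "i \<in> {1..k} \<Longrightarrow> 0 < x \<Longrightarrow> x \<le> y \<Longrightarrow> \<phi> i x \<le> \<phi> i y"
  using C1[of i] by (auto simp: mono_on_def)

lemma phi_has_derivative:
  assumes i: "i \<in> {1..k}" and x: "x > 0"
  shows "(\<phi> i has_real_derivative deriv (\<phi> i) x) (at x)"
proof -
  obtain D where "\<And>x. x \<in> {0<..} \<Longrightarrow> (\<phi> i has_vector_derivative D x) (at x)"
    using C1[OF i] unfolding C1_differentiable_on_def by blast
  then have "(\<phi> i has_real_derivative D x) (at x)"
    using x by (simp add: has_real_derivative_iff_has_vector_derivative)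
  then show ?thesis using DERIV_imp_deriv by metis
qed

text \<open>
  From \<open>\<phi>\<^sub>i\<^sup>\<kappa> < \<phi>\<^sub>i\<^sub>+\<^sub>1\<close> with \<open>\<kappa> > 1\<close>: as soon as \<open>\<phi>\<^sub>i\<^sup>\<kappa>\<^sup>-\<^sup>1 \<ge> 1/c\<close>, also \<open>\<phi>\<^sub>i \<le> c \<phi>\<^sub>i\<^sup>\<kappa>\<close>.
\<close>
lemma phi_little_o_step:
  assumes i: "i \<in> {1..k-1}" and c: "c > 0"
  shows "\<forall>\<^sub>F x in at_top. \<phi> i x \<le> c * \<phi> (i + 1) x"
proof -
  obtain \<kappa> where \<kappa>: "\<kappa> > 1" and ev: "\<forall>\<^sub>F x in at_top. \<phi> i x powr \<kappa> < \<phi> (i+1) x"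
    using C3 i by blast
  have "filterlim (\<phi> i) at_top at_top" using C1[of i] i by auto
  then have "\<forall>\<^sub>F x in at_top. \<phi> i x \<ge> max 1 ((1 / c) powr (1 / (\<kappa> - 1)))"
    by (rule filterlim_at_top[THEN iffD1, rule_format])
  with ev show ?thesis
  proof eventually_elim
    case (elim x)
    let ?y = "\<phi> i x"
    have y: "?y \<ge> 1" "(1 / c) powr (1 / (\<kappa> - 1)) \<le> ?y" using elim by auto
    have "((1 / c) powr (1 / (\<kappa> - 1))) powr (\<kappa> - 1) \<le> ?y powr (\<kappa> - 1)"
      using y \<kappa> by (intro powr_mono2) auto
    then have "1 / c \<le> ?y powr (\<kappa> - 1)" using \<kappa> c by (simp add: powr_powr)
    then have "?y \<le> c * (?y * ?y powr (\<kappa> - 1))"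
      using c y by (simp add: field_simps)
    also have "?y * ?y powr (\<kappa> - 1) = ?y powr \<kappa>"
      using y by (simp add: powr_diff)
    also have "c * ?y powr \<kappa> \<le> c * \<phi> (i + 1) x" using elim c by simp
    finally show ?case .
  qed
qed

lemma phi_little_o:
  assumes i: "1 \<le> i" "i < l" "l \<le> k" and c: "c > 0"
  shows "\<forall>\<^sub>F x in at_top. \<phi> i x \<le> c * \<phi> l x"
proof -
  have "Suc i \<le> l" using i by simp
  then show ?thesis using i
  proof (induction l rule: dec_induct)
    case base
    then show ?case using phi_little_o_step[of i c] c by simp
  next
    case (step l)
    have "\<forall>\<^sub>F x in at_top. \<phi> i x \<le> c * \<phi> l x" using step by simp
    moreover have "\<forall>\<^sub>F x in at_top. \<phi> l x \<le> 1 * \<phi> (l + 1) x"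
      using step by (intro phi_little_o_step) auto
    ultimately show ?case
    proof eventually_elim
      case (elim x)
      then have "c * \<phi> l x \<le> c * \<phi> (l + 1) x" using c by simp
      then show ?case using elim(1) by simp
    qed
  qed
qed

lemma phi_le_top:
  assumes i: "i \<in> {1..<k}" and c: "c > 0"
  shows "\<exists>K. \<forall>x>0. \<phi> i x \<le> K + c * \<phi> k x"
proof -
  obtain R where R: "\<And>x. x \<ge> R \<Longrightarrow> \<phi> i x \<le> c * \<phi> k x"
    using phi_little_o[of i k c] i c by (auto simp: eventually_at_top_linorder)
  define R' where "R' = max R 1"
  have "\<phi> i x \<le> \<phi> i R' + c * \<phi> k x" if "x > 0" for x
  proof (cases "x \<le> R'")
    case True
    have "\<phi> i x \<le> \<phi> i R'" using i that True by (intro phi_mono) auto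
    moreover have "0 \<le> c * \<phi> k x" using pos[OF k_mem(2) that] c by simp
    ultimately show ?thesis by simp
  next
    case False
    have "0 < \<phi> i R'" using i by (intro pos) (auto simp: R'_def)
    moreover have "\<phi> i x \<le> c * \<phi> k x" using False by (intro R) (simp add: R'_def)
    ultimately show ?thesis by simp
  qed
  then show ?thesis by blast
qed

text \<open>
  Each \<open>\<phi>\<^sub>i\<close> with \<open>i < k\<close> is at most a constant plus so small a multiple of \<open>\<phi>\<^sub>k\<close> that the \<open>k - 1\<close>
  multiples together do not outweigh the negative last term.
\<close>
lemma linear_combination_bounded_above:
  assumes p: "p k < 0"
  shows "\<exists>K. \<forall>x>0. (\<Sum>i\<in>{1..k}. p i * \<phi> i x) \<le> K"
proof -
  define c where "c i = - p k / (real k * (\<bar>p i\<bar> + 1))" for i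
  have c: "c i > 0" for i unfolding c_def using p k by (intro divide_pos_pos mult_pos_pos) auto
  have "\<forall>i\<in>{1..<k}. \<exists>K. \<forall>x>0. \<phi> i x \<le> K + c i * \<phi> k x"
    using phi_le_top c by blast
  then obtain K where K: "\<And>i x. i \<in> {1..<k} \<Longrightarrow> x > 0 \<Longrightarrow> \<phi> i x \<le> K i + c i * \<phi> k x"
    by metis
  have "(\<Sum>i\<in>{1..k}. p i * \<phi> i x) \<le> (\<Sum>i\<in>{1..<k}. \<bar>p i\<bar> * \<bar>K i\<bar>)" if x: "x > 0" for x
  proof -
    have ph: "\<phi> k x > 0" using pos k_mem x by blast
    have t: "p i * \<phi> i x \<le> \<bar>p i\<bar> * \<bar>K i\<bar> + (- p k / real k) * \<phi> k x" if i: "i \<in> {1..<k}" for i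
    proof -
      have "p i * \<phi> i x \<le> \<bar>p i\<bar> * \<phi> i x"
        using pos[of i x] i x by (intro mult_right_mono) auto
      also have "\<dots> \<le> \<bar>p i\<bar> * (\<bar>K i\<bar> + c i * \<phi> k x)"
        using K[OF i x] by (intro mult_left_mono) auto
      also have "\<bar>p i\<bar> * (\<bar>K i\<bar> + c i * \<phi> k x) = \<bar>p i\<bar> * \<bar>K i\<bar> + \<bar>p i\<bar> * (c i * \<phi> k x)"
        by (simp add: distrib_left)
      also have "\<bar>p i\<bar> * (c i * \<phi> k x) \<le> (- p k / real k) * \<phi> k x"
      proof -
        have "\<bar>p i\<bar> * c i = (\<bar>p i\<bar> / (\<bar>p i\<bar> + 1)) * (- p k / real k)"
          by (simp add: c_def)
        also have "\<dots> \<le> 1 * (- p k / real k)"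
          using p k by (intro mult_right_mono) (auto simp: field_simps)
        finally have "\<bar>p i\<bar> * c i * \<phi> k x \<le> (- p k / real k) * \<phi> k x"
          using ph by (intro mult_right_mono) auto
        then show ?thesis by (simp add: mult.assoc)
      qed
      finally show ?thesis by (simp add: algebra_simps)
    qed
    have "{1..k} = insert k {1..<k}" using k by auto
    then have "(\<Sum>i\<in>{1..k}. p i * \<phi> i x) = p k * \<phi> k x + (\<Sum>i\<in>{1..<k}. p i * \<phi> i x)" by simp
    also have "\<dots> \<le> p k * \<phi> k x + (\<Sum>i\<in>{1..<k}. \<bar>p i\<bar> * \<bar>K i\<bar> + (- p k / real k) * \<phi> k x)"
      by (intro add_left_mono sum_mono t)
    also have "\<dots> = (\<Sum>i\<in>{1..<k}. \<bar>p i\<bar> * \<bar>K i\<bar>) + p k * \<phi> k x * (1 - real (k - 1) / real k)"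
      by (simp only: sum.distrib sum_constant card_atLeastLessThan) (simp add: algebra_simps)
    also have "p k * \<phi> k x * (1 - real (k - 1) / real k) \<le> 0"
      using p ph k by (intro mult_nonpos_nonneg) (auto simp: mult_le_0_iff field_simps)
    finally show ?thesis by simp
  qed
  then show ?thesis by blast
qed

section \<open>The base law\<close>

definition Z :: real where "Z = (\<integral>y. exp (- \<phi> 1 y) \<partial>leb_pos)"

lemma int_exp_phi1: "integrable leb_pos (\<lambda>x. exp (- \<phi> 1 x))"
  using C2[OF k_mem(1), of 1] by simp

lemma leb_pos_measurable: "f \<in> borel_measurable borel_pos \<Longrightarrow> f \<in> borel_measurable leb_pos"
  using sets_leb_pos measurable_cong_sets by blast

lemma emeasure_leb_pos: "A \<in> sets borel \<Longrightarrow> A \<subseteq> {0<..} \<Longrightarrow> emeasure leb_pos A = emeasure lborel A"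
  unfolding leb_pos_def by (intro emeasure_restrict_space) auto

lemma Z_pos: "Z > 0"
proof -
  have "Z \<noteq> 0"
  proof
    assume "Z = 0"
    then have "AE x in leb_pos. exp (- \<phi> 1 x) = 0"
      unfolding Z_def using int_exp_phi1 by (subst (asm) integral_nonneg_eq_0_iff_AE) auto
    then have "AE x in leb_pos. False" by simp
    then have "emeasure leb_pos (space leb_pos) = 0"
      by (simp add: eventually_False ae_filter_eq_bot_iff)
    moreover have "emeasure leb_pos {1..2} \<le> emeasure leb_pos (space leb_pos)"
      by (intro emeasure_mono) (auto simp: space_leb_pos sets_leb_pos borel_pos_def sets_restrict_space_iff)
    moreover have "emeasure leb_pos {1..2} = 1" by (subst emeasure_leb_pos) auto
    ultimately show False by simp
  qed
  moreover have "Z \<ge> 0" unfolding Z_def by (intro integral_nonneg_AE) auto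
  ultimately show ?thesis by simp
qed

lemma base_law_eq: "base_law \<phi> = density leb_pos (\<lambda>x. ennreal (exp (- \<phi> 1 x) / Z))"
  by (simp add: base_law_def normalized_def Z_def)

lemma sets_base[simp, measurable_cong]: "sets (base_law \<phi>) = sets borel_pos"
  by (simp add: base_law_eq sets_leb_pos)

lemma space_base[simp]: "space (base_law \<phi>) = {0<..}"
  by (simp add: base_law_eq space_leb_pos)

lemma prob_space_base: "prob_space (base_law \<phi>)"
proof
  have "emeasure (base_law \<phi>) (space (base_law \<phi>)) = (\<integral>\<^sup>+x. ennreal (exp (- \<phi> 1 x) / Z) \<partial>leb_pos)"
    unfolding base_law_eq using int_exp_phi1
    by (subst emeasure_density) (auto intro!: nn_integral_cong)
  also have "\<dots> = ennreal (\<integral>x. exp (- \<phi> 1 x) / Z \<partial>leb_pos)"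
    using int_exp_phi1 Z_pos by (intro nn_integral_eq_integral) auto
  also have "(\<integral>x. exp (- \<phi> 1 x) / Z \<partial>leb_pos) = 1"
    using Z_pos by (simp add: Z_def)
  finally show "emeasure (base_law \<phi>) (space (base_law \<phi>)) = 1" by simp
qed

sublocale base: prob_space "base_law \<phi>" by (rule prob_space_base)

lemma emeasure_base_space[simp]: "emeasure (base_law \<phi>) {0<..} = 1"
  using base.emeasure_space_1 by simp

lemma nn_integral_base:
  assumes [measurable]: "f \<in> borel_measurable borel_pos"
  shows "(\<integral>\<^sup>+x. ennreal (f x) \<partial>base_law \<phi>) = (\<integral>\<^sup>+x. ennreal (exp (- \<phi> 1 x) / Z * f x) \<partial>leb_pos)"
proof -
  note [measurable_cong] = sets_leb_pos
  have [measurable]: "(\<lambda>x. ennreal (exp (- \<phi> 1 x) / Z)) \<in> borel_measurable leb_pos"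
    by (intro leb_pos_measurable) measurable
  have [measurable]: "f \<in> borel_measurable leb_pos" by (intro leb_pos_measurable) measurable
  show ?thesis
    unfolding base_law_eq using Z_pos
    by (subst nn_integral_density)
        (auto simp: ennreal_mult'[symmetric] simp del: One_nat_def intro!: nn_integral_cong)
qed

section \<open>Exponential tilts\<close>

text \<open>
  The exponent of the dual problem for the window \<open>\<bar>v\<^sub>i - a\<^sub>i\<bar> \<le> d\<close>: the term \<open>d \<bar>p\<^sub>i\<bar>\<close> is the support
  function of the window, so that \<open>\<Sum>i. p\<^sub>i (v\<^sub>i - a\<^sub>i) + d \<bar>p\<^sub>i\<bar> \<ge> 0\<close> for every \<open>v\<close> in it.
\<close>
definition tilt :: "(nat \<Rightarrow> real) \<Rightarrow> real \<Rightarrow> (nat \<Rightarrow> real) \<Rightarrow> real \<Rightarrow> real" where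
  "tilt a d p x = (\<Sum>i\<in>{1..k}. p i * (\<phi> i x - a i) + d * \<bar>p i\<bar>)"

definition partfn :: "(nat \<Rightarrow> real) \<Rightarrow> real \<Rightarrow> (nat \<Rightarrow> real) \<Rightarrow> ennreal" where
  "partfn a d p = (\<integral>\<^sup>+x. ennreal (exp (tilt a d p x)) \<partial>base_law \<phi>)"

definition minimizer :: "(nat \<Rightarrow> real) \<Rightarrow> real \<Rightarrow> (nat \<Rightarrow> real) \<Rightarrow> bool" where
  "minimizer a d p \<longleftrightarrow> (\<forall>q. partfn a d p \<le> partfn a d q)"

definition tilted :: "(nat \<Rightarrow> real) \<Rightarrow> real \<Rightarrow> (nat \<Rightarrow> real) \<Rightarrow> real measure" where
  "tilted a d p = density (base_law \<phi>) (\<lambda>x. ennreal (exp (tilt a d p x) / enn2real (partfn a d p)))"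

definition tilted_mean :: "(nat \<Rightarrow> real) \<Rightarrow> real \<Rightarrow> (nat \<Rightarrow> real) \<Rightarrow> nat \<Rightarrow> real" where
  "tilted_mean a d p i = (\<integral>x. \<phi> i x \<partial>tilted a d p)"

abbreviation base_pow :: "nat \<Rightarrow> (nat \<Rightarrow> real) measure" where
  "base_pow n \<equiv> PiM {1..n} (\<lambda>_. base_law \<phi>)"

abbreviation tilted_pow :: "(nat \<Rightarrow> real) \<Rightarrow> real \<Rightarrow> (nat \<Rightarrow> real) \<Rightarrow> nat \<Rightarrow> (nat \<Rightarrow> real) measure" where
  "tilted_pow a d p n \<equiv> PiM {1..n} (\<lambda>_. tilted a d p)"

lemma tilt_measurable[measurable]: "tilt a d p \<in> borel_measurable borel_pos"
  unfolding tilt_def[abs_def] by measurable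

lemma tilt_0[simp]: "tilt a d (\<lambda>_. 0) x = 0" by (simp add: tilt_def)

lemma tilt_eq: "tilt a d p x = (\<Sum>i\<in>{1..k}. p i * (\<phi> i x - a i)) + d * (\<Sum>i\<in>{1..k}. \<bar>p i\<bar>)"
  by (simp add: tilt_def sum.distrib sum_distrib_left)

lemma tilt_split:
  "tilt a d p x = (\<Sum>i\<in>{1..k}. p i * \<phi> i x) - (\<Sum>i\<in>{1..k}. p i * a i) + d * (\<Sum>i\<in>{1..k}. \<bar>p i\<bar>)"
  by (simp add: tilt_def sum.distrib sum_subtractf sum_distrib_left algebra_simps)

lemma partfn_0[simp]: "partfn a d (\<lambda>_. 0) = 1"
  by (simp add: partfn_def base.emeasure_space_1)

lemma partfn_pos: "partfn a d p > 0"
proof -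
  have "partfn a d p \<noteq> 0"
  proof
    assume "partfn a d p = 0"
    then have "AE x in base_law \<phi>. ennreal (exp (tilt a d p x)) = 0"
      unfolding partfn_def by (subst (asm) nn_integral_0_iff_AE) auto
    then have "AE x in base_law \<phi>. False" by (simp add: ennreal_eq_0_iff not_le)
    then show False using base.AE_False by simp
  qed
  then show ?thesis by (simp add: zero_less_iff_neq_zero)
qed

lemma partfn_cong: "(\<And>i. i \<in> {1..k} \<Longrightarrow> p i = q i) \<Longrightarrow> partfn a d p = partfn a d q"
  unfolding partfn_def tilt_def by (intro nn_integral_cong arg_cong[where f="\<lambda>s. ennreal (exp s)"] sum.cong) auto

lemma partfn_mono_delta: "0 \<le> d \<Longrightarrow> partfn a 0 p \<le> partfn a d p"
  unfolding partfn_def by (intro nn_integral_mono ennreal_leI) (simp add: tilt_eq sum_nonneg)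

lemma partfn_finite:
  assumes "p k < 0" shows "partfn a d p < \<infinity>"
proof -
  obtain K where K: "\<And>x. x > 0 \<Longrightarrow> (\<Sum>i\<in>{1..k}. p i * \<phi> i x) \<le> K"
    using linear_combination_bounded_above[of p] assms by blast
  define c where "c = K - (\<Sum>i\<in>{1..k}. p i * a i) + d * (\<Sum>i\<in>{1..k}. \<bar>p i\<bar>)"
  have "partfn a d p \<le> (\<integral>\<^sup>+x. ennreal (exp c) \<partial>base_law \<phi>)"
    unfolding partfn_def using K by (intro nn_integral_mono ennreal_leI) (auto simp: tilt_split c_def)
  also have "\<dots> = ennreal (exp c)" by (simp add: base.emeasure_space_1)
  finally show ?thesis by (auto simp: top.not_eq_extremum intro: order.strict_trans1)
qed

text \<open>
  For \<open>p\<^sub>k > 0\<close> the exponent \<open>\<Sum>i. p\<^sub>i \<phi>\<^sub>i - \<phi>\<^sub>1\<close> of the integrand with respect to Lebesgue measure is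
  bounded below, since \<open>\<phi>\<^sub>k\<close> dominates.  Thus a minimizer never has a positive last parameter, and only
  the upper edge of the window can be active in the last coordinate.
\<close>
lemma partfn_infinite:
  assumes "p k > 0" shows "partfn a d p = \<infinity>"
proof -
  have sp: "{1..k} = insert 1 {2..k}" using k by auto
  obtain K where K: "\<And>x. x > 0 \<Longrightarrow> (\<Sum>i\<in>{1..k}. (- (p(1 := p 1 - 1))) i * \<phi> i x) \<le> K"
    using linear_combination_bounded_above[of "- (p(1 := p 1 - 1))"] assms k by auto
  have "(\<Sum>i\<in>{1..k}. (- (p(1 := p 1 - 1))) i * \<phi> i x) = \<phi> 1 x - (\<Sum>i\<in>{1..k}. p i * \<phi> i x)" for x
    unfolding sp by (simp add: algebra_simps sum_negf)
  then have K': "(\<Sum>i\<in>{1..k}. p i * \<phi> i x) - \<phi> 1 x \<ge> - K" if "x > 0" for x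
    using K[OF that] by simp
  define c where "c = - K - (\<Sum>i\<in>{1..k}. p i * a i) + d * (\<Sum>i\<in>{1..k}. \<bar>p i\<bar>)"
  have "\<infinity> = (\<integral>\<^sup>+x. ennreal (exp c / Z) \<partial>leb_pos)"
  proof -
    have "emeasure leb_pos {0<..} = \<infinity>"
    proof (rule ccontr)
      assume "emeasure leb_pos {0<..} \<noteq> \<infinity>"
      then obtain r where r: "emeasure leb_pos {0<..} = ennreal r" "r \<ge> 0"
        by (cases "emeasure leb_pos {0<..}") auto
      have "emeasure leb_pos {0<..r + 1} \<le> emeasure leb_pos {0<..}"
        by (intro emeasure_mono) (auto simp: sets_leb_pos)
      moreover have "emeasure leb_pos {0<..r + 1} = ennreal (r + 1)"
        using r by (subst emeasure_leb_pos) auto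
      ultimately show False using r by (simp add: ennreal_le_iff del: ennreal_plus)
    qed
    then show ?thesis using Z_pos by (simp add: space_leb_pos ennreal_mult_top)
  qed
  also have "\<dots> \<le> (\<integral>\<^sup>+x. ennreal (exp (- \<phi> 1 x) / Z * exp (tilt a d p x)) \<partial>leb_pos)"
  proof (intro nn_integral_mono ennreal_leI)
    fix x assume "x \<in> space leb_pos"
    then have "exp c \<le> exp (- \<phi> 1 x + tilt a d p x)"
      using K'[of x] by (simp add: tilt_split c_def space_leb_pos)
    then have "exp c / Z \<le> exp (- \<phi> 1 x + tilt a d p x) / Z"
      using Z_pos by (intro divide_right_mono) auto
    then show "exp c / Z \<le> exp (- \<phi> 1 x) / Z * exp (tilt a d p x)" by (simp only: exp_add) simp
  qed
  also have "\<dots> = partfn a d p" unfolding partfn_def by (subst nn_integral_base) auto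
  finally show ?thesis by (simp add: top_unique)
qed

lemma minimizer_le_1: "minimizer a d p \<Longrightarrow> partfn a d p \<le> 1"
  using partfn_0[of a d] unfolding minimizer_def by metis

lemma minimizer_finite: "minimizer a d p \<Longrightarrow> partfn a d p < \<infinity>"
  using minimizer_le_1[of a d p] by (auto intro: order.strict_trans1)

lemma minimizer_top_nonpos: "minimizer a d p \<Longrightarrow> p k \<le> 0"
proof (rule ccontr)
  assume "minimizer a d p" "\<not> p k \<le> 0"
  then show False using minimizer_le_1[of a d p] partfn_infinite[of p a d] by (simp add: top_unique)
qed

lemma partfn_enn2real:
  "partfn a d p < \<infinity> \<Longrightarrow> partfn a d p = ennreal (enn2real (partfn a d p)) \<and> enn2real (partfn a d p) > 0"
  using partfn_pos[of a d p] by (auto simp: enn2real_positive_iff)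

lemma sets_tilted[simp, measurable_cong]: "sets (tilted a d p) = sets borel_pos"
  by (simp add: tilted_def)

lemma space_tilted[simp]: "space (tilted a d p) = {0<..}"
  by (simp add: tilted_def)

lemma nn_integral_tilted_density:
  assumes "partfn a d p < \<infinity>"
  shows "(\<integral>\<^sup>+x. ennreal (exp (tilt a d p x) / enn2real (partfn a d p)) \<partial>base_law \<phi>) = 1"
proof -
  note f = partfn_enn2real[OF assms]
  have "(\<integral>\<^sup>+x. ennreal (exp (tilt a d p x) / enn2real (partfn a d p)) \<partial>base_law \<phi>)
    = (\<integral>\<^sup>+x. ennreal (exp (tilt a d p x)) / ennreal (enn2real (partfn a d p)) \<partial>base_law \<phi>)"
    using f by (intro nn_integral_cong) (subst divide_ennreal, auto)
  also have "\<dots> = partfn a d p / ennreal (enn2real (partfn a d p))"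
    unfolding partfn_def by (subst nn_integral_divide) auto
  also have "\<dots> = 1" using f assms
    by (metis ennreal_divide_self ennreal_eq_0_iff infinity_ennreal_def not_le order_less_irrefl)
  finally show ?thesis .
qed

lemma prob_space_tilted:
  assumes "partfn a d p < \<infinity>" shows "prob_space (tilted a d p)"
proof
  have "emeasure (tilted a d p) (space (tilted a d p))
    = (\<integral>\<^sup>+x. ennreal (exp (tilt a d p x) / enn2real (partfn a d p)) \<partial>base_law \<phi>)"
    unfolding tilted_def by (subst emeasure_density) (auto intro!: nn_integral_cong)
  then show "emeasure (tilted a d p) (space (tilted a d p)) = 1"
    using nn_integral_tilted_density[OF assms] by simp
qed

lemma measure_tilted_space: "partfn a d p < \<infinity> \<Longrightarrow> measure (tilted a d p) {0<..} = 1"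
  using prob_space.prob_space[OF prob_space_tilted] by fastforce

lemma nn_integral_tilted:
  assumes fin: "partfn a d p < \<infinity>" and [measurable]: "f \<in> borel_measurable borel_pos"
  shows "(\<integral>\<^sup>+x. ennreal (exp (tilt a d p x)) * f x \<partial>base_law \<phi>) = partfn a d p * (\<integral>\<^sup>+x. f x \<partial>tilted a d p)"
proof -
  note F = partfn_enn2real[OF fin]
  let ?F = "enn2real (partfn a d p)"
  have "(\<integral>\<^sup>+x. ennreal (exp (tilt a d p x)) * f x \<partial>base_law \<phi>)
     = (\<integral>\<^sup>+x. ennreal ?F * (ennreal (exp (tilt a d p x) / ?F) * f x) \<partial>base_law \<phi>)"
  proof (rule nn_integral_cong)
    fix x
    have "ennreal (exp (tilt a d p x)) = ennreal ?F * ennreal (exp (tilt a d p x) / ?F)"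
      using F by (subst ennreal_mult[symmetric]) auto
    then show "ennreal (exp (tilt a d p x)) * f x = ennreal ?F * (ennreal (exp (tilt a d p x) / ?F) * f x)"
      by (simp only: mult.assoc)
  qed
  also have "\<dots> = ennreal ?F * (\<integral>\<^sup>+x. ennreal (exp (tilt a d p x) / ?F) * f x \<partial>base_law \<phi>)"
    by (subst nn_integral_cmult) auto
  also have "(\<integral>\<^sup>+x. ennreal (exp (tilt a d p x) / ?F) * f x \<partial>base_law \<phi>) = (\<integral>\<^sup>+x. f x \<partial>tilted a d p)"
    unfolding tilted_def by (subst nn_integral_density) auto
  finally show ?thesis using F by metis
qed

section \<open>First-order conditions\<close>

text \<open>
  The directional derivative of the partition function at a minimizer is nonnegative.  The direction
  changes coordinate \<open>i\<close> at rate \<open>\<sigma>\<close> and the last coordinate at rate \<open>\<rho>\<close>, and \<open>s\<close>, \<open>s'\<close> bound the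
  growth of the two absolute values.  A negative last parameter at the far end of the segment ensures
  finiteness there.
\<close>
lemma minimizer_direction:
  assumes min: "minimizer a d p" and d: "d \<ge> 0" and i: "i \<in> {1..<k}" and t0: "t0 > 0"
    and si: "\<And>t. 0 < t \<Longrightarrow> t \<le> t0 \<Longrightarrow> \<bar>p i + t * \<sigma>\<bar> \<le> \<bar>p i\<bar> + t * s"
    and sk: "\<And>t. 0 < t \<Longrightarrow> t \<le> t0 \<Longrightarrow> \<bar>p k + t * \<rho>\<bar> \<le> \<bar>p k\<bar> + t * s'"
    and top: "p k + t0 * \<rho> < 0"
  defines "Y \<equiv> \<lambda>x. \<sigma> * (\<phi> i x - a i) + \<rho> * (\<phi> k x - a k) + d * (s + s')"
  shows "integrable (tilted a d p) Y" and "0 \<le> (\<integral>x. Y x \<partial>tilted a d p)"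
proof -
  note fin = minimizer_finite[OF min]
  interpret \<nu>: prob_space "tilted a d p" by (rule prob_space_tilted[OF fin])
  have ik: "i \<in> {1..k}" "i \<noteq> k" using i by auto
  have [measurable]: "\<phi> i \<in> borel_measurable borel_pos" "\<phi> k \<in> borel_measurable borel_pos"
    using ik k_mem by auto
  have Ym[measurable]: "Y \<in> borel_measurable borel_pos" unfolding Y_def by measurable
  have Ym': "Y \<in> borel_measurable (tilted a d p)" by measurable
  define e where "e l = (if l = i then \<sigma> else 0) + (if l = k then \<rho> else 0)" for l
  define q where "q t l = p l + t * e l" for t l
  have lin: "(\<Sum>l\<in>{1..k}. e l * g l) = \<sigma> * g i + \<rho> * g k" for g :: "nat \<Rightarrow> real"
    using ik k by (simp add: e_def distrib_right sum.distrib mult_delta_left)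
  have abs: "(\<Sum>l\<in>{1..k}. \<bar>q t l\<bar>)
      = (\<Sum>l\<in>{1..k}. \<bar>p l\<bar>) + (\<bar>p i + t * \<sigma>\<bar> - \<bar>p i\<bar>) + (\<bar>p k + t * \<rho>\<bar> - \<bar>p k\<bar>)" for t
  proof -
    have "(\<Sum>l\<in>{1..k}. \<bar>q t l\<bar>) = (\<Sum>l\<in>{1..k}. \<bar>p l\<bar> + (if l = i then \<bar>p i + t * \<sigma>\<bar> - \<bar>p i\<bar> else 0)
        + (if l = k then \<bar>p k + t * \<rho>\<bar> - \<bar>p k\<bar> else 0))"
      using ik by (intro sum.cong refl) (auto simp: q_def e_def)
    then show ?thesis using ik k by (simp add: sum.distrib)
  qed
  \<comment> \<open>The exponent at \<open>q t\<close> exceeds the one at \<open>p\<close> by \<open>t * Y\<close>, up to the constant error \<open>c t \<le> 0\<close>.\<close>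
  define c where "c t = d * ((\<Sum>l\<in>{1..k}. \<bar>q t l\<bar>) - (\<Sum>l\<in>{1..k}. \<bar>p l\<bar>) - t * (s + s'))" for t
  have tilt_q: "tilt a d (q t) x = tilt a d p x + t * Y x + c t" for t x
  proof -
    have "(\<Sum>l\<in>{1..k}. q t l * (\<phi> l x - a l))
      = (\<Sum>l\<in>{1..k}. p l * (\<phi> l x - a l)) + t * (\<Sum>l\<in>{1..k}. e l * (\<phi> l x - a l))"
      by (simp add: q_def distrib_right sum.distrib sum_distrib_left mult.assoc)
    then show ?thesis
      unfolding lin tilt_eq Y_def c_def by (simp add: algebra_simps)
  qed
  have c_le: "c t \<le> 0" if "0 < t" "t \<le> t0" for t
    using si[OF that] sk[OF that] d unfolding c_def abs
    by (intro mult_nonneg_nonpos) (auto simp: algebra_simps)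
  have eq: "partfn a d (q t) = ennreal (exp (c t))
      * (partfn a d p * (\<integral>\<^sup>+x. ennreal (exp (t * Y x)) \<partial>tilted a d p))" for t
  proof -
    have "partfn a d (q t)
        = (\<integral>\<^sup>+x. ennreal (exp (c t)) * (ennreal (exp (tilt a d p x)) * ennreal (exp (t * Y x))) \<partial>base_law \<phi>)"
      unfolding partfn_def tilt_q by (intro nn_integral_cong) (simp add: exp_add ennreal_mult mult_ac)
    also have "\<dots> = ennreal (exp (c t)) * (\<integral>\<^sup>+x. ennreal (exp (tilt a d p x)) * ennreal (exp (t * Y x)) \<partial>base_law \<phi>)"
      by (subst nn_integral_cmult) auto
    also have "(\<integral>\<^sup>+x. ennreal (exp (tilt a d p x)) * ennreal (exp (t * Y x)) \<partial>base_law \<phi>)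
      = partfn a d p * (\<integral>\<^sup>+x. ennreal (exp (t * Y x)) \<partial>tilted a d p)"
      by (subst nn_integral_tilted[OF fin]) auto
    finally show ?thesis .
  qed
  have ge: "1 \<le> (\<integral>\<^sup>+x. ennreal (exp (t * Y x)) \<partial>tilted a d p)" (is "1 \<le> ?I") if t: "0 < t" "t \<le> t0" for t
  proof -
    have "partfn a d p * 1 \<le> partfn a d (q t)" using min by (simp add: minimizer_def)
    also have "\<dots> \<le> ennreal 1 * (partfn a d p * ?I)"
      unfolding eq using c_le[OF t] by (intro mult_right_mono ennreal_leI) auto
    finally show ?thesis
      using fin partfn_pos[of a d p] ennreal_mult_le_mult_iff[of "partfn a d p" 1 ?I] by simp
  qed
  have int: "integrable (tilted a d p) (\<lambda>x. exp (t0 * Y x))"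
  proof -
    have "partfn a d (q t0) < \<infinity>"
      using top ik by (intro partfn_finite) (auto simp: q_def e_def)
    then have "(\<integral>\<^sup>+x. ennreal (exp (t0 * Y x)) \<partial>tilted a d p) < \<infinity>"
      unfolding eq using partfn_pos[of a d p] by (auto simp: ennreal_mult_less_top ennreal_eq_0_iff)
    then show ?thesis by (auto simp: integrable_iff_bounded)
  qed
  show "integrable (tilted a d p) Y"
    by (rule \<nu>.expectation_nonneg_if_exp_moments_ge_1(1)[OF Ym' t0 int ge])
  show "0 \<le> (\<integral>x. Y x \<partial>tilted a d p)"
    by (rule \<nu>.expectation_nonneg_if_exp_moments_ge_1(2)[OF Ym' t0 int ge])
qed

text \<open>
  The Karush-Kuhn-Tucker conditions of the dual problem.  Decreasing the last parameter is always
  possible and shows that \<open>\<phi>\<^sub>k\<close>, hence every \<open>\<phi>\<^sub>i\<close>, has a finite mean.  A pure change of a parameter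
  \<open>p\<^sub>i\<close> with \<open>i < k\<close> may leave the domain if the parameters above it vanish; it is therefore combined
  with a decrease of \<open>p\<^sub>k\<close> at a small rate \<open>\<epsilon>\<close>, and \<open>\<epsilon>\<close> is then sent to \<open>0\<close>.  Increasing the last
  parameter is possible only if it is negative, which is why its mean may fall short of \<open>a\<^sub>k\<close>
  otherwise.
\<close>
lemma minimizer_moments:
  assumes min: "minimizer a d p" and d: "d \<ge> 0"
  shows integrable_phi: "\<And>i. i \<in> {1..k} \<Longrightarrow> integrable (tilted a d p) (\<phi> i)"
    and tilted_mean_top: "tilted_mean a d p k \<le> a k + d"
    and tilted_mean_le: "\<And>i. i \<in> {1..<k} \<Longrightarrow> \<bar>tilted_mean a d p i - a i\<bar> \<le> d"
    and tilted_mean_slack: "\<And>i. i \<in> {1..k} \<Longrightarrow> p i * (tilted_mean a d p i - a i) + d * \<bar>p i\<bar> = 0"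
proof -
  note fin = minimizer_finite[OF min] and pk = minimizer_top_nonpos[OF min]
  interpret \<nu>: prob_space "tilted a d p" by (rule prob_space_tilted[OF fin])
  have one: "1 \<in> {1..<k}" using k by auto
  have top: "integrable (tilted a d p) (\<lambda>x. 0 * (\<phi> 1 x - a 1) + (-1) * (\<phi> k x - a k) + d * (0 + 1))"
    "0 \<le> (\<integral>x. 0 * (\<phi> 1 x - a 1) + (-1) * (\<phi> k x - a k) + d * (0 + 1) \<partial>tilted a d p)"
    using pk by (intro minimizer_direction[OF min d one zero_less_one]; simp)+
  have "integrable (tilted a d p) (\<lambda>x. a k + d - (0 * (\<phi> 1 x - a 1) + (-1) * (\<phi> k x - a k) + d * (0 + 1)))"
    by (intro Bochner_Integration.integrable_diff top(1)) auto
  then have ik: "integrable (tilted a d p) (\<phi> k)" by simp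
  show tople: "tilted_mean a d p k \<le> a k + d"
    using top(2) ik by (simp add: tilted_mean_def measure_tilted_space[OF fin])
  have ii: "integrable (tilted a d p) (\<phi> i)" if i: "i \<in> {1..<k}" for i
  proof -
    obtain K where K: "\<And>x. x > 0 \<Longrightarrow> \<phi> i x \<le> K + 1 * \<phi> k x"
      using phi_le_top[OF i, of 1] by auto
    have m: "\<phi> i \<in> borel_measurable (tilted a d p)" using phi_measurable[of i] i by auto
    show ?thesis
    proof (rule Bochner_Integration.integrable_bound[where f="\<lambda>x. K + \<phi> k x"])
      show "integrable (tilted a d p) (\<lambda>x. K + \<phi> k x)" using ik by auto
      show "AE x in tilted a d p. norm (\<phi> i x) \<le> norm (K + \<phi> k x)"
        using K pos[of i] i by (intro AE_I2) (force simp: abs_of_pos)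
    qed (rule m)
  qed
  show integ: "integrable (tilted a d p) (\<phi> i)" if "i \<in> {1..k}" for i
    using ii[of i] ik that by (cases "i = k") auto
  have dir: "0 \<le> \<sigma> * (tilted_mean a d p i - a i) + d * (if p i = 0 then 1 else \<sigma> * sgn (p i))"
    if i: "i \<in> {1..<k}" and \<sigma>: "\<sigma> = 1 \<or> \<sigma> = -1" for i \<sigma>
  proof -
    let ?s = "if p i = 0 then 1 else \<sigma> * sgn (p i)"
    have "- (\<sigma> * (tilted_mean a d p i - a i) + d * ?s) \<le> 0 + e" if e: "e > 0" for e
    proof -
      \<comment> \<open>This rate makes the contribution of the last coordinate at most \<open>e\<close>.\<close>
      define \<epsilon> where "\<epsilon> = e / (\<bar>d - (tilted_mean a d p k - a k)\<bar> + 1)"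
      have \<epsilon>: "\<epsilon> > 0" using e by (simp add: \<epsilon>_def)
      \<comment> \<open>Up to this step size the parameter \<open>p i\<close> does not change its sign.\<close>
      let ?t0 = "if p i = 0 then 1 else \<bar>p i\<bar>"
      have "0 \<le> (\<integral>x. \<sigma> * (\<phi> i x - a i) + (- \<epsilon>) * (\<phi> k x - a k) + d * (?s + \<epsilon>) \<partial>tilted a d p)"
      proof (rule minimizer_direction(2)[OF min d i, where ?t0.0="?t0"])
        show "\<bar>p i + t * \<sigma>\<bar> \<le> \<bar>p i\<bar> + t * ?s" if "0 < t" "t \<le> ?t0" for t
          using that \<sigma> by (auto simp: sgn_if abs_if split: if_splits)
        show "\<bar>p k + t * (- \<epsilon>)\<bar> \<le> \<bar>p k\<bar> + t * \<epsilon>" if "0 < t" "t \<le> ?t0" for t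
          using pk mult_pos_pos[OF that(1) \<epsilon>] by (simp add: abs_if; linarith)
        show "p k + ?t0 * (- \<epsilon>) < 0"
        proof -
          have "?t0 * \<epsilon> > 0" using \<epsilon> by (intro mult_pos_pos) auto
          then show ?thesis using pk by simp
        qed
      qed simp
      also have "\<dots> = \<sigma> * (tilted_mean a d p i - a i) + d * ?s + \<epsilon> * (d - (tilted_mean a d p k - a k))"
        using ii[OF i] ik by (simp add: tilted_mean_def measure_tilted_space[OF fin] algebra_simps)
      also have "\<epsilon> * (d - (tilted_mean a d p k - a k)) \<le> \<epsilon> * (\<bar>d - (tilted_mean a d p k - a k)\<bar> + 1)"
        using \<epsilon> by (intro mult_left_mono) auto
      also have "\<dots> = e" by (simp add: \<epsilon>_def)
      finally show ?thesis by simp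
    qed
    then have "- (\<sigma> * (tilted_mean a d p i - a i) + d * ?s) \<le> 0" by (rule field_le_epsilon)
    then show ?thesis by simp
  qed
  show "\<bar>tilted_mean a d p i - a i\<bar> \<le> d" if i: "i \<in> {1..<k}" for i
    using dir[OF i, of 1] dir[OF i, of "-1"] d by (auto simp: sgn_if split: if_splits)
  have low: "p i * (tilted_mean a d p i - a i) + d * \<bar>p i\<bar> = 0" if i: "i \<in> {1..<k}" for i
  proof -
    have "p i = 0 \<or> (p i > 0 \<and> tilted_mean a d p i - a i = - d) \<or> (p i < 0 \<and> tilted_mean a d p i - a i = d)"
      using dir[OF i, of 1] dir[OF i, of "-1"] by (auto simp: sgn_if split: if_splits)
    then show ?thesis by auto
  qed
  have high: "p k * (tilted_mean a d p k - a k) + d * \<bar>p k\<bar> = 0"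
  proof (cases "p k = 0")
    case False
    then have pk': "p k < 0" using pk by simp
    have "0 \<le> (\<integral>x. 0 * (\<phi> 1 x - a 1) + 1 * (\<phi> k x - a k) + d * (0 + (- 1)) \<partial>tilted a d p)"
      using pk' by (intro minimizer_direction(2)[OF min d one, where ?t0.0="- p k / 2"]) auto
    then have "tilted_mean a d p k \<ge> a k + d" using ik by (simp add: tilted_mean_def measure_tilted_space[OF fin])
    then have "tilted_mean a d p k - a k = d" using tople by simp
    then show ?thesis using pk' by simp
  qed simp
  show "p i * (tilted_mean a d p i - a i) + d * \<bar>p i\<bar> = 0" if "i \<in> {1..k}" for i
    using low[of i] high that by (cases "i = k") auto
qed

text \<open>
  Convexity makes the first-order conditions sufficient: Jensen's inequality under the tilted law
  bounds the quotient of the partition functions at \<open>q\<close> and at \<open>p\<close> from below by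
  \<open>exp (q\<^sub>k (m\<^sub>k - a\<^sub>k)) \<ge> 1\<close>, where \<open>m\<^sub>k\<close> is the last tilted mean and \<open>q\<^sub>k \<le> 0\<close>.
\<close>
lemma minimizer_of_moments:
  assumes fin: "partfn a 0 p < \<infinity>" and pk: "p k = 0"
    and int: "\<And>i. i \<in> {1..k} \<Longrightarrow> integrable (tilted a 0 p) (\<phi> i)"
    and eq: "\<And>i. i \<in> {1..<k} \<Longrightarrow> tilted_mean a 0 p i = a i" and le: "tilted_mean a 0 p k \<le> a k"
  shows "minimizer a 0 p"
  unfolding minimizer_def
proof
  fix q
  interpret \<nu>: prob_space "tilted a 0 p" by (rule prob_space_tilted[OF fin])
  show "partfn a 0 p \<le> partfn a 0 q"
  proof (cases "q k > 0")
    case True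
    then show ?thesis by (simp add: partfn_infinite)
  next
    case False
    define Y where "Y x = (\<Sum>i\<in>{1..k}. (q i - p i) * (\<phi> i x - a i))" for x
    have iY: "integrable (tilted a 0 p) Y" unfolding Y_def
      using int by (intro Bochner_Integration.integrable_sum integrable_mult_right
          Bochner_Integration.integrable_diff) auto
    have tq: "tilt a 0 q x = tilt a 0 p x + Y x" for x
      by (simp add: tilt_def Y_def left_diff_distrib sum_subtractf)
    have [measurable]: "Y \<in> borel_measurable borel_pos"
      using iY measurable_cong_sets[OF sets_tilted refl] by blast
    have EY: "\<nu>.expectation Y = (\<Sum>i\<in>{1..k}. (q i - p i) * (tilted_mean a 0 p i - a i))"
      unfolding Y_def using int
      by (subst Bochner_Integration.integral_sum)
          (auto simp: tilted_mean_def measure_tilted_space[OF fin] intro!: integrable_mult_right sum.cong)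
    also have "\<dots> = q k * (tilted_mean a 0 p k - a k)"
      unfolding sum_split_top using eq pk by simp
    also have "\<dots> \<ge> 0" using False le by (intro mult_nonpos_nonpos) auto
    finally have "1 \<le> exp (\<nu>.expectation Y)" by simp
    then have "1 \<le> ennreal (exp (\<nu>.expectation Y))" by (metis ennreal_1 ennreal_leI)
    also have "\<dots> \<le> (\<integral>\<^sup>+x. ennreal (exp (Y x)) \<partial>tilted a 0 p)" by (rule \<nu>.exp_expectation_le[OF iY])
    finally have "partfn a 0 p * 1 \<le> partfn a 0 p * (\<integral>\<^sup>+x. ennreal (exp (Y x)) \<partial>tilted a 0 p)"
      by (intro mult_left_mono) auto
    also have "\<dots> = partfn a 0 q"
      unfolding partfn_def[of a 0 q] tq
      by (subst nn_integral_tilted[OF fin, symmetric]) (auto simp: exp_add ennreal_mult)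
    finally show ?thesis by simp
  qed
qed

section \<open>Existence of minimizers\<close>

text \<open>Fatou's lemma.  Full continuity fails at the boundary of the domain, where the value may jump down.\<close>
lemma partfn_lower_semicontinuous:
  assumes q: "\<And>i. i \<in> {1..k} \<Longrightarrow> (\<lambda>n. q n i) \<longlonglongrightarrow> p i"
  shows "partfn a d p \<le> liminf (\<lambda>n. partfn a d (q n))"
proof -
  have "partfn a d p = (\<integral>\<^sup>+x. liminf (\<lambda>n. ennreal (exp (tilt a d (q n) x))) \<partial>base_law \<phi>)"
    unfolding partfn_def
  proof (rule nn_integral_cong)
    fix x
    have "(\<lambda>n. ennreal (exp (tilt a d (q n) x))) \<longlonglongrightarrow> ennreal (exp (tilt a d p x))"
      unfolding tilt_def by (intro tendsto_ennrealI tendsto_intros q)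
    then show "ennreal (exp (tilt a d p x)) = liminf (\<lambda>n. ennreal (exp (tilt a d (q n) x)))"
      by (rule lim_imp_Liminf[OF sequentially_bot, symmetric])
  qed
  also have "\<dots> \<le> liminf (\<lambda>n. partfn a d (q n))"
    unfolding partfn_def by (rule nn_integral_liminf) measurable
  finally show ?thesis .
qed

text \<open>
  The value \<open>1\<close> is attained at \<open>p = 0\<close>, so only parameters with a value at most \<open>1\<close> compete.  The bound
  is uniform in the window size.
\<close>
definition coercive :: "(nat \<Rightarrow> real) \<Rightarrow> real \<Rightarrow> bool" where
  "coercive a K \<longleftrightarrow> (\<forall>d\<ge>0. \<forall>p. partfn a d p \<le> 1 \<longrightarrow> (\<forall>i\<in>{1..k}. \<bar>p i\<bar> \<le> K))"

lemma minimizer_exists: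
  assumes co: "coercive a K" and d: "d \<ge> 0"
  shows "\<exists>p. minimizer a d p"
proof -
  let ?I = "INF q. partfn a d q"
  have I1: "?I \<le> 1" using INF_lower[of "\<lambda>_. 0" UNIV "partfn a d"] by simp
  show ?thesis
  proof (cases "?I = 1")
    case True
    then have "minimizer a d (\<lambda>_. 0)"
      unfolding minimizer_def by (metis INF_lower UNIV_I partfn_0)
    then show ?thesis by blast
  next
    case False
    \<comment> \<open>A minimizing sequence eventually has values below \<open>1\<close> and is then bounded.\<close>
    then have lt: "?I < 1" using I1 by simp
    obtain f :: "nat \<Rightarrow> ennreal" where f: "decseq f" "range f \<subseteq> range (partfn a d)" "?I = (INF n. f n)"
      using ennreal_Inf_countable_INF[of "range (partfn a d)"] by auto
    have lim: "f \<longlonglongrightarrow> ?I" using LIMSEQ_INF[OF f(1)] f(3) by simp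
    then have "\<forall>\<^sub>F n in sequentially. f n < 1" using lt by (rule order_tendstoD)
    then obtain N where N: "\<And>n. n \<ge> N \<Longrightarrow> f n < 1" by (auto simp: eventually_sequentially)
    have "\<forall>n. \<exists>q. f (n + N) = partfn a d q" using f(2) by auto
    then obtain q where q: "\<And>n. f (n + N) = partfn a d (q n)" by metis
    have "partfn a d (q n) \<le> 1" for n using N[of "n + N"] unfolding q by simp
    then have "\<bar>q n i\<bar> \<le> K" if "i \<in> {1..k}" for n i
      using co d that unfolding coercive_def by blast
    then obtain r p where r: "strict_mono r" and p: "\<forall>i\<in>{1..k}. (\<lambda>n. q (r n) i) \<longlonglongrightarrow> p i"
      using bounded_componentwise_subsequence[of "{1..k}" q K] by auto
    have "(\<lambda>n. partfn a d (q n)) \<longlonglongrightarrow> ?I"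
      using LIMSEQ_ignore_initial_segment[OF lim, of N] by (simp add: q)
    then have "(\<lambda>n. partfn a d (q (r n))) \<longlonglongrightarrow> ?I"
      using LIMSEQ_subseq_LIMSEQ[OF _ r] by (auto simp: comp_def)
    then have "liminf (\<lambda>n. partfn a d (q (r n))) = ?I" by (simp add: lim_imp_Liminf)
    moreover have "partfn a d p \<le> liminf (\<lambda>n. partfn a d (q (r n)))"
      using p by (intro partfn_lower_semicontinuous) auto
    ultimately have "minimizer a d p"
      unfolding minimizer_def by (metis INF_lower UNIV_I order.trans)
    then show ?thesis by blast
  qed
qed

lemma minimizer_bounded:
  "coercive a K \<Longrightarrow> d \<ge> 0 \<Longrightarrow> minimizer a d p \<Longrightarrow> i \<in> {1..k} \<Longrightarrow> \<bar>p i\<bar> \<le> K"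
  using minimizer_le_1 unfolding coercive_def by blast

lemma sigma_finite_leb_pos: "sigma_finite_measure leb_pos"
  unfolding leb_pos_def by (rule sigma_finite_measure_restrict_space) (auto intro: sigma_finite_lborel)

text \<open>
  The entropy is a difference of two integrals in \<open>[0,\<infinity>]\<close>.  The integral of the negative part of
  \<open>f log f\<close> is finite because \<open>- f log f \<le> f \<phi>\<^sub>1 + exp (- \<phi>\<^sub>1)\<close> and \<open>\<phi>\<^sub>1\<close> has a finite mean, so an entropy other than \<open>-\<infinity>\<close> makes
  the other integral finite too.
\<close>
lemma integrable_log_density:
  assumes \<mu>: "\<mu> \<in> probs borel_pos" and ent: "diff_entropy \<mu> \<noteq> - \<infinity>" and i1: "integrable \<mu> (\<phi> 1)"
  shows "\<exists>f. (\<forall>x. 0 \<le> f x) \<and> f \<in> borel_measurable borel_pos \<and> \<mu> = density leb_pos (\<lambda>x. ennreal (f x))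
    \<and> integrable \<mu> (\<lambda>x. ln (f x))"
proof -
  interpret L: sigma_finite_measure leb_pos by (rule sigma_finite_leb_pos)
  interpret \<mu>: prob_space \<mu> using \<mu> by (simp add: probs_def)
  have smu: "sets \<mu> = sets leb_pos" using \<mu> by (simp add: probs_def sets_leb_pos)
  note [measurable_cong] = sets_leb_pos
  have ac: "absolutely_continuous leb_pos \<mu>" using ent by (auto simp: diff_entropy_def split: if_splits)
  define f where "f x = enn2real (RN_deriv leb_pos \<mu> x)" for x
  have fm[measurable]: "f \<in> borel_measurable borel_pos"
  proof -
    have "f \<in> borel_measurable leb_pos" unfolding f_def by measurable
    then show ?thesis using sets_leb_pos measurable_cong_sets by blast
  qed
  have f0: "0 \<le> f x" for x by (simp add: f_def)
  have "AE x in leb_pos. RN_deriv leb_pos \<mu> x \<noteq> \<infinity>"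
    by (rule L.RN_deriv_finite[OF \<mu>.sigma_finite_measure_axioms ac smu])
  then have "AE x in leb_pos. RN_deriv leb_pos \<mu> x = ennreal (f x)"
    by eventually_elim (simp add: f_def ennreal_enn2real_if)
  then have "density leb_pos (RN_deriv leb_pos \<mu>) = density leb_pos (\<lambda>x. ennreal (f x))"
    using leb_pos_measurable[OF fm] by (intro density_cong) auto
  then have dens: "\<mu> = density leb_pos (\<lambda>x. ennreal (f x))"
    using L.density_RN_deriv[OF ac smu] by simp
  have fl[measurable]: "f \<in> borel_measurable leb_pos" by (rule leb_pos_measurable[OF fm])
  have p1[measurable]: "\<phi> 1 \<in> borel_measurable leb_pos" by (rule leb_pos_measurable[OF phi1_measurable(1)])
  let ?A = "\<integral>\<^sup>+x. ennreal (- (f x * ln (f x))) \<partial>leb_pos"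
  let ?B = "\<integral>\<^sup>+x. ennreal (f x * ln (f x)) \<partial>leb_pos"
  have "?A \<le> (\<integral>\<^sup>+x. ennreal (f x) * ennreal (\<phi> 1 x) + ennreal (exp (- \<phi> 1 x)) \<partial>leb_pos)"
  proof (rule nn_integral_mono)
    fix x assume "x \<in> space leb_pos"
    then have x: "x > 0" by (simp add: space_leb_pos)
    have p: "\<phi> 1 x > 0" using pos[OF k_mem(1) x] .
    have "- (f x * ln (f x)) \<le> f x * \<phi> 1 x + exp (- \<phi> 1 x)"
    proof (cases "f x = 0")
      case False
      then have fx: "f x > 0" using f0[of x] by simp
      have "ln (exp (- \<phi> 1 x) / f x) \<le> exp (- \<phi> 1 x) / f x - 1" using fx by (intro ln_le_minus_one) simp
      then have "- \<phi> 1 x - ln (f x) \<le> exp (- \<phi> 1 x) / f x" using fx by (simp add: ln_div)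
      then have "f x * (- \<phi> 1 x - ln (f x)) \<le> exp (- \<phi> 1 x)" using fx by (simp add: field_simps)
      then show ?thesis by (simp add: algebra_simps)
    qed simp
    then have "ennreal (- (f x * ln (f x))) \<le> ennreal (f x * \<phi> 1 x + exp (- \<phi> 1 x))" by (rule ennreal_leI)
    then show "ennreal (- (f x * ln (f x))) \<le> ennreal (f x) * ennreal (\<phi> 1 x) + ennreal (exp (- \<phi> 1 x))"
      using f0[of x] p by (simp add: ennreal_mult)
  qed
  also have "\<dots> = (\<integral>\<^sup>+x. ennreal (f x) * ennreal (\<phi> 1 x) \<partial>leb_pos) + (\<integral>\<^sup>+x. ennreal (exp (- \<phi> 1 x)) \<partial>leb_pos)"
    by (rule nn_integral_add) measurable
  also have "(\<integral>\<^sup>+x. ennreal (f x) * ennreal (\<phi> 1 x) \<partial>leb_pos) = (\<integral>\<^sup>+x. ennreal (\<phi> 1 x) \<partial>\<mu>)"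
    by (subst dens, subst nn_integral_density) auto
  also have "\<dots> < \<infinity>"
    by (rule nn_integral_less_top_if_integrable[OF i1])
  finally have A: "?A < \<infinity>"
    using int_exp_phi1 by (auto simp: integrable_iff_bounded ennreal_add_less_top)
  have "diff_entropy \<mu> = enn2ereal ?A - enn2ereal ?B"
    using ac by (simp add: diff_entropy_def Let_def f_def)
  then have B: "?B < \<infinity>"
    using ent A by (cases ?A; cases ?B) (auto simp: top.not_eq_extremum)
  have "(\<integral>\<^sup>+x. ennreal (norm (f x * ln (f x))) \<partial>leb_pos)
    = (\<integral>\<^sup>+x. ennreal (- (f x * ln (f x))) + ennreal (f x * ln (f x)) \<partial>leb_pos)"
    by (intro nn_integral_cong) (auto simp: abs_if ennreal_neg)
  also have "\<dots> = ?A + ?B" by (rule nn_integral_add) measurable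
  finally have "integrable leb_pos (\<lambda>x. f x *\<^sub>R ln (f x))"
    using A B by (auto simp: integrable_iff_bounded ennreal_add_less_top)
  then have "integrable \<mu> (\<lambda>x. ln (f x))"
    by (subst dens, subst integrable_density) (auto simp: f0)
  then show ?thesis using f0 fm dens by blast
qed

text \<open>
  A Gibbs variational inequality: for any \<open>\<mu>\<close> with a density \<open>f\<close> and finite entropy, Jensen's
  inequality applied to \<open>log\<close> of the integrand divided by \<open>f\<close> bounds the partition function from below
  in terms of the moments of \<open>\<mu>\<close>.
\<close>
lemma partfn_lower_bound:
  assumes \<mu>: "\<mu> \<in> probs borel_pos" and ent: "diff_entropy \<mu> \<noteq> - \<infinity>"
    and v: "\<And>i. i \<in> {1..<k} \<Longrightarrow> has_bochner_integral \<mu> (\<phi> i) (v i)"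
    and w: "(\<integral>\<^sup>+x. ennreal (\<phi> k x) \<partial>\<mu>) \<le> ennreal w" "w \<ge> 0"
  shows "\<exists>D>0. \<forall>p. p k \<le> 0 \<longrightarrow>
    ennreal (D * exp ((\<Sum>i\<in>{1..<k}. p i * (v i - a i)) + p k * (w - a k))) \<le> partfn a 0 p"
proof -
  interpret \<mu>: prob_space \<mu> using \<mu> by (simp add: probs_def)
  have smu: "sets \<mu> = sets borel_pos" using \<mu> by (simp add: probs_def)
  have spmu: "space \<mu> = {0<..}" using sets_eq_imp_space_eq[OF smu] by (simp add: space_borel_pos)
  have one: "1 \<in> {1..<k}" using k by auto
  obtain f where f0: "\<And>x. 0 \<le> f x" and fm[measurable]: "f \<in> borel_measurable borel_pos"
    and dens: "\<mu> = density leb_pos (\<lambda>x. ennreal (f x))" and il: "integrable \<mu> (\<lambda>x. ln (f x))"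
    using integrable_log_density[OF \<mu> ent] v[OF one] by (auto simp: has_bochner_integral_iff)
  note [measurable_cong] = sets_leb_pos
  have ik: "integrable \<mu> (\<phi> k)"
  proof -
    have "(\<integral>\<^sup>+x. ennreal (norm (\<phi> k x)) \<partial>\<mu>) = (\<integral>\<^sup>+x. ennreal (\<phi> k x) \<partial>\<mu>)"
      using pos[OF k_mem(2)] spmu by (intro nn_integral_cong) (auto simp: abs_of_pos)
    also have "\<dots> < \<infinity>" using w by (auto intro: order.strict_trans1)
    finally show ?thesis
      using phi_measurable[OF k_mem(2)]
      by (simp add: integrable_iff_bounded measurable_cong_sets[OF smu refl])
  qed
  have mk: "integral\<^sup>L \<mu> (\<phi> k) \<le> w"
  proof -
    have "ennreal (integral\<^sup>L \<mu> (\<phi> k)) = (\<integral>\<^sup>+x. ennreal (\<phi> k x) \<partial>\<mu>)"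
      using pos[OF k_mem(2)] spmu by (intro nn_integral_eq_integral[symmetric] ik AE_I2) (auto intro: less_imp_le)
    then have "ennreal (integral\<^sup>L \<mu> (\<phi> k)) \<le> ennreal w" using w(1) by (simp only:)
    then show ?thesis using w(2) by (subst (asm) ennreal_le_iff)
  qed
  have ii: "integrable \<mu> (\<phi> i)" if "i \<in> {1..k}" for i
    using v[of i] ik that by (cases "i = k") (auto simp: has_bochner_integral_iff)
  define L where "L = integral\<^sup>L \<mu> (\<lambda>x. ln (f x))"
  define D where "D = exp (- v 1 - ln Z - L)"
  have "ennreal (D * exp ((\<Sum>i\<in>{1..<k}. p i * (v i - a i)) + p k * (w - a k))) \<le> partfn a 0 p"
    if pk: "p k \<le> 0" for p
  proof -
    \<comment> \<open>The logarithm of the integrand divided by \<open>f\<close>, with respect to Lebesgue measure.\<close>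
    define Y where "Y x = tilt a 0 p x - \<phi> 1 x - ln Z - ln (f x)" for x
    have it: "integrable \<mu> (tilt a 0 p)" unfolding tilt_def
      using ii by (auto intro!: Bochner_Integration.integrable_sum integrable_mult_right
          Bochner_Integration.integrable_diff)
    have iY: "integrable \<mu> Y" unfolding Y_def using it ii[of 1] k il by auto
    have "integral\<^sup>L \<mu> (tilt a 0 p) = (\<Sum>i\<in>{1..k}. p i * (integral\<^sup>L \<mu> (\<phi> i) - a i))"
      unfolding tilt_def using ii
      by (subst Bochner_Integration.integral_sum) (auto simp: \<mu>.prob_space intro!: integrable_mult_right sum.cong)
    also have "\<dots> = (\<Sum>i\<in>{1..<k}. p i * (v i - a i)) + p k * (integral\<^sup>L \<mu> (\<phi> k) - a k)"
      unfolding sum_split_top using v by (intro arg_cong2[where f="(+)"] sum.cong refl)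
          (auto simp: has_bochner_integral_iff)
    also have "\<dots> \<ge> (\<Sum>i\<in>{1..<k}. p i * (v i - a i)) + p k * (w - a k)"
      using pk mk by (intro add_left_mono mult_left_mono_neg) auto
    finally have It: "integral\<^sup>L \<mu> (tilt a 0 p) \<ge> (\<Sum>i\<in>{1..<k}. p i * (v i - a i)) + p k * (w - a k)" .
    have "integral\<^sup>L \<mu> Y = integral\<^sup>L \<mu> (tilt a 0 p) - v 1 - ln Z - L"
      unfolding Y_def L_def using it ii[of 1] k il v[OF one]
      by (simp add: \<mu>.prob_space has_bochner_integral_iff)
    then have "D * exp ((\<Sum>i\<in>{1..<k}. p i * (v i - a i)) + p k * (w - a k)) \<le> exp (integral\<^sup>L \<mu> Y)"
      using It unfolding D_def by (simp flip: exp_add)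
    then have "ennreal (D * exp ((\<Sum>i\<in>{1..<k}. p i * (v i - a i)) + p k * (w - a k))) \<le> ennreal (exp (integral\<^sup>L \<mu> Y))"
      by (rule ennreal_leI)
    also have "\<dots> \<le> (\<integral>\<^sup>+x. ennreal (exp (Y x)) \<partial>\<mu>)" by (rule \<mu>.exp_expectation_le[OF iY])
    also have "\<dots> = (\<integral>\<^sup>+x. ennreal (f x) * ennreal (exp (Y x)) \<partial>leb_pos)"
    proof -
      have "Y \<in> borel_measurable leb_pos" unfolding Y_def
        by (intro leb_pos_measurable) measurable
      then show ?thesis using leb_pos_measurable[OF fm] by (subst dens, subst nn_integral_density) auto
    qed
    also have "\<dots> \<le> (\<integral>\<^sup>+x. ennreal (exp (- \<phi> 1 x) / Z * exp (tilt a 0 p x)) \<partial>leb_pos)"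
    proof (rule nn_integral_mono)
      fix x
      have "f x * exp (Y x) \<le> exp (- \<phi> 1 x) / Z * exp (tilt a 0 p x)"
      proof (cases "f x = 0")
        case False
        then have fx: "f x > 0" using f0[of x] by simp
        have "f x * exp (Y x) = exp (ln (f x)) * exp (Y x)" using fx by simp
        also have "\<dots> = exp (- \<phi> 1 x) / exp (ln Z) * exp (tilt a 0 p x)"
          by (simp add: Y_def exp_diff exp_minus exp_add field_simps)
        finally show ?thesis using Z_pos by simp
      qed (use Z_pos in simp)
      then show "ennreal (f x) * ennreal (exp (Y x)) \<le> ennreal (exp (- \<phi> 1 x) / Z * exp (tilt a 0 p x))"
        using f0[of x] by (subst ennreal_mult[symmetric]) (auto intro: ennreal_leI)
    qed
    also have "\<dots> = partfn a 0 p" unfolding partfn_def by (subst nn_integral_base) auto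
    finally show ?thesis .
  qed
  moreover have "D > 0" by (simp add: D_def)
  ultimately show ?thesis by blast
qed

text \<open>
  Applying the previous bound to measures whose \<open>i\<close>-th moment is shifted by \<open>\<plusminus> r\<close>, for \<open>i < k\<close>, controls \<open>\<plusminus> p\<^sub>i\<close>.  A
  measure whose last moment is strictly below \<open>a\<^sub>k\<close> controls the last parameter, which is nonpositive.
\<close>
lemma admissible_coercive:
  assumes g1_cont: "continuous_map (subtopology (euclid {1..<k}) (A1_set k \<phi>)) euclideanreal (g1 k \<phi>)"
    and a: "a \<in> admissible k \<phi>"
  shows "\<exists>K. coercive a K"
proof -
  let ?A = "A1_set k \<phi>" and ?a = "proj1 k a"
  have aA: "?a \<in> ?A" and ak: "g1 k \<phi> ?a < a k" using a by (auto simp: admissible_def)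
  \<comment> \<open>A level strictly between, so that \<open>a\<close> has room in the last coordinate.\<close>
  define c where "c = (g1 k \<phi> ?a + a k) / 2"
  have c: "g1 k \<phi> ?a < c" "c < a k" using ak by (auto simp: c_def)
  have c0: "c > 0" using c by (auto simp: g1_def intro: order.strict_trans1[OF enn2real_nonneg])
  define U where "U = {w \<in> ?A. g1 k \<phi> w < c}"
  have Aop: "openin (euclid {1..<k}) ?A" by (simp add: A1_set_def)
  have Asub: "?A \<subseteq> topspace (euclid {1..<k})" by (rule openin_subset[OF Aop])
  have "openin (subtopology (euclid {1..<k}) ?A) {w \<in> topspace (subtopology (euclid {1..<k}) ?A). g1 k \<phi> w \<in> {..<c}}"
    by (rule openin_continuous_map_preimage[OF g1_cont]) auto
  also have "{w \<in> topspace (subtopology (euclid {1..<k}) ?A). g1 k \<phi> w \<in> {..<c}} = U"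
    using Asub by (auto simp: U_def)
  finally have Uop: "openin (euclid {1..<k}) U"
    using Aop by (metis openin_trans_full)
  have low: "\<exists>D>0. \<forall>p. p k \<le> 0 \<longrightarrow>
      ennreal (D * exp ((\<Sum>i\<in>{1..<k}. p i * (w i - a i)) + p k * (c - a k))) \<le> partfn a 0 p"
    if w: "w \<in> U" for w
  proof -
    let ?S = "{\<mu> \<in> probs borel_pos. diff_entropy \<mu> \<noteq> - \<infinity> \<and>
        (\<forall>i\<in>{1..<k}. has_bochner_integral \<mu> (\<phi> i) (w i))}"
    let ?I = "INF \<mu>\<in>?S. \<integral>\<^sup>+x. ennreal (\<phi> k x) \<partial>\<mu>"
    have wA: "w \<in> ?A" using w by (simp add: U_def)
    have "?A \<subseteq> {v \<in> {1..<k} \<rightarrow>\<^sub>E {0<..}. \<exists>\<mu>\<in>probs borel_pos. diff_entropy \<mu> \<noteq> - \<infinity> \<and>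
        (\<forall>i\<in>{1..<k}. has_bochner_integral \<mu> (\<phi> i) (v i)) \<and> integrable \<mu> (\<phi> k)}"
      unfolding A1_set_def by (rule interior_of_subset)
    then obtain \<mu>0 where \<mu>0: "\<mu>0 \<in> ?S" and i0: "integrable \<mu>0 (\<phi> k)"
      using wA by blast
    have "?I \<le> (\<integral>\<^sup>+x. ennreal (\<phi> k x) \<partial>\<mu>0)" by (rule INF_lower[OF \<mu>0])
    also have "\<dots> < \<infinity>"
      by (rule nn_integral_less_top_if_integrable[OF i0])
    finally have fin: "?I < \<infinity>" .
    have "enn2real ?I < c" using w by (simp add: U_def g1_def)
    then have "?I < ennreal c" using fin
      by (subst ennreal_enn2real[symmetric]) (auto simp: ennreal_less_iff)
    then obtain \<mu> where "\<mu> \<in> ?S" "(\<integral>\<^sup>+x. ennreal (\<phi> k x) \<partial>\<mu>) < ennreal c"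
      by (auto simp: INF_less_iff)
    then show ?thesis using c0 by (intro partfn_lower_bound[of \<mu>]) auto
  qed
  have ext: "?a \<in> {1..<k} \<rightarrow>\<^sub>E UNIV" by (simp add: proj1_def)
  have shift: "\<exists>r>0. ?a(i := a i + r) \<in> U \<and> ?a(i := a i - r) \<in> U" if i: "i \<in> {1..<k}" for i
  proof -
    let ?h = "\<lambda>t. ?a(i := a i + t)"
    have cont: "continuous_map euclideanreal (euclid {1..<k}) ?h"
      unfolding euclid_def continuous_map_componentwise
    proof (intro conjI ballI)
      show "?h ` topspace euclideanreal \<subseteq> extensional {1..<k}" using i by (auto simp: proj1_def extensional_def)
      fix l assume "l \<in> {1..<k}"
      show "continuous_map euclideanreal euclideanreal (\<lambda>t. ?h t l)"
        by (cases "l = i") (auto intro!: continuous_intros)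
    qed
    have "openin euclideanreal {t \<in> topspace euclideanreal. ?h t \<in> U}"
      by (rule openin_continuous_map_preimage[OF cont Uop])
    then have op: "open {t. ?h t \<in> U}" by simp
    have "?h 0 = ?a" using i by (auto simp: proj1_def)
    then have "0 \<in> {t. ?h t \<in> U}" using aA c by (simp add: U_def)
    then obtain e where e: "e > 0" "ball 0 e \<subseteq> {t. ?h t \<in> U}" using op open_contains_ball by blast
    moreover have "e / 2 \<in> ball 0 e" "- (e / 2) \<in> ball 0 e" using e by (auto simp: dist_real_def)
    ultimately have "e / 2 \<in> {t. ?h t \<in> U}" "- (e / 2) \<in> {t. ?h t \<in> U}" by blast+
    then have "?h (e / 2) \<in> U" "?h (- (e / 2)) \<in> U" by blast+
    then show ?thesis using e by (intro exI[of _ "e / 2"]) auto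
  qed
  have bound: "\<exists>K. \<forall>p. p k \<le> 0 \<longrightarrow> partfn a 0 p \<le> 1 \<longrightarrow> \<bar>p i\<bar> \<le> K" if i: "i \<in> {1..k}" for i
  proof -
    have fromexp: "x \<le> - ln D / r" if "ennreal (D * exp y) \<le> P" "P \<le> 1" "D > 0" "r > 0" "r * x \<le> y"
      for D r x y :: real and P
    proof -
      have "D * exp y \<le> 1" using that by (metis ennreal_1 ennreal_le_iff order.trans zero_le_one)
      then have "exp y \<le> 1 / D" using that by (simp add: field_simps)
      then have "y \<le> ln (1 / D)" using that by (subst ln_ge_iff) auto
      then show ?thesis using that by (simp add: ln_div field_simps)
    qed
    show ?thesis
    proof (cases "i = k")
      case True
      have "?a \<in> U" using aA c by (simp add: U_def)
      from low[OF this] obtain D where D: "D > 0"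
        "\<And>p. p k \<le> 0 \<Longrightarrow> ennreal (D * exp ((\<Sum>i\<in>{1..<k}. p i * (?a i - a i)) + p k * (c - a k))) \<le> partfn a 0 p"
        by blast
      have "\<bar>p i\<bar> \<le> - ln D / (a k - c)" if p: "p k \<le> 0" "partfn a 0 p \<le> 1" for p
        by (rule fromexp[OF D(2)[of p, OF p(1)] p(2) D(1)]) (use c p True in \<open>auto simp: proj1_def algebra_simps\<close>)
      then show ?thesis by blast
    next
      case False
      then have i': "i \<in> {1..<k}" using i by auto
      obtain r where r: "r > 0" "?a(i := a i + r) \<in> U" "?a(i := a i - r) \<in> U" using shift[OF i'] by blast
      obtain D where D: "D > 0"
        "\<And>p. p k \<le> 0 \<Longrightarrow> ennreal (D * exp ((\<Sum>l\<in>{1..<k}. p l * ((?a(i := a i + r)) l - a l)) + p k * (c - a k)))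
            \<le> partfn a 0 p"
        using low[OF r(2)] by blast
      obtain D' where D': "D' > 0"
        "\<And>p. p k \<le> 0 \<Longrightarrow> ennreal (D' * exp ((\<Sum>l\<in>{1..<k}. p l * ((?a(i := a i - r)) l - a l)) + p k * (c - a k)))
            \<le> partfn a 0 p"
        using low[OF r(3)] by blast
      have s: "(\<Sum>l\<in>{1..<k}. p l * ((?a(i := a i + t)) l - a l)) = p i * t" for p t
      proof -
        have "(\<Sum>l\<in>{1..<k}. p l * ((?a(i := a i + t)) l - a l)) = (\<Sum>l\<in>{1..<k}. if l = i then p i * t else 0)"
          by (intro sum.cong refl) (auto simp: proj1_def)
        then show ?thesis using i' by simp
      qed
      have "\<bar>p i\<bar> \<le> max (- ln D / r) (- ln D' / r)" if p: "p k \<le> 0" "partfn a 0 p \<le> 1" for p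
      proof -
        have nn: "0 \<le> p k * (c - a k)" using p c by (intro mult_nonpos_nonpos) auto
        have "p i \<le> - ln D / r"
          by (rule fromexp[OF D(2)[of p, OF p(1)] p(2) D(1) r(1)])
              (use nn in \<open>simp add: s mult.commute del: fun_upd_apply One_nat_def\<close>)
        moreover have "- p i \<le> - ln D' / r"
          by (rule fromexp[OF D'(2)[of p, OF p(1)] p(2) D'(1) r(1)])
              (use nn s[of p "- r"] in \<open>simp add: mult.commute del: fun_upd_apply\<close>)
        ultimately show ?thesis by linarith
      qed
      then show ?thesis by blast
    qed
  qed
  then obtain K where K: "\<And>i p. i \<in> {1..k} \<Longrightarrow> p k \<le> 0 \<Longrightarrow> partfn a 0 p \<le> 1 \<Longrightarrow> \<bar>p i\<bar> \<le> K i" by metis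
  have "coercive a (\<Sum>i\<in>{1..k}. \<bar>K i\<bar>)"
    unfolding coercive_def
  proof (intro allI impI ballI)
    fix d p i assume d: "0 \<le> d" and p: "partfn a d p \<le> 1" and i: "i \<in> {1..k}"
    have "p k \<le> 0"
    proof (rule ccontr)
      assume "\<not> p k \<le> 0"
      then show False using p partfn_infinite[of p a d] by (simp add: top_unique)
    qed
    moreover have "partfn a 0 p \<le> 1" using partfn_mono_delta[OF d] p by (rule order.trans)
    ultimately have "\<bar>p i\<bar> \<le> \<bar>K i\<bar>" using K[OF i, of p] by simp
    also have "\<dots> \<le> (\<Sum>i\<in>{1..k}. \<bar>K i\<bar>)" using i by (intro member_le_sum) auto
    finally show "\<bar>p i\<bar> \<le> (\<Sum>i\<in>{1..k}. \<bar>K i\<bar>)" .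
  qed
  then show ?thesis by blast
qed

section \<open>One large value\<close>

definition jump_window :: "real \<Rightarrow> real \<Rightarrow> nat \<Rightarrow> real set" where
  "jump_window b \<eta> n = {y \<in> {0<..}. real n * (b + \<eta>) \<le> \<phi> k y \<and> \<phi> k y \<le> real n * (b + 2 * \<eta>) \<and>
    (\<forall>i\<in>{1..<k}. \<phi> i y \<le> \<eta> * real n)}"

lemma jump_window_sets: "jump_window b \<eta> n \<in> sets borel_pos"
proof -
  have "{y \<in> space borel_pos. real n * (b + \<eta>) \<le> \<phi> k y \<and> \<phi> k y \<le> real n * (b + 2 * \<eta>) \<and>
    (\<forall>i\<in>{1..<k}. \<phi> i y \<le> \<eta> * real n)} \<in> sets borel_pos"
    using phi_measurable k_mem
    by (intro sets.sets_Collect_conj borel_measurable_le sets.sets_Collect_finite_All) auto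
  then show ?thesis by (simp add: jump_window_def space_borel_pos)
qed

text \<open>
  A coordinate at which \<open>\<phi>\<^sub>k\<close> is of order \<open>n\<close> is not exponentially unlikely: the points where \<open>\<phi>\<^sub>k\<close> lies
  between \<open>n (b + \<eta>)\<close> and \<open>n (b + 2 \<eta>)\<close> form an interval.  By the mean value theorem and the polynomial
  bound on the derivative, its length is at least polynomially small in \<open>n\<close>, and on it the base density
  \<open>exp (- \<phi>\<^sub>1) / Z\<close> is at least \<open>exp (- \<epsilon> n / 2) / Z\<close>.
\<close>
lemma jump_probability:
  assumes b: "b \<ge> 0" and \<eta>: "\<eta> > 0" and \<epsilon>: "\<epsilon> > 0"
  shows "\<forall>\<^sub>F n in sequentially. exp (- \<epsilon> * real n) \<le> measure (base_law \<phi>) (jump_window b \<eta> n)"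
proof -
  obtain C M where C: "C > 0" and M: "M > 0" and
    C4': "\<And>x. x > C \<Longrightarrow> deriv (\<phi> k) x < C * \<phi> k x powr M"
    using C4 k_mem(2) by blast
  define B where "B = b + 2 * \<eta>"
  have B: "B > 0" using b \<eta> by (simp add: B_def)
  have one: "1 \<in> {1..<k}" using k by auto
  \<comment> \<open>On the window \<open>\<phi>\<^sub>k \<le> n B\<close>, so this ratio makes \<open>\<phi>\<^sub>i\<close> at most \<open>\<eta> n\<close> and \<open>\<epsilon> n / 2\<close>.\<close>
  have "\<forall>\<^sub>F x in at_top. \<forall>i\<in>{1..<k}. \<phi> i x \<le> (min \<eta> (\<epsilon> / 2) / B) * \<phi> k x"
    using B \<eta> \<epsilon> by (intro eventually_ball_finite ballI phi_little_o divide_pos_pos) auto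
  then obtain R0 where R0: "\<And>x i. x \<ge> R0 \<Longrightarrow> i \<in> {1..<k} \<Longrightarrow> \<phi> i x \<le> (min \<eta> (\<epsilon> / 2) / B) * \<phi> k x"
    unfolding eventually_at_top_linorder by blast
  define R where "R = max R0 (C + 1)"
  have R: "R > C" "R \<ge> R0" "R > 0" using C by (auto simp: R_def)
  let ?W = "jump_window b \<eta>"
  have main: "real n * \<eta> / (Z * C * (real n * B) powr M) * exp (- (\<epsilon> / 2 * real n)) \<le> measure (base_law \<phi>) (?W n)"
    if n: "n \<ge> 1" "\<phi> k R < real n * (b + \<eta>)" for n
  proof -
    have "\<forall>\<^sub>F y in at_top. \<phi> k y \<ge> real n * B \<and> y \<ge> R"
      using C1[OF k_mem(2)] by (intro eventually_conj eventually_ge_at_top) (auto simp: filterlim_at_top)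
    then obtain y where y: "\<phi> k y \<ge> real n * B" "y \<ge> R"
      using eventually_happens'[OF trivial_limit_at_top_linorder] by blast
    have cont: "continuous_on {R..y} (\<phi> k)"
      using phi_continuous[OF k_mem(2)] R by (rule_tac continuous_on_subset) auto
    have lt: "real n * (b + \<eta>) < real n * B" using n \<eta> by (simp add: B_def)
    obtain x1 where x1: "R \<le> x1" "x1 \<le> y" "\<phi> k x1 = real n * (b + \<eta>)"
      using IVT'[OF _ _ y(2) cont, of "real n * (b + \<eta>)"] n y lt by auto
    obtain x2 where x2: "R \<le> x2" "x2 \<le> y" "\<phi> k x2 = real n * B"
      using IVT'[OF _ _ y(2) cont, of "real n * B"] n y lt by auto
    have x12: "x1 < x2"
    proof (rule ccontr)
      assume "\<not> x1 < x2"
      then have "\<phi> k x2 \<le> \<phi> k x1" using x2 R by (intro phi_mono k_mem) auto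
      then show False using x1 x2 lt by simp
    qed
    have bnd: "\<phi> k x \<le> real n * B" "real n * (b + \<eta>) \<le> \<phi> k x" "x > 0" "x \<ge> R" if "x \<in> {x1..x2}" for x
      using that x1 x2 R phi_mono[OF k_mem(2), of x x2] phi_mono[OF k_mem(2), of x1 x] by auto
    obtain \<xi> where \<xi>: "x1 < \<xi>" "\<xi> < x2" "\<phi> k x2 - \<phi> k x1 = (x2 - x1) * deriv (\<phi> k) \<xi>"
      using MVT2[OF x12, of "\<phi> k" "deriv (\<phi> k)"] phi_has_derivative[OF k_mem(2)] x1 R by fastforce
    have "deriv (\<phi> k) \<xi> \<le> C * (real n * B) powr M"
    proof -
      have "deriv (\<phi> k) \<xi> \<le> C * \<phi> k \<xi> powr M" using C4'[of \<xi>] \<xi> x1 R by simp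
      also have "\<dots> \<le> C * (real n * B) powr M"
        using C M bnd[of \<xi>] \<xi> pos[OF k_mem(2), of \<xi>] by (intro mult_left_mono powr_mono2) auto
      finally show ?thesis .
    qed
    then have "real n * \<eta> \<le> (x2 - x1) * (C * (real n * B) powr M)"
    proof -
      have "real n * \<eta> = (x2 - x1) * deriv (\<phi> k) \<xi>" using \<xi> x1 x2 by (simp add: B_def algebra_simps)
      also have "\<dots> \<le> (x2 - x1) * (C * (real n * B) powr M)"
        using x12 \<open>deriv (\<phi> k) \<xi> \<le> _\<close> by (intro mult_left_mono) auto
      finally show ?thesis .
    qed
    moreover have Ppos: "(real n * B) powr M > 0" using n B by simp
    ultimately have len: "real n * \<eta> / (C * (real n * B) powr M) \<le> x2 - x1"
      using C by (simp add: pos_divide_le_eq)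
    have small: "\<phi> i x \<le> min \<eta> (\<epsilon> / 2) * real n" if "x \<in> {x1..x2}" "i \<in> {1..<k}" for x i
    proof -
      have "\<phi> i x \<le> (min \<eta> (\<epsilon> / 2) / B) * \<phi> k x" using R0[of x i] bnd[of x] that R by auto
      also have "\<dots> \<le> (min \<eta> (\<epsilon> / 2) / B) * (real n * B)"
        using bnd[of x] that \<eta> \<epsilon> B by (intro mult_left_mono) auto
      finally show ?thesis using B by simp
    qed
    have sub: "{x1..x2} \<subseteq> ?W n"
    proof
      fix x assume x: "x \<in> {x1..x2}"
      have "\<phi> i x \<le> \<eta> * real n" if "i \<in> {1..<k}" for i
        using small[OF x that] n mult_right_mono[of "min \<eta> (\<epsilon> / 2)" \<eta> "real n"] by linarith
      then show "x \<in> ?W n" using bnd[OF x] by (auto simp: B_def jump_window_def)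
    qed
    have Wm: "?W n \<in> sets (base_law \<phi>)" using jump_window_sets by simp
    have Im: "{x1..x2} \<in> sets borel_pos"
      using x1 R by (auto simp: borel_pos_def sets_restrict_space_iff)
    let ?c = "exp (- (\<epsilon> / 2 * real n)) / Z"
    have "ennreal (?c * (x2 - x1)) = ennreal ?c * emeasure leb_pos {x1..x2}"
      using x1 R x12 Z_pos by (subst emeasure_leb_pos) (auto simp: ennreal_mult[symmetric])
    also have "\<dots> = (\<integral>\<^sup>+x. ennreal ?c * indicator {x1..x2} x \<partial>leb_pos)"
      using Im by (subst nn_integral_cmult_indicator) (auto simp: sets_leb_pos)
    also have "\<dots> \<le> (\<integral>\<^sup>+x. ennreal (exp (- \<phi> 1 x) / Z) * indicator {x1..x2} x \<partial>leb_pos)"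
    proof (intro nn_integral_mono)
      fix x
      show "ennreal ?c * indicator {x1..x2} x \<le> ennreal (exp (- \<phi> 1 x) / Z) * indicator {x1..x2} x"
      proof (cases "x \<in> {x1..x2}")
        case True
        have "\<phi> 1 x \<le> \<epsilon> / 2 * real n"
          using small[OF True one] mult_right_mono[of "min \<eta> (\<epsilon> / 2)" "\<epsilon> / 2" "real n"] by linarith
        then have "?c \<le> exp (- \<phi> 1 x) / Z" using Z_pos by (intro divide_right_mono) auto
        then show ?thesis using True by (auto intro: ennreal_leI)
      qed simp
    qed
    also have "\<dots> = emeasure (base_law \<phi>) {x1..x2}"
      unfolding base_law_eq using Im leb_pos_measurable[OF phi1_measurable(2)]
      by (subst emeasure_density) (auto simp: sets_leb_pos)
    also have "\<dots> \<le> emeasure (base_law \<phi>) (?W n)" by (rule emeasure_mono[OF sub Wm])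
    also have "\<dots> = ennreal (measure (base_law \<phi>) (?W n))" by (rule base.emeasure_eq_measure)
    finally have "?c * (x2 - x1) \<le> measure (base_law \<phi>) (?W n)" by (simp add: ennreal_le_iff)
    moreover have "?c * (real n * \<eta> / (C * (real n * B) powr M)) \<le> ?c * (x2 - x1)"
      using len Z_pos by (intro mult_left_mono) auto
    ultimately show ?thesis by (simp add: field_simps)
  qed
  have "\<forall>\<^sub>F n in sequentially. \<phi> k R < real n * (b + \<eta>)"
    using b \<eta> by real_asymp
  with real_subexponential[OF mult_pos_pos[OF Z_pos C] B \<epsilon> \<eta> M] eventually_ge_at_top[of 1]
  show ?thesis
  proof eventually_elim
    case (elim n)
    then show ?case using main[of n] by linarith
  qed
qed

section \<open>Lower bound for the probability of the conditioning event\<close>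

definition near_moments :: "(nat \<Rightarrow> real) \<Rightarrow> nat \<Rightarrow> real \<Rightarrow> (nat \<Rightarrow> real) set" where
  "near_moments v n \<eta> = {x \<in> {1..n} \<rightarrow>\<^sub>E {0<..}. \<forall>i\<in>{1..k}. \<bar>emp_mean \<phi> i n x - v i\<bar> \<le> \<eta>}"

lemma space_PiM_base: "space (PiM I (\<lambda>_. base_law \<phi>)) = I \<rightarrow>\<^sub>E {0<..}"
  by (simp add: space_PiM)

lemma base_component_measurable:
  fixes w :: "real \<Rightarrow> real"
  assumes "i \<in> I" "w \<in> borel_measurable borel_pos"
  shows "(\<lambda>x. w (x i)) \<in> borel_measurable (PiM I (\<lambda>_. base_law \<phi>))"
  using measurable_compose[OF measurable_component_singleton[of i I "\<lambda>_. base_law \<phi>"], of w borel] assms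
  by simp

lemma emp_mean_measurable:
  assumes i: "i \<in> {1..k}" and I: "{1..n} \<subseteq> I"
  shows "emp_mean \<phi> i n \<in> borel_measurable (PiM I (\<lambda>_. base_law \<phi>))"
  unfolding emp_mean_def[abs_def] using I phi_measurable[OF i]
  by (intro borel_measurable_divide borel_measurable_sum borel_measurable_const base_component_measurable) auto

lemma near_moments_sets: "near_moments v n \<eta> \<in> sets (base_pow n)"
proof -
  have "{x \<in> space (base_pow n). \<forall>i\<in>{1..k}. \<bar>emp_mean \<phi> i n x - v i\<bar> \<le> \<eta>}
    \<in> sets (base_pow n)"
    by (intro sets.sets_Collect_finite_All borel_measurable_le borel_measurable_abs borel_measurable_diff
        emp_mean_measurable) auto
  then show ?thesis by (simp add: near_moments_def space_PiM_base)
qed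

lemma sum_tilt:
  "n \<ge> 1 \<Longrightarrow> (\<Sum>m\<in>{1..n}. tilt a d p (x m)) = real n * (\<Sum>i\<in>{1..k}. p i * (emp_mean \<phi> i n x - a i) + d * \<bar>p i\<bar>)"
proof -
  assume n: "n \<ge> 1"
  have "(\<Sum>m\<in>{1..n}. tilt a d p (x m)) = (\<Sum>i\<in>{1..k}. \<Sum>m\<in>{1..n}. p i * (\<phi> i (x m) - a i) + d * \<bar>p i\<bar>)"
    unfolding tilt_def by (rule sum.swap)
  also have "\<dots> = (\<Sum>i\<in>{1..k}. real n * (p i * (emp_mean \<phi> i n x - a i) + d * \<bar>p i\<bar>))"
  proof (intro sum.cong refl)
    fix i
    have "(\<Sum>m\<in>{1..n}. \<phi> i (x m)) = real n * emp_mean \<phi> i n x" using n by (simp add: emp_mean_def)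
    then show "(\<Sum>m\<in>{1..n}. p i * (\<phi> i (x m) - a i) + d * \<bar>p i\<bar>) = real n
        * (p i * (emp_mean \<phi> i n x - a i) + d * \<bar>p i\<bar>)"
      by (simp add: sum.distrib sum_distrib_left[symmetric] sum_subtractf algebra_simps)
  qed
  finally show ?thesis by (simp add: sum_distrib_left)
qed

text \<open>
  The tilted product law gives probability at least \<open>1/2\<close> to the event that the means are near the
  tilted means.  By complementary slackness its density with respect to the base product law equals
  \<open>F\<^sup>-\<^sup>n\<close> there, up to a factor \<open>exp (n \<eta> k K)\<close>.
\<close>
lemma near_moments_probability:
  assumes min: "minimizer a d p" and d: "d \<ge> 0" and K: "\<And>i. i \<in> {1..k} \<Longrightarrow> \<bar>p i\<bar> \<le> K" and \<eta>: "\<eta> > 0"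
  shows "\<forall>\<^sub>F n in sequentially. enn2real (partfn a d p) ^ n * exp (- real n * (\<eta> * real k * K)) / 2
    \<le> measure (base_pow n) (near_moments (tilted_mean a d p) n \<eta>)"
proof -
  note fin = minimizer_finite[OF min]
  let ?F = "enn2real (partfn a d p)" and ?\<nu> = "tilted a d p" and ?v = "tilted_mean a d p"
  have F: "?F > 0" using partfn_enn2real[OF fin] by simp
  have P\<nu>: "prob_space ?\<nu>" by (rule prob_space_tilted[OF fin])
  let ?P = "\<lambda>n. base_pow n" and ?T = "\<lambda>n. tilted_pow a d p n"
  let ?bad = "\<lambda>i n. {x \<in> space (?T n). \<bar>(\<Sum>m\<in>{1..n}. \<phi> i (x m)) / real n - integral\<^sup>L ?\<nu> (\<phi> i)\<bar> > \<eta>}"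
  have setsT: "sets (?T n) = sets (?P n)" for n by (intro sets_PiM_cong) auto
  have spT: "space (?T n) = {1..n} \<rightarrow>\<^sub>E {0<..}" for n by (simp add: space_PiM)
  have "\<forall>\<^sub>F n in sequentially. \<forall>i\<in>{1..k}. measure (?T n) (?bad i n) < 1 / (2 * real k)"
  proof (intro eventually_ball_finite ballI)
    fix i assume i: "i \<in> {1..k}"
    have "(\<lambda>n. measure (?T n) (?bad i n)) \<longlonglongrightarrow> 0"
      using pos[OF i] by (intro weak_law_of_large_numbers P\<nu> minimizer_moments(1)[OF min d i] \<eta>)
          (auto intro: less_imp_le)
    then show "\<forall>\<^sub>F n in sequentially. measure (?T n) (?bad i n) < 1 / (2 * real k)"
      using k by (intro order_tendstoD(2)[of _ 0]) auto
  qed simp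
  then show ?thesis using eventually_ge_at_top[of 1]
  proof eventually_elim
    case (elim n)
    interpret T: prob_space "?T n" by (intro prob_space_PiM P\<nu>)
    interpret P: prob_space "?P n" by (intro prob_space_PiM prob_space_base)
    let ?L = "near_moments ?v n \<eta>"
    have bm: "?bad i n \<in> T.events" if "i \<in> {1..k}" for i
    proof -
      have "{x \<in> space (?P n). \<bar>emp_mean \<phi> i n x - integral\<^sup>L ?\<nu> (\<phi> i)\<bar> > \<eta>} \<in> sets (?P n)"
        using emp_mean_measurable[OF that order_refl, of n] by measurable
      then show ?thesis unfolding setsT by (simp add: emp_mean_def spT space_PiM_base del: One_nat_def)
    qed
    have half: "1 / 2 \<le> T.prob ?L"
    proof -
      have "space (?T n) - ?L \<subseteq> (\<Union>i\<in>{1..k}. ?bad i n)"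
      proof
        fix x assume x: "x \<in> space (?T n) - ?L"
        then obtain i where "i \<in> {1..k}" "\<not> \<bar>emp_mean \<phi> i n x - ?v i\<bar> \<le> \<eta>"
          unfolding near_moments_def spT by blast
        then show "x \<in> (\<Union>i\<in>{1..k}. ?bad i n)"
          using x unfolding emp_mean_def tilted_mean_def not_le by blast
      qed
      then have "T.prob (space (?T n) - ?L) \<le> T.prob (\<Union>i\<in>{1..k}. ?bad i n)"
        using bm by (intro T.finite_measure_mono) auto
      also have "\<dots> \<le> (\<Sum>i\<in>{1..k}. T.prob (?bad i n))"
        using bm by (intro T.finite_measure_subadditive_finite) auto
      also have "\<dots> \<le> (\<Sum>i\<in>{1..k}. 1 / (2 * real k))"
        using elim(1) by (intro sum_mono) (auto intro: less_imp_le)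
      also have "\<dots> = 1 / 2" using k by simp
      finally have "T.prob (space (?T n) - ?L) \<le> 1 / 2" .
      moreover have "?L \<in> T.events" unfolding setsT by (rule near_moments_sets)
      ultimately show ?thesis using T.prob_compl[of ?L] by linarith
    qed
    let ?u = "\<lambda>x. exp (tilt a d p x) / ?F"
    have dens: "?T n = density (?P n) (\<lambda>x. ennreal (\<Prod>m\<in>{1..n}. ?u (x m)))"
      using P\<nu> F unfolding tilted_def
      by (intro PiM_density[OF prob_space_base]) (auto simp: less_imp_le)
    have "emeasure (?T n) ?L = (\<integral>\<^sup>+x. ennreal (\<Prod>m\<in>{1..n}. ?u (x m)) * indicator ?L x \<partial>?P n)"
      unfolding dens using near_moments_sets
      by (subst emeasure_density) (auto intro!: borel_measurable_prod borel_measurable_divide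
          measurable_compose[OF measurable_component_singleton] simp: tilt_measurable)
    also have "\<dots> \<le> (\<integral>\<^sup>+x. ennreal (exp (real n * (\<eta> * real k * K)) / ?F ^ n) * indicator ?L x \<partial>?P n)"
    proof (intro nn_integral_mono)
      fix x
      show "ennreal (\<Prod>m\<in>{1..n}. ?u (x m)) * indicator ?L x
        \<le> ennreal (exp (real n * (\<eta> * real k * K)) / ?F ^ n) * indicator ?L x"
      proof (cases "x \<in> ?L")
        case True
        have "(\<Prod>m\<in>{1..n}. ?u (x m)) = exp (\<Sum>m\<in>{1..n}. tilt a d p (x m)) / ?F ^ n"
          by (simp add: exp_sum prod_dividef)
        also have "(\<Sum>m\<in>{1..n}. tilt a d p (x m)) \<le> real n * (\<Sum>i\<in>{1..k}. \<eta> * K)"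
          unfolding sum_tilt[OF elim(2)]
        proof (intro mult_left_mono sum_mono)
          fix i assume i: "i \<in> {1..k}"
          have "p i * (emp_mean \<phi> i n x - a i) + d * \<bar>p i\<bar> = p i * (emp_mean \<phi> i n x - ?v i)"
            using tilted_mean_slack[OF min d i] by (simp add: algebra_simps)
          also have "\<dots> \<le> \<bar>p i\<bar> * \<bar>emp_mean \<phi> i n x - ?v i\<bar>" by (metis abs_ge_self abs_mult)
          also have "\<dots> \<le> K * \<eta>"
            using K[OF i] True i by (intro mult_mono) (auto simp: near_moments_def intro: order.trans[OF abs_ge_zero])
          finally show "p i * (emp_mean \<phi> i n x - a i) + d * \<bar>p i\<bar> \<le> \<eta> * K" by (simp add: mult.commute)
        qed simp
        finally have "(\<Prod>m\<in>{1..n}. ?u (x m)) \<le> exp (real n * (\<eta> * real k * K)) / ?F ^ n"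
          using F by (simp add: divide_right_mono mult_ac)
        then show ?thesis using True by (auto intro: ennreal_leI)
      qed simp
    qed
    also have "\<dots> = ennreal (exp (real n * (\<eta> * real k * K)) / ?F ^ n) * emeasure (?P n) ?L"
      using near_moments_sets by (subst nn_integral_cmult_indicator) auto
    finally have "ennreal (T.prob ?L) \<le> ennreal (exp (real n * (\<eta> * real k * K)) / ?F ^ n * P.prob ?L)"
      using F unfolding T.emeasure_eq_measure P.emeasure_eq_measure by (subst ennreal_mult) auto
    then have "T.prob ?L \<le> exp (real n * (\<eta> * real k * K)) / ?F ^ n * P.prob ?L"
      using F by (subst (asm) ennreal_le_iff) auto
    with half have "1 / 2 \<le> exp (real n * (\<eta> * real k * K)) / ?F ^ n * P.prob ?L" by linarith
    then show ?case using F by (simp add: exp_minus field_simps)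
  qed
qed

lemma cond_event_eq:
  "cond_event k \<phi> a n \<delta> = {\<omega> \<in> space (iid_law \<phi>). restrict \<omega> {1..n} \<in> near_moments a n \<delta>}"
proof -
  have "emp_mean \<phi> i n (restrict \<omega> {1..n}) = emp_mean \<phi> i n \<omega>" for i \<omega>
    unfolding emp_mean_def by simp
  then show ?thesis
    by (auto simp: cond_event_def near_moments_def iid_law_def space_PiM_base PiE_iff)
qed

lemma prob_space_iid: "prob_space (iid_law \<phi>)"
  unfolding iid_law_def by (intro prob_space_PiM prob_space_base)

lemma cond_event_sets: "cond_event k \<phi> a n \<delta> \<in> sets (iid_law \<phi>)"
proof -
  have "(\<lambda>\<omega>. restrict \<omega> {1..n}) \<in> measurable (iid_law \<phi>) (base_pow n)"
    unfolding iid_law_def by (intro measurable_restrict_subset) auto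
  from measurable_sets[OF this near_moments_sets[of a n \<delta>]]
  show ?thesis unfolding cond_event_eq by (simp add: vimage_def Int_def conj_commute)
qed

lemma measure_cond_event:
  "measure (iid_law \<phi>) (cond_event k \<phi> a n \<delta>) = measure (base_pow n) (near_moments a n \<delta>)"
proof -
  have d: "distr (iid_law \<phi>) (base_pow n) (\<lambda>\<omega>. \<lambda>i\<in>{1..n}. \<omega> i) = base_pow n"
    unfolding iid_law_def by (rule distr_PiM_reindex[of _ _ "\<lambda>i. i", OF prob_space_base]) auto
  have m: "(\<lambda>\<omega>. restrict \<omega> {1..n}) \<in> measurable (iid_law \<phi>) (base_pow n)"
    unfolding iid_law_def by (intro measurable_restrict_subset) auto
  have "measure (base_pow n) (near_moments a n \<delta>)
    = measure (distr (iid_law \<phi>) (base_pow n) (\<lambda>\<omega>. restrict \<omega> {1..n})) (near_moments a n \<delta>)"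
    using d by simp
  also have "\<dots> = measure (iid_law \<phi>) (cond_event k \<phi> a n \<delta>)"
    by (subst measure_distr[OF m near_moments_sets])
       (auto simp: cond_event_eq intro!: arg_cong[where f="measure (iid_law \<phi>)"])
  finally show ?thesis by simp
qed

lemma append_one_probability:
  assumes sub: "\<And>x y. x \<in> near_moments v n \<eta> \<Longrightarrow> y \<in> W \<Longrightarrow> x(Suc n := y) \<in> near_moments a (Suc n) \<delta>"
    and W: "W \<in> sets borel_pos"
  shows "measure (base_pow n) (near_moments v n \<eta>) * measure (base_law \<phi>) W
    \<le> measure (base_pow (Suc n)) (near_moments a (Suc n) \<delta>)"
proof -
  interpret PM: product_sigma_finite "\<lambda>_::nat. base_law \<phi>"
    by (simp add: product_sigma_finite_def base.sigma_finite_measure_axioms)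
  let ?P = "base_pow n" and ?Q = "base_pow (Suc n)"
  interpret P: prob_space ?P by (intro prob_space_PiM prob_space_base)
  interpret Q: prob_space ?Q by (intro prob_space_PiM prob_space_base)
  let ?L = "near_moments v n \<eta>" and ?C = "near_moments a (Suc n) \<delta>"
  have ins: "{1..Suc n} = insert (Suc n) {1..n}" by auto
  have "ennreal (P.prob ?L * base.prob W) = emeasure ?P ?L * emeasure (base_law \<phi>) W"
    unfolding P.emeasure_eq_measure base.emeasure_eq_measure by (rule ennreal_mult) auto
  also have "\<dots> = (\<integral>\<^sup>+x. (\<integral>\<^sup>+y. indicator ?L x * indicator W y \<partial>base_law \<phi>) \<partial>?P)"
    using W near_moments_sets by (simp add: nn_integral_cmult nn_integral_multc del: One_nat_def)
  also have "\<dots> \<le> (\<integral>\<^sup>+x. (\<integral>\<^sup>+y. indicator ?C (x(Suc n := y)) \<partial>base_law \<phi>) \<partial>?P)"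
    using sub by (intro nn_integral_mono) (auto simp: indicator_def)
  also have "\<dots> = (\<integral>\<^sup>+x. indicator ?C x \<partial>?Q)"
    unfolding ins using near_moments_sets[of a "Suc n" \<delta>, unfolded ins]
    by (intro PM.product_nn_integral_insert[symmetric] borel_measurable_indicator) (simp_all del: One_nat_def)
  also have "\<dots> = ennreal (Q.prob ?C)"
    using near_moments_sets[of a "Suc n" \<delta>] by (simp add: Q.emeasure_eq_measure del: One_nat_def)
  finally show ?thesis by (simp add: ennreal_le_iff)
qed

text \<open>
  The value \<open>b = max 0 (a\<^sub>k - v\<^sub>k)\<close> is what the last mean lacks; a jump is made also when nothing is
  missing, which avoids a case distinction and costs only \<open>2 \<eta>\<close>.
\<close>
lemma append_jump:
  assumes x: "x \<in> near_moments v n \<eta>" and n: "n \<ge> 1" and y: "y > 0"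
    and y1: "real (Suc n) * (b + \<eta>) \<le> \<phi> k y" and y2: "\<phi> k y \<le> real (Suc n) * (b + 2 * \<eta>)"
    and y3: "\<And>i. i \<in> {1..<k} \<Longrightarrow> \<phi> i y \<le> \<eta> * real (Suc n)"
    and b: "b = max 0 (a k - v k)" and vk: "v k \<le> a k + d"
    and vi: "\<And>i. i \<in> {1..<k} \<Longrightarrow> \<bar>v i - a i\<bar> \<le> d"
    and v0: "\<And>i. i \<in> {1..k} \<Longrightarrow> 0 \<le> v i"
    and vn: "\<And>i. i \<in> {1..k} \<Longrightarrow> v i \<le> \<eta> * real (Suc n)"
    and d: "d \<ge> 0" and \<eta>: "\<eta> > 0" and \<delta>: "d + 4 * \<eta> \<le> \<delta>"
  shows "x(Suc n := y) \<in> near_moments a (Suc n) \<delta>"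
proof -
  let ?N = "real (Suc n)"
  have mean: "emp_mean \<phi> i (Suc n) (x(Suc n := y)) = real n * emp_mean \<phi> i n x / ?N + \<phi> i y / ?N" for i
  proof -
    have "(\<Sum>m\<in>{1..n}. \<phi> i ((x(Suc n := y)) m)) = (\<Sum>m\<in>{1..n}. \<phi> i (x m))" by (intro sum.cong) auto
    then show ?thesis using n by (simp add: emp_mean_def add_divide_distrib)
  qed
  have "\<bar>emp_mean \<phi> i (Suc n) (x(Suc n := y)) - a i\<bar> \<le> \<delta>" if i: "i \<in> {1..k}" for i
  proof -
    let ?s = "emp_mean \<phi> i n x"
    have s: "\<bar>?s - v i\<bar> \<le> \<eta>" using x i by (simp add: near_moments_def)
    have 1: "\<bar>real n * (?s - v i) / ?N\<bar> \<le> \<eta>"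
    proof -
      have "\<bar>real n * (?s - v i)\<bar> \<le> ?N * \<eta>" unfolding abs_mult using s by (intro mult_mono) auto
      then show ?thesis by (simp add: divide_le_eq mult.commute)
    qed
    have 2: "0 \<le> v i / ?N" "v i / ?N \<le> \<eta>" using v0[OF i] vn[OF i] by (auto simp: divide_le_eq)
    have eq: "emp_mean \<phi> i (Suc n) (x(Suc n := y)) - a i
      = real n * (?s - v i) / ?N - v i / ?N + (v i - a i) + \<phi> i y / ?N"
    proof -
      have "real n * v i / ?N = v i - v i / ?N" by (simp add: field_simps)
      then show ?thesis unfolding mean by (simp add: right_diff_distrib diff_divide_distrib)
    qed
    show ?thesis
    proof (cases "i = k")
      case True
      have "b + \<eta> \<le> \<phi> i y / ?N" "\<phi> i y / ?N \<le> b + 2 * \<eta>"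
        using y1 y2 True by (auto simp: le_divide_eq divide_le_eq mult.commute)
      moreover have "b \<ge> 0" "b = 0 \<or> b = a k - v k" "b \<ge> a k - v k" using b by auto
      moreover have "v i = v k" "a i = a k" using True by auto
      ultimately show ?thesis
        unfolding eq using 1 2 \<delta> vk d \<eta> by linarith
    next
      case False
      then have i': "i \<in> {1..<k}" using i by auto
      have "0 \<le> \<phi> i y / ?N" "\<phi> i y / ?N \<le> \<eta>"
        using y3[OF i'] pos[OF i y] by (auto simp: divide_le_eq)
      then show ?thesis
        unfolding eq using 1 2 \<delta> d \<eta> vi[OF i'] by linarith
    qed
  qed
  then show ?thesis using x y by (auto simp: near_moments_def PiE_iff extensional_def)
qed

lemma partfn_le_of_delta:
  assumes K: "\<And>i. i \<in> {1..k} \<Longrightarrow> \<bar>p i\<bar> \<le> K" and d: "d \<le> \<delta>"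
  shows "partfn a \<delta> p \<le> ennreal (exp ((\<delta> - d) * (real k * K))) * partfn a d p"
proof -
  have s: "(\<Sum>i\<in>{1..k}. \<bar>p i\<bar>) \<le> real k * K" using sum_bounded_above[of "{1..k}" "\<lambda>i. \<bar>p i\<bar>" K] K by simp
  have "partfn a \<delta> p \<le> (\<integral>\<^sup>+x. ennreal (exp ((\<delta> - d) * (real k * K))) * ennreal (exp (tilt a d p x)) \<partial>base_law \<phi>)"
    unfolding partfn_def
  proof (intro nn_integral_mono)
    fix x
    have "(\<delta> - d) * (\<Sum>i\<in>{1..k}. \<bar>p i\<bar>) \<le> (\<delta> - d) * (real k * K)" using s d by (intro mult_left_mono) auto
    then have "tilt a \<delta> p x \<le> (\<delta> - d) * (real k * K) + tilt a d p x"
      by (simp add: tilt_eq algebra_simps)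
    then show "ennreal (exp (tilt a \<delta> p x)) \<le> ennreal (exp ((\<delta> - d) * (real k * K))) * ennreal (exp (tilt a d p x))"
      by (subst ennreal_mult[symmetric]) (auto simp flip: exp_add intro!: ennreal_leI)
  qed
  also have "\<dots> = ennreal (exp ((\<delta> - d) * (real k * K))) * partfn a d p"
    unfolding partfn_def by (subst nn_integral_cmult) auto
  finally show ?thesis .
qed

text \<open>
  The tilted means for the window \<open>\<delta>\<close> itself may lie on its boundary, where the law of large numbers
  is of no use.  The means for a smaller window \<open>d\<close> lie inside, and the minima of the two partition
  functions differ at most by the factor \<open>exp ((\<delta> - d) k K)\<close>.
\<close>
lemma cond_event_probability:
  assumes co: "coercive a K" and \<delta>: "\<delta> > 0" and min: "minimizer a \<delta> p" and \<epsilon>: "\<epsilon> > 0"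
  shows "\<forall>\<^sub>F n in sequentially. enn2real (partfn a \<delta> p) ^ n * exp (- \<epsilon> * real n)
    \<le> measure (iid_law \<phi>) (cond_event k \<phi> a n \<delta>)"
proof -
  have K0: "K \<ge> 0" using minimizer_bounded[OF co _ min, of 1] \<delta> k by fastforce
  \<comment> \<open>The gap \<open>\<theta>\<close> between the two windows costs at most \<open>exp (\<epsilon> / 8)\<close>, once per coordinate.\<close>
  define \<theta> where "\<theta> = min \<delta> (\<epsilon> / (8 * (real k * K + 1)))"
  have \<theta>: "\<theta> > 0" "\<theta> \<le> \<delta>" using \<delta> \<epsilon> K0 by (auto simp: \<theta>_def intro!: divide_pos_pos add_nonneg_pos)
  have kK: "real k * K * c \<le> \<epsilon> / 8" if "c \<le> \<theta>" "c \<ge> 0" for c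
  proof -
    have "real k * K * c \<le> (real k * K + 1) * (\<epsilon> / (8 * (real k * K + 1)))"
      using that K0 unfolding \<theta>_def by (intro mult_mono) auto
    also have "\<dots> = \<epsilon> / 8"
    proof -
      have u: "u * (\<epsilon> / (8 * u)) = \<epsilon> / 8" if "u > 0" for u :: real using that by simp
      show ?thesis using K0 by (intro u add_nonneg_pos) auto
    qed
    finally show ?thesis .
  qed
  define d where "d = \<delta> - \<theta>"
  \<comment> \<open>The room left by the smaller window, divided among the four errors in \<open>append_jump\<close>.\<close>
  define \<eta> where "\<eta> = \<theta> / 4"
  have d: "d \<ge> 0" "d + 4 * \<eta> \<le> \<delta>" "d \<le> \<delta>" and \<eta>: "\<eta> > 0" using \<theta> by (auto simp: d_def \<eta>_def)
  obtain q where q: "minimizer a d q" using minimizer_exists[OF co d(1)] by blast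
  have qK: "\<bar>q i\<bar> \<le> K" if "i \<in> {1..k}" for i by (rule minimizer_bounded[OF co d(1) q that])
  let ?v = "tilted_mean a d q"
  let ?F = "enn2real (partfn a \<delta> p)" and ?G = "enn2real (partfn a d q)"
  note Ff = partfn_enn2real[OF minimizer_finite[OF min]] and Gf = partfn_enn2real[OF minimizer_finite[OF q]]
  have F1: "?F \<le> 1" using minimizer_le_1[OF min] Ff by (metis ennreal_1 ennreal_le_iff zero_le_one)
  have FG: "?F \<le> exp (\<epsilon> / 8) * ?G"
  proof -
    have "partfn a \<delta> p \<le> partfn a \<delta> q" using min by (simp add: minimizer_def)
    also have "\<dots> \<le> ennreal (exp ((\<delta> - d) * (real k * K))) * partfn a d q" by (rule partfn_le_of_delta[OF qK d(3)])
    also have "\<dots> = ennreal (exp ((\<delta> - d) * (real k * K)) * ?G)"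
      using Gf by (subst ennreal_mult) auto
    finally have "ennreal ?F \<le> ennreal (exp ((\<delta> - d) * (real k * K)) * ?G)" using Ff by metis
    then have "?F \<le> exp ((\<delta> - d) * (real k * K)) * ?G" using Gf by (subst (asm) ennreal_le_iff) auto
    also have "\<dots> \<le> exp (\<epsilon> / 8) * ?G"
      using kK[of \<theta>] \<theta> Gf by (intro mult_right_mono) (auto simp: d_def mult_ac)
    finally show ?thesis .
  qed
  have v0: "0 \<le> ?v i" if "i \<in> {1..k}" for i
    unfolding tilted_mean_def using pos[OF that] by (intro integral_nonneg_AE AE_I2) (auto intro: less_imp_le)
  define b where "b = max 0 (a k - ?v k)"
  let ?W = "jump_window b \<eta>"
  have ev0: "\<forall>\<^sub>F n in sequentially. ?G ^ n * exp (- real n * (\<eta> * real k * K)) / 2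
    \<le> measure (base_pow n) (near_moments ?v n \<eta>)"
    using qK by (intro near_moments_probability[OF q d(1) _ \<eta>])
  have ev1: "\<forall>\<^sub>F n in sequentially. exp (- (\<epsilon> / 8) * real (Suc n)) \<le> measure (base_law \<phi>) (?W (Suc n))"
    using jump_probability[of b \<eta> "\<epsilon> / 8"] \<eta> \<epsilon> by (subst eventually_sequentially_Suc) (auto simp: b_def)
  have ev2: "\<forall>\<^sub>F n in sequentially. \<forall>i\<in>{1..k}. ?v i \<le> \<eta> * real (Suc n)"
  proof (intro eventually_ball_finite ballI)
    fix i
    show "\<forall>\<^sub>F n in sequentially. ?v i \<le> \<eta> * real (Suc n)"
      using eventually_ge_at_top[of "nat \<lceil>?v i / \<eta>\<rceil>"]
    proof eventually_elim
      case (elim n)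
      then have "?v i / \<eta> \<le> real (Suc n)" by linarith
      then show ?case using \<eta> by (simp add: field_simps)
    qed
  qed simp
  have ev3: "\<forall>\<^sub>F n in sequentially. 2 \<le> exp (\<epsilon> / 8 * real n)" using \<epsilon> by real_asymp
  have "\<forall>\<^sub>F n in sequentially. ?F ^ Suc n * exp (- \<epsilon> * real (Suc n))
    \<le> measure (iid_law \<phi>) (cond_event k \<phi> a (Suc n) \<delta>)"
    using ev0 ev1 ev2 ev3 eventually_ge_at_top[of 1]
  proof eventually_elim
    case (elim n)
    let ?L = "measure (base_pow n) (near_moments ?v n \<eta>)"
    have "exp (- (\<epsilon> / 8) * real n) \<le> exp (- real n * (\<eta> * real k * K))"
      using mult_left_mono[OF kK[of \<eta>], of "real n"] \<eta> \<theta> by (simp add: \<eta>_def mult_ac)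
    then have a1: "?G ^ n * exp (- (\<epsilon> / 8) * real n) / 2 \<le> ?L"
      using elim(1) Gf by (intro order.trans[OF _ elim(1)] divide_right_mono mult_left_mono) auto
    have "?F ^ Suc n \<le> ?F ^ n" using F1 Ff by (intro power_decreasing) auto
    also have "\<dots> \<le> (exp (\<epsilon> / 8) * ?G) ^ n" using FG Ff by (intro power_mono) auto
    also have "\<dots> = exp (\<epsilon> / 8 * real n) * ?G ^ n"
      by (simp add: power_mult_distrib exp_of_nat_mult[symmetric] mult.commute)
    finally have FGn: "?F ^ Suc n \<le> exp (\<epsilon> / 8 * real n) * ?G ^ n" .
    have "?F ^ Suc n * exp (- \<epsilon> * real (Suc n)) \<le> exp (\<epsilon> / 8 * real n) * ?G ^ n * exp (- \<epsilon> * real (Suc n))"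
      by (intro mult_right_mono FGn) auto
    also have "\<dots> = ?G ^ n * exp (\<epsilon> / 8 * real n + - \<epsilon> * real (Suc n))"
      by (simp only: exp_add mult_ac)
    also have "\<dots> \<le> ?G ^ n * exp (- (\<epsilon> / 8) * real n + - (\<epsilon> / 8) * real n + - (\<epsilon> / 8) * real (Suc n))"
      using \<epsilon> Gf by (intro mult_left_mono) (auto simp: algebra_simps)
    also have "\<dots> = (?G ^ n * exp (- (\<epsilon> / 8) * real n) * exp (- (\<epsilon> / 8) * real n)) * exp (- (\<epsilon> / 8) * real (Suc n))"
      by (simp only: exp_add mult_ac)
    also have "\<dots> \<le> (?G ^ n * exp (- (\<epsilon> / 8) * real n) * (1 / 2)) * exp (- (\<epsilon> / 8) * real (Suc n))"
    proof -
      have "exp (- (\<epsilon> / 8) * real n) = 1 / exp (\<epsilon> / 8 * real n)"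
        using exp_minus[of "\<epsilon> / 8 * real n"] by (simp add: inverse_eq_divide)
      also have "\<dots> \<le> 1 / 2" using elim(4) by (intro divide_left_mono) auto
      finally show ?thesis using Gf by (intro mult_right_mono mult_left_mono) auto
    qed
    also have "\<dots> \<le> ?L * measure (base_law \<phi>) (?W (Suc n))"
      using a1 elim(2) by (intro mult_mono) auto
    also have "\<dots> \<le> measure (base_pow (Suc n)) (near_moments a (Suc n) \<delta>)"
    proof (rule append_one_probability[OF _ jump_window_sets])
      fix x y assume x: "x \<in> near_moments ?v n \<eta>" and y: "y \<in> ?W (Suc n)"
      show "x(Suc n := y) \<in> near_moments a (Suc n) \<delta>"
        using y elim(3) \<eta> d unfolding jump_window_def
        by (intro append_jump[OF x elim(5) _ _ _ _ b_def tilted_mean_top[OF q d(1)] tilted_mean_le[OF q d(1)]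
            v0]) auto
    qed
    finally show ?case by (simp only: measure_cond_event)
  qed
  then show ?thesis by (subst (asm) eventually_sequentially_Suc)
qed

section \<open>The conditional law for a fixed window\<close>

lemma sets_PiM_base: "sets (base_pow j) = sets (borel_pos_pow j)"
  unfolding borel_pos_pow_def by (intro sets_PiM_cong) auto

lemma sets_PiM_tilted: "sets (tilted_pow a d p j) = sets (borel_pos_pow j)"
  unfolding borel_pos_pow_def by (intro sets_PiM_cong) auto

lemma space_borel_pos_pow: "space (borel_pos_pow j) = {1..j} \<rightarrow>\<^sub>E {0<..}"
  by (simp add: borel_pos_pow_def space_PiM space_borel_pos)

lemma PiM_tilted_density:
  fixes j :: nat
  assumes fin: "partfn a d p < \<infinity>"
  shows "tilted_pow a d p j = density (base_pow j)
    (\<lambda>x. ennreal (\<Prod>i\<in>{1..j}. exp (tilt a d p (x i)) / enn2real (partfn a d p)))"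
proof -
  have "prob_space (density (base_law \<phi>) (\<lambda>x. ennreal (exp (tilt a d p x) / enn2real (partfn a d p))))"
    using prob_space_tilted[OF fin] by (simp add: tilted_def)
  then show ?thesis unfolding tilted_def
    by (intro PiM_density[OF prob_space_base]) auto
qed

lemma nn_integral_tilted_block:
  assumes fin: "partfn a d p < \<infinity>" and h[measurable]: "h \<in> borel_measurable (borel_pos_pow j)"
  shows "(\<integral>\<^sup>+x. ennreal (h x * (\<Prod>i\<in>{1..j}. exp (tilt a d p (x i)))) \<partial>base_pow j)
    = ennreal (enn2real (partfn a d p) ^ j) * (\<integral>\<^sup>+x. ennreal (h x) \<partial>tilted_pow a d p j)"
proof -
  let ?F = "enn2real (partfn a d p)" and ?P = "base_pow j"
  have F: "?F > 0" using partfn_enn2real[OF fin] by simp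
  note [measurable_cong] = sets_PiM_base
  have hP: "h \<in> borel_measurable ?P" by measurable
  have um: "(\<lambda>x. ennreal (\<Prod>i\<in>{1..j}. exp (tilt a d p (x i)) / ?F)) \<in> borel_measurable ?P"
    by (intro measurable_compose[OF _ measurable_ennreal] borel_measurable_prod borel_measurable_divide
        borel_measurable_const measurable_compose[OF _ borel_measurable_exp]
        base_component_measurable tilt_measurable)
  have "(\<integral>\<^sup>+x. ennreal (h x) \<partial>tilted_pow a d p j)
    = (\<integral>\<^sup>+x. ennreal (\<Prod>i\<in>{1..j}. exp (tilt a d p (x i)) / ?F) * ennreal (h x) \<partial>?P)"
    unfolding PiM_tilted_density[OF fin] using um hP by (intro nn_integral_density) auto
  then have "ennreal (?F ^ j) * (\<integral>\<^sup>+x. ennreal (h x) \<partial>tilted_pow a d p j)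
    = (\<integral>\<^sup>+x. ennreal (?F ^ j) * (ennreal (\<Prod>i\<in>{1..j}. exp (tilt a d p (x i)) / ?F) * ennreal (h x)) \<partial>?P)"
    using um hP by (subst nn_integral_cmult) auto
  also have "\<dots> = (\<integral>\<^sup>+x. ennreal (h x * (\<Prod>i\<in>{1..j}. exp (tilt a d p (x i)))) \<partial>?P)"
  proof (rule nn_integral_cong)
    fix x
    have "(\<Prod>i\<in>{1..j}. exp (tilt a d p (x i)) / ?F) = (\<Prod>i\<in>{1..j}. exp (tilt a d p (x i))) / ?F ^ j"
      by (simp add: prod_dividef)
    then have e: "?F ^ j * (\<Prod>i\<in>{1..j}. exp (tilt a d p (x i)) / ?F) = (\<Prod>i\<in>{1..j}. exp (tilt a d p (x i)))"
      using F by simp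
    have "ennreal (?F ^ j) * (ennreal (\<Prod>i\<in>{1..j}. exp (tilt a d p (x i)) / ?F) * ennreal (h x))
      = ennreal (?F ^ j * (\<Prod>i\<in>{1..j}. exp (tilt a d p (x i)) / ?F)) * ennreal (h x)"
      using F by (subst ennreal_mult) (auto intro!: prod_nonneg simp: mult.assoc)
    also have "\<dots> = ennreal (h x * (\<Prod>i\<in>{1..j}. exp (tilt a d p (x i))))"
      unfolding e by (subst ennreal_mult'[symmetric]) (auto intro!: prod_nonneg simp: mult.commute)
    finally show "ennreal (?F ^ j) * (ennreal (\<Prod>i\<in>{1..j}. exp (tilt a d p (x i)) / ?F) * ennreal (h x))
      = ennreal (h x * (\<Prod>i\<in>{1..j}. exp (tilt a d p (x i))))" .
  qed
  finally show ?thesis by simp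
qed

lemma cond_event_permute:
  assumes \<pi>: "bij_betw \<pi> {1..n} {1..n}" and \<omega>: "\<omega> \<in> space (iid_law \<phi>)" and \<pi>': "\<pi> \<in> {1..} \<rightarrow> {1..}"
  shows "(\<lambda>i\<in>{1..}. \<omega> (\<pi> i)) \<in> cond_event k \<phi> a n \<delta> \<longleftrightarrow> \<omega> \<in> cond_event k \<phi> a n \<delta>"
proof -
  have "emp_mean \<phi> i n (\<lambda>i\<in>{1..}. \<omega> (\<pi> i)) = emp_mean \<phi> i n \<omega>" for i
  proof -
    have "(\<Sum>m\<in>{1..n}. \<phi> i ((\<lambda>i\<in>{1..}. \<omega> (\<pi> i)) m)) = (\<Sum>m\<in>{1..n}. \<phi> i (\<omega> (\<pi> m)))" by simp
    also have "\<dots> = (\<Sum>m\<in>{1..n}. \<phi> i (\<omega> m))" by (rule sum.reindex_bij_betw[OF \<pi>])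
    finally show ?thesis by (simp add: emp_mean_def)
  qed
  moreover have "(\<lambda>i\<in>{1..}. \<omega> (\<pi> i)) \<in> space (iid_law \<phi>)"
    using \<omega> \<pi>' by (auto simp: iid_law_def space_PiM_base PiE_iff Pi_iff)
  ultimately show ?thesis using \<omega> by (simp add: cond_event_def)
qed

lemma block_measurable:
  "(\<lambda>\<omega>. \<lambda>i\<in>{1..j}. \<omega> (c + i)) \<in> measurable (iid_law \<phi>) (borel_pos_pow j)"
proof -
  have "(\<lambda>\<omega>. \<lambda>i\<in>{1..j}. \<omega> (c + i)) \<in> measurable (iid_law \<phi>) (base_pow j)"
    unfolding iid_law_def by (intro measurable_restrict measurable_component_singleton) auto
  then show ?thesis using measurable_cong_sets[OF refl sets_PiM_base] by blast
qed

lemma restrict_measurable_iid: "(\<lambda>\<omega>. restrict \<omega> {1..j}) \<in> measurable (iid_law \<phi>) (borel_pos_pow j)"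
  using block_measurable[of 0 j] by (simp only: add_0)

text \<open>The conditioning event is invariant under the permutation that swaps block \<open>b\<close> with the first block.\<close>
lemma block_exchangeable:
  fixes h :: "(nat \<Rightarrow> real) \<Rightarrow> real"
  assumes h: "h \<in> borel_measurable (borel_pos_pow j)" and b: "b * j + j \<le> n"
  shows "(\<integral>\<omega>. indicator (cond_event k \<phi> a n \<delta>) \<omega> * h (\<lambda>i\<in>{1..j}. \<omega> (b * j + i)) \<partial>iid_law \<phi>)
    = (\<integral>\<omega>. indicator (cond_event k \<phi> a n \<delta>) \<omega> * h (restrict \<omega> {1..j}) \<partial>iid_law \<phi>)"
proof (cases "b = 0")
  case True
  then show ?thesis by simp
next
  case False
  let ?C = "cond_event k \<phi> a n \<delta>"
  define c where "c = b * j"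
  have bj: "j \<le> c" "c + j \<le> n" using False b by (auto simp: c_def)
  \<comment> \<open>Exchanges \<open>i\<close> and \<open>c + i\<close> for \<open>i \<in> {1..j}\<close>.\<close>
  define \<pi> where "\<pi> i = (if i \<in> {1..j} then c + i else if i \<in> {c + 1..c + j} then i - c else i)" for i
  have inv: "\<pi> (\<pi> i) = i" for i using bj by (auto simp: \<pi>_def)
  have into: "\<pi> i \<in> {1..n}" if "i \<in> {1..n}" for i using that bj by (auto simp: \<pi>_def)
  have bij: "bij_betw \<pi> {1..n} {1..n}"
    by (rule bij_betwI[of \<pi> _ _ \<pi>]) (use into inv in auto)
  have inj: "inj_on \<pi> {1..}" by (metis inj_onI inv)
  have fn: "\<pi> \<in> {1..} \<rightarrow> {1..}" by (auto simp: \<pi>_def)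
  define F where "F \<omega> = indicator ?C \<omega> * h (restrict \<omega> {1..j})" for \<omega>
  have Fm: "F \<in> borel_measurable (iid_law \<phi>)"
    unfolding F_def using cond_event_sets measurable_compose[OF restrict_measurable_iid h]
    by (intro borel_measurable_times borel_measurable_indicator) auto
  have "(\<integral>\<omega>. F \<omega> \<partial>iid_law \<phi>) = (\<integral>\<omega>. F (\<lambda>i\<in>{1..}. \<omega> (\<pi> i)) \<partial>iid_law \<phi>)"
    using integral_PiM_permute[OF prob_space_base inj fn Fm[unfolded iid_law_def]] by (simp add: iid_law_def)
  also have "\<dots> = (\<integral>\<omega>. indicator ?C \<omega> * h (\<lambda>i\<in>{1..j}. \<omega> (b * j + i)) \<partial>iid_law \<phi>)"
  proof (rule Bochner_Integration.integral_cong[OF refl])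
    fix \<omega> assume \<omega>: "\<omega> \<in> space (iid_law \<phi>)"
    have "restrict (\<lambda>i\<in>{1..}. \<omega> (\<pi> i)) {1..j} = (\<lambda>i\<in>{1..j}. \<omega> (b * j + i))"
      by (auto simp: fun_eq_iff \<pi>_def c_def)
    then show "F (\<lambda>i\<in>{1..}. \<omega> (\<pi> i)) = indicator ?C \<omega> * h (\<lambda>i\<in>{1..j}. \<omega> (b * j + i))"
      using cond_event_permute[OF bij \<omega> fn] by (simp add: F_def indicator_def)
  qed
  finally show ?thesis by (simp add: F_def)
qed

text \<open>
  Facts about the spaces with index set \<open>{1..j}\<close> are stated with the numeral \<open>1\<close> and should keep
  matching after simplification.
\<close>
declare One_nat_def [simp del]

text \<open>
  On the conditioning event the empirical means lie in the window, so \<open>\<Sum>l. tilt a \<delta> p (\<omega> l) \<ge> 0\<close>.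
  Hence the indicator of the event is at most the product of the factors \<open>exp (tilt a \<delta> p (\<omega> l))\<close>,
  under which the coordinates become independent with the tilted law.
\<close>
lemma exp_block_sum_on_cond_event:
  fixes h :: "(nat \<Rightarrow> real) \<Rightarrow> real"
  assumes min: "minimizer a \<delta> p" and h: "h \<in> borel_measurable (borel_pos_pow j)"
    and n: "n = m * j + r" "n \<ge> 1"
  shows "(\<integral>\<^sup>+\<omega>. indicator (cond_event k \<phi> a n \<delta>) \<omega> * ennreal (exp (\<Sum>b<m. h (\<lambda>i\<in>{1..j}. \<omega> (b * j + i)))) \<partial>iid_law \<phi>)
    \<le> ennreal (enn2real (partfn a \<delta> p) ^ n) * (\<integral>\<^sup>+x. ennreal (exp (h x)) \<partial>tilted_pow a \<delta> p j) ^ m"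
proof -
  note fin = minimizer_finite[OF min]
  let ?F = "enn2real (partfn a \<delta> p)" and ?C = "cond_event k \<phi> a n \<delta>"
  let ?I = "\<integral>\<^sup>+x. ennreal (exp (h x)) \<partial>tilted_pow a \<delta> p j"
  let ?\<sigma> = "\<lambda>b \<omega>. \<lambda>i\<in>{1..j}. \<omega> (b * j + i)"
  define G where "G x = exp (h x) * (\<Prod>i\<in>{1..j}. exp (tilt a \<delta> p (x i)))" for x :: "nat \<Rightarrow> real"
  have eh: "(\<lambda>x. exp (h x)) \<in> borel_measurable (borel_pos_pow j)"
    using h by (rule measurable_compose[OF _ borel_measurable_exp])
  have Gm: "G \<in> borel_measurable (base_pow j)"
  proof -
    have "h \<in> borel_measurable (base_pow j)"
      using h measurable_cong_sets[OF sets_PiM_base refl] by blast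
    then show ?thesis unfolding G_def[abs_def]
      by (intro borel_measurable_times borel_measurable_prod measurable_compose[OF _ borel_measurable_exp]
          base_component_measurable tilt_measurable)
  qed
  have "(\<integral>\<^sup>+\<omega>. indicator ?C \<omega> * ennreal (exp (\<Sum>b<m. h (?\<sigma> b \<omega>))) \<partial>iid_law \<phi>)
    \<le> (\<integral>\<^sup>+\<omega>. ennreal ((\<Prod>b<m. G (?\<sigma> b \<omega>)) * (\<Prod>l\<in>{m * j + 1..m * j + r}. exp (tilt a \<delta> p (\<omega> l)))) \<partial>iid_law \<phi>)"
  proof (rule nn_integral_mono)
    fix \<omega>
    show "indicator ?C \<omega> * ennreal (exp (\<Sum>b<m. h (?\<sigma> b \<omega>)))
      \<le> ennreal ((\<Prod>b<m. G (?\<sigma> b \<omega>)) * (\<Prod>l\<in>{m * j + 1..m * j + r}. exp (tilt a \<delta> p (\<omega> l))))"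
    proof (cases "\<omega> \<in> ?C")
      case True
      have "0 \<le> real n * (\<Sum>i\<in>{1..k}. p i * (emp_mean \<phi> i n \<omega> - a i) + \<delta> * \<bar>p i\<bar>)"
      proof (intro mult_nonneg_nonneg sum_nonneg)
        fix i assume i: "i \<in> {1..k}"
        have "\<bar>p i * (emp_mean \<phi> i n \<omega> - a i)\<bar> \<le> \<bar>p i\<bar> * \<delta>"
          unfolding abs_mult using True i by (intro mult_left_mono) (auto simp: cond_event_def)
        then show "0 \<le> p i * (emp_mean \<phi> i n \<omega> - a i) + \<delta> * \<bar>p i\<bar>" by (simp add: mult.commute)
      qed simp
      then have "0 \<le> (\<Sum>l\<in>{1..n}. tilt a \<delta> p (\<omega> l))" using sum_tilt[OF n(2)] by simp
      also have "\<dots> = (\<Sum>b<m. \<Sum>i\<in>{1..j}. tilt a \<delta> p (\<omega> (b * j + i))) + (\<Sum>l\<in>{m * j + 1..m * j + r}. tilt a \<delta> p (\<omega> l))"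
        unfolding n(1) by (rule sum_blocks)
      finally have "exp (\<Sum>b<m. h (?\<sigma> b \<omega>)) \<le> exp ((\<Sum>b<m. h (?\<sigma> b \<omega>) + (\<Sum>i\<in>{1..j}. tilt a \<delta> p (\<omega> (b * j + i))))
          + (\<Sum>l\<in>{m * j + 1..m * j + r}. tilt a \<delta> p (\<omega> l)))"
        by (simp add: sum.distrib)
      also have "\<dots> = (\<Prod>b<m. G (?\<sigma> b \<omega>)) * (\<Prod>l\<in>{m * j + 1..m * j + r}. exp (tilt a \<delta> p (\<omega> l)))"
        by (simp add: exp_add exp_sum G_def)
      finally show ?thesis using True by (simp add: ennreal_leI)
    qed simp
  qed
  also have "\<dots> = (\<integral>\<^sup>+x. ennreal (G x) \<partial>base_pow j) ^ m * (\<integral>\<^sup>+x. ennreal (exp (tilt a \<delta> p x)) \<partial>base_law \<phi>) ^ r"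
    unfolding iid_law_def
    by (rule nn_integral_PiM_blocks[OF prob_space_base Gm]) (auto simp: G_def intro!: mult_nonneg_nonneg prod_nonneg)
  also have "(\<integral>\<^sup>+x. ennreal (G x) \<partial>base_pow j) = ennreal (?F ^ j) * ?I"
    unfolding G_def by (rule nn_integral_tilted_block[OF fin eh])
  also have "(\<integral>\<^sup>+x. ennreal (exp (tilt a \<delta> p x)) \<partial>base_law \<phi>) = ennreal ?F"
    using partfn_enn2real[OF fin] by (simp add: partfn_def)
  also have "(ennreal (?F ^ j) * ?I) ^ m * ennreal ?F ^ r = ennreal (?F ^ n) * ?I ^ m"
  proof -
    have "ennreal (?F ^ n) = ennreal (?F ^ j) ^ m * ennreal ?F ^ r"
      unfolding n(1) by (simp add: power_add power_mult ennreal_power mult.commute flip: ennreal_mult)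
    then show ?thesis by (simp add: power_mult_distrib mult_ac)
  qed
  finally show ?thesis .
qed

text \<open>
  By exchangeability the conditional mean \<open>e\<close> of \<open>h\<close> on the first block is the conditional mean of
  the average over \<open>m\<close> blocks.  Jensen's inequality and the two preceding estimates give
  \<open>\<theta> m e \<le> m \<theta>\<^sup>2 B\<^sup>2 + o(n)\<close>, where the quadratic term bounds \<open>m\<close> times the logarithm of the exponential
  moment of the centred function \<open>\<theta> h\<close> under the tilted law.  Since \<open>n\<close> is at most \<open>2 m j\<close>, a small
  \<open>\<theta>\<close> makes \<open>e\<close> small.
\<close>
lemma cond_expectation_upper:
  fixes h :: "(nat \<Rightarrow> real) \<Rightarrow> real"
  assumes co: "coercive a K" and \<delta>: "\<delta> > 0" and min: "minimizer a \<delta> p" and j: "j \<ge> 1"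
    and h: "h \<in> borel_measurable (borel_pos_pow j)"
    and B: "\<And>x. x \<in> space (borel_pos_pow j) \<Longrightarrow> \<bar>h x\<bar> \<le> B"
    and h0: "(\<integral>x. h x \<partial>tilted_pow a \<delta> p j) = 0" and \<epsilon>: "\<epsilon> > 0"
  shows "\<forall>\<^sub>F n in sequentially.
    (\<integral>\<omega>. h (restrict \<omega> {1..j}) \<partial>uniform_measure (iid_law \<phi>) (cond_event k \<phi> a n \<delta>)) < \<epsilon>"
proof -
  note fin = minimizer_finite[OF min]
  let ?F = "enn2real (partfn a \<delta> p)" and ?T = "tilted_pow a \<delta> p j"
  have F: "?F > 0" using partfn_enn2real[OF fin] by simp
  interpret T: prob_space ?T by (intro prob_space_PiM prob_space_tilted fin)
  interpret I: prob_space "iid_law \<phi>" by (rule prob_space_iid)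
  have spT: "space ?T = space (borel_pos_pow j)" by (rule sets_eq_imp_space_eq[OF sets_PiM_tilted])
  have hT: "h \<in> borel_measurable ?T" using h measurable_cong_sets[OF sets_PiM_tilted refl] by blast
  have B0: "B \<ge> 0"
  proof -
    have "(\<lambda>i\<in>{1..j}. 1::real) \<in> space (borel_pos_pow j)" by (auto simp: space_borel_pos_pow)
    from B[OF this] show ?thesis by linarith
  qed
  \<comment> \<open>The first bound allows the quadratic estimate of \<open>exp (\<theta> * h x)\<close>, the second makes \<open>\<theta> * B\<^sup>2\<close> small.\<close>
  define \<theta> where "\<theta> = min (1 / (B + 1)) (\<epsilon> / (4 * (B\<^sup>2 + 1)))"
  have \<theta>: "\<theta> > 0" using B0 \<epsilon> by (auto simp: \<theta>_def intro!: divide_pos_pos add_nonneg_pos)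
  have \<theta>B: "\<theta> * B \<le> 1"
  proof -
    have "\<theta> * B \<le> (1 / (B + 1)) * (B + 1)" using B0 by (intro mult_mono) (auto simp: \<theta>_def)
    then show ?thesis using B0 by simp
  qed
  have \<theta>B2: "\<theta> * B\<^sup>2 \<le> \<epsilon> / 4"
  proof -
    have "\<theta> * B\<^sup>2 \<le> (\<epsilon> / (4 * (B\<^sup>2 + 1))) * (B\<^sup>2 + 1)" using \<epsilon> by (intro mult_mono) (auto simp: \<theta>_def)
    also have "\<dots> = \<epsilon> / 4"
    proof -
      have u: "\<epsilon> / (4 * u) * u = \<epsilon> / 4" if "u > 0" for u :: real using that by simp
      show ?thesis by (rule u) (simp add: add_nonneg_pos)
    qed
    finally show ?thesis .
  qed
  \<comment> \<open>Chosen so that \<open>\<epsilon>1 * (2 * m * j) = \<theta> * m * \<epsilon> / 4\<close>.\<close>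
  define \<epsilon>1 where "\<epsilon>1 = \<epsilon> * \<theta> / (8 * real j)"
  have \<epsilon>1: "\<epsilon>1 > 0" using \<epsilon> \<theta> j by (simp add: \<epsilon>1_def)
  have ih: "integrable ?T h"
    by (rule T.integrable_const_bound[where B=B]) (use B spT hT in auto)
  have M: "(\<integral>\<^sup>+x. ennreal (exp (\<theta> * h x)) \<partial>?T) \<le> ennreal (exp (\<theta>\<^sup>2 * B\<^sup>2))"
  proof -
    have "(\<integral>\<^sup>+x. ennreal (exp (\<theta> * h x)) \<partial>?T) \<le> (\<integral>\<^sup>+x. ennreal (1 + \<theta> * h x + \<theta>\<^sup>2 * B\<^sup>2) \<partial>?T)"
    proof (intro nn_integral_mono ennreal_leI)
      fix x assume "x \<in> space ?T"
      then have hx: "\<bar>h x\<bar> \<le> B" using B spT by simp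
      then have "\<bar>\<theta> * h x\<bar> \<le> \<theta> * B" using \<theta> by (simp add: abs_mult)
      then have "exp (\<theta> * h x) \<le> 1 + \<theta> * h x + (\<theta> * h x)\<^sup>2" using \<theta>B by (intro exp_le_quadratic) simp
      also have "(\<theta> * h x)\<^sup>2 \<le> \<theta>\<^sup>2 * B\<^sup>2"
        using hx B0 by (simp add: power_mult_distrib abs_le_square_iff[symmetric] mult_left_mono)
      finally show "exp (\<theta> * h x) \<le> 1 + \<theta> * h x + \<theta>\<^sup>2 * B\<^sup>2" by simp
    qed
    also have "\<dots> = ennreal (\<integral>x. 1 + \<theta> * h x + \<theta>\<^sup>2 * B\<^sup>2 \<partial>?T)"
    proof (intro nn_integral_eq_integral AE_I2)
      fix x assume "x \<in> space ?T"
      then have hx: "\<bar>h x\<bar> \<le> B" using B spT by simp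
      have "\<bar>\<theta> * h x\<bar> = \<theta> * \<bar>h x\<bar>" using \<theta> by (simp add: abs_mult)
      then have "\<bar>\<theta> * h x\<bar> \<le> 1" using \<theta>B mult_left_mono[OF hx less_imp_le[OF \<theta>]] by linarith
      moreover have "0 \<le> \<theta>\<^sup>2 * B\<^sup>2" by simp
      ultimately show "0 \<le> 1 + \<theta> * h x + \<theta>\<^sup>2 * B\<^sup>2" by linarith
    qed (use ih in auto)
    also have "(\<integral>x. 1 + \<theta> * h x + \<theta>\<^sup>2 * B\<^sup>2 \<partial>?T) = 1 + \<theta>\<^sup>2 * B\<^sup>2"
      using ih h0 by (simp add: T.prob_space del: One_nat_def)
    also have "ennreal (1 + \<theta>\<^sup>2 * B\<^sup>2) \<le> ennreal (exp (\<theta>\<^sup>2 * B\<^sup>2))"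
      by (intro ennreal_leI exp_ge_add_one_self)
    finally show ?thesis .
  qed
  from cond_event_probability[OF co \<delta> min \<epsilon>1] eventually_ge_at_top[of j]
  show ?thesis
  proof eventually_elim
    case (elim n)
    let ?C = "cond_event k \<phi> a n \<delta>"
    let ?U = "uniform_measure (iid_law \<phi>) ?C"
    have PC: "I.prob ?C > 0" using elim(1) F by (smt (verit) exp_gt_zero mult_pos_pos zero_less_power)
    have eC: "emeasure (iid_law \<phi>) ?C \<noteq> 0" "emeasure (iid_law \<phi>) ?C \<noteq> \<infinity>"
      using PC by (auto simp: I.emeasure_eq_measure)
    interpret U: prob_space ?U by (rule prob_space_uniform_measure[OF eC])
    have setsU: "sets ?U = sets (iid_law \<phi>)" by simp
    define m where "m = n div j"
    define r where "r = n mod j"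
    have n: "n = m * j + r" and r: "r < j" and n1: "n \<ge> 1"
      using j elim(2) by (auto simp: m_def r_def)
    have m: "m \<ge> 1" using div_le_mono[OF elim(2), of j] j by (simp add: m_def)
    let ?\<sigma> = "\<lambda>b \<omega>. \<lambda>i\<in>{1..j}. \<omega> (b * j + i)"
    have hm: "(\<lambda>\<omega>. h (?\<sigma> b \<omega>)) \<in> borel_measurable (iid_law \<phi>)" for b
      by (rule measurable_compose[OF block_measurable h])
    have \<sigma>sp: "?\<sigma> b \<omega> \<in> space (borel_pos_pow j)" if "\<omega> \<in> space (iid_law \<phi>)" for b \<omega>
      using that unfolding space_borel_pos_pow iid_law_def space_PiM_base by (auto simp: PiE_iff)
    have ihU: "integrable ?U (\<lambda>\<omega>. h (?\<sigma> b \<omega>))" for b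
      by (rule U.integrable_const_bound[where B=B])
         (use B \<sigma>sp hm measurable_cong_sets[OF setsU refl] in \<open>auto intro!: AE_I2\<close>)
    define e where "e = (\<integral>\<omega>. h (restrict \<omega> {1..j}) \<partial>?U)"
    have eb: "(\<integral>\<omega>. h (?\<sigma> b \<omega>) \<partial>?U) = e" if b: "b < m" for b
    proof -
      have "(b + 1) * j \<le> m * j" using b by (intro mult_right_mono) auto
      then have "b * j + j \<le> m * j" by (simp only: distrib_right mult_1)
      then have bn: "b * j + j \<le> n" using n by linarith
      have h0m: "(\<lambda>\<omega>. h (restrict \<omega> {1..j})) \<in> borel_measurable (iid_law \<phi>)"
        by (rule measurable_compose[OF restrict_measurable_iid h])
      have "(\<integral>\<omega>. h (?\<sigma> b \<omega>) \<partial>?U) = (\<integral>\<omega>. indicator ?C \<omega> * h (?\<sigma> b \<omega>) \<partial>iid_law \<phi>) / I.prob ?C"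
        by (rule integral_uniform_measure[OF I.prob_space_axioms cond_event_sets PC hm])
      also have "\<dots> = (\<integral>\<omega>. indicator ?C \<omega> * h (restrict \<omega> {1..j}) \<partial>iid_law \<phi>) / I.prob ?C"
        by (simp only: block_exchangeable[OF h bn])
      also have "\<dots> = e" unfolding e_def
        by (rule integral_uniform_measure[OF I.prob_space_axioms cond_event_sets PC h0m, symmetric])
      finally show ?thesis .
    qed
    have iS: "integrable ?U (\<lambda>\<omega>. \<Sum>b<m. \<theta> * h (?\<sigma> b \<omega>))"
      using ihU by (intro Bochner_Integration.integrable_sum integrable_mult_right) auto
    have ES: "U.expectation (\<lambda>\<omega>. \<Sum>b<m. \<theta> * h (?\<sigma> b \<omega>)) = \<theta> * real m * e"
      using ihU eb by (subst Bochner_Integration.integral_sum) (auto intro!: integrable_mult_right)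
    have "ennreal (exp (\<theta> * real m * e)) \<le> (\<integral>\<^sup>+\<omega>. ennreal (exp (\<Sum>b<m. \<theta> * h (?\<sigma> b \<omega>))) \<partial>?U)"
      using U.exp_expectation_le[OF iS] unfolding ES .
    also have "\<dots> = (\<integral>\<^sup>+\<omega>. ennreal (exp (\<Sum>b<m. \<theta> * h (?\<sigma> b \<omega>))) * indicator ?C \<omega> \<partial>iid_law \<phi>) / emeasure (iid_law \<phi>) ?C"
      using hm by (intro nn_integral_uniform_measure cond_event_sets)
        (auto intro!: measurable_compose[OF _ measurable_ennreal] measurable_compose[OF _ borel_measurable_exp]
            borel_measurable_sum)
    also have "\<dots> \<le> (ennreal (?F ^ n) * (\<integral>\<^sup>+x. ennreal (exp (\<theta> * h x)) \<partial>?T) ^ m) / emeasure (iid_law \<phi>) ?C"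
      using exp_block_sum_on_cond_event[OF min, of "\<lambda>x. \<theta> * h x" j n m r] h n n1
      by (intro divide_right_mono_ennreal) (simp add: mult.commute)
    also have "\<dots> \<le> (ennreal (?F ^ n) * ennreal (exp (\<theta>\<^sup>2 * B\<^sup>2)) ^ m) / emeasure (iid_law \<phi>) ?C"
      using M by (intro divide_right_mono_ennreal mult_left_mono power_mono) auto
    also have "\<dots> = ennreal (?F ^ n * exp (\<theta>\<^sup>2 * B\<^sup>2) ^ m / I.prob ?C)"
      using PC F by (simp add: I.emeasure_eq_measure ennreal_power ennreal_mult[symmetric] divide_ennreal)
    also have "\<dots> \<le> ennreal (exp (real m * (\<theta>\<^sup>2 * B\<^sup>2) + \<epsilon>1 * real n))"
    proof (rule ennreal_leI)
      have "?F ^ n * exp (\<theta>\<^sup>2 * B\<^sup>2) ^ m / I.prob ?C \<le> ?F ^ n * exp (\<theta>\<^sup>2 * B\<^sup>2) ^ m / (?F ^ n * exp (- \<epsilon>1 * real n))"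
        using elim(1) F PC by (intro divide_left_mono mult_pos_pos) auto
      also have "\<dots> = exp (\<theta>\<^sup>2 * B\<^sup>2) ^ m / exp (- \<epsilon>1 * real n)" using F by simp
      also have "\<dots> = exp (real m * (\<theta>\<^sup>2 * B\<^sup>2)) / exp (- (\<epsilon>1 * real n))" by (simp only: exp_of_nat_mult) simp
      also have "\<dots> = exp (real m * (\<theta>\<^sup>2 * B\<^sup>2) + \<epsilon>1 * real n)" by (simp only: exp_diff[symmetric]) simp
      finally show "?F ^ n * exp (\<theta>\<^sup>2 * B\<^sup>2) ^ m / I.prob ?C \<le> exp (real m * (\<theta>\<^sup>2 * B\<^sup>2) + \<epsilon>1 * real n)" .
    qed
    finally have "\<theta> * real m * e \<le> real m * (\<theta>\<^sup>2 * B\<^sup>2) + \<epsilon>1 * real n"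
      by (simp add: ennreal_le_iff)
    also have "\<dots> \<le> real m * (\<theta>\<^sup>2 * B\<^sup>2) + \<epsilon>1 * (2 * real m * real j)"
    proof -
      have "1 * j \<le> m * j" by (intro mult_right_mono m) simp
      then have "n \<le> 2 * m * j" using n r by linarith
      then have "real n \<le> 2 * real m * real j" by (metis of_nat_le_iff of_nat_mult of_nat_numeral)
      then show ?thesis using \<epsilon>1 by simp
    qed
    also have "\<dots> = \<theta> * real m * (\<theta> * B\<^sup>2 + \<epsilon> / 4)"
      using j by (simp add: \<epsilon>1_def power2_eq_square algebra_simps)
    finally have "e \<le> \<theta> * B\<^sup>2 + \<epsilon> / 4" using \<theta> m by simp
    also have "\<dots> < \<epsilon>" using \<theta>B2 \<epsilon> by simp
    finally show ?case unfolding e_def .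
  qed
qed

lemma bounded_pos_pow:
  assumes "bounded (f ` topspace (pos_pow_top j))"
  obtains B :: real where "\<And>x. x \<in> space (borel_pos_pow j) \<Longrightarrow> \<bar>f x :: real\<bar> \<le> B"
proof -
  have "topspace (pos_pow_top j) = space (borel_pos_pow j)"
    by (simp add: pos_pow_top_def space_borel_pos_pow)
  then show ?thesis using assms that unfolding bounded_iff by auto
qed

lemma cond_law_weak_limit:
  assumes co: "coercive a K" and \<delta>: "\<delta> > 0" and min: "minimizer a \<delta> p" and j: "j \<ge> 1"
  shows "weak_limit (pos_pow_top j) (\<lambda>n. cond_law k \<phi> a j n \<delta>) (tilted_pow a \<delta> p j) sequentially"
  unfolding weak_limit_def
proof (intro allI impI, elim conjE)
  fix f assume fc: "continuous_map (pos_pow_top j) euclideanreal f" and fb: "bounded (f ` topspace (pos_pow_top j))"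
  let ?T = "tilted_pow a \<delta> p j"
  interpret T: prob_space ?T by (intro prob_space_PiM prob_space_tilted minimizer_finite[OF min])
  have fm: "f \<in> borel_measurable (borel_pos_pow j)" by (rule continuous_map_pos_pow_measurable[OF fc])
  obtain B where B: "\<And>x. x \<in> space (borel_pos_pow j) \<Longrightarrow> \<bar>f x\<bar> \<le> B" using bounded_pos_pow[OF fb] by blast
  have spT: "space ?T = space (borel_pos_pow j)" by (rule sets_eq_imp_space_eq[OF sets_PiM_tilted])
  have fT: "f \<in> borel_measurable ?T" using fm measurable_cong_sets[OF sets_PiM_tilted refl] by blast
  have if': "integrable ?T f" by (rule T.integrable_const_bound[where B=B]) (use B spT fT in auto)
  define c where "c = integral\<^sup>L ?T f"
  have upper: "\<forall>\<^sub>F n in sequentially. (\<integral>\<omega>. s * (f (restrict \<omega> {1..j}) - c)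
      \<partial>uniform_measure (iid_law \<phi>) (cond_event k \<phi> a n \<delta>)) < \<epsilon>" if s: "\<bar>s\<bar> = 1" and \<epsilon>: "\<epsilon> > 0" for s \<epsilon>
  proof (rule cond_expectation_upper[OF co \<delta> min j _ _ _ \<epsilon>, where B="B + \<bar>c\<bar>"])
    show "(\<lambda>x. s * (f x - c)) \<in> borel_measurable (borel_pos_pow j)" using fm by auto
    show "\<bar>s * (f x - c)\<bar> \<le> B + \<bar>c\<bar>" if "x \<in> space (borel_pos_pow j)" for x
      using B[OF that] s by (simp add: abs_mult)
    show "(\<integral>x. s * (f x - c) \<partial>?T) = 0" using if' by (simp add: c_def T.prob_space del: One_nat_def)
  qed
  show "((\<lambda>n. \<integral>x. f x \<partial>cond_law k \<phi> a j n \<delta>) \<longlongrightarrow> integral\<^sup>L ?T f) sequentially"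
  proof (rule tendstoI)
    fix \<epsilon> :: real assume \<epsilon>: "\<epsilon> > 0"
    have "\<forall>\<^sub>F n in sequentially. 1 / 2
        * (enn2real (partfn a \<delta> p) ^ n * exp (- 1 * real n)) < measure (iid_law \<phi>) (cond_event k \<phi> a n \<delta>)"
      using cond_event_probability[OF co \<delta> min zero_less_one]
    proof eventually_elim
      case (elim n)
      have "0 < enn2real (partfn a \<delta> p) ^ n * exp (- 1 * real n)"
        using partfn_enn2real[OF minimizer_finite[OF min]] by (intro mult_pos_pos zero_less_power) auto
      then show ?case using elim by linarith
    qed
    moreover have "\<forall>\<^sub>F n in sequentially. (\<integral>\<omega>. - 1 * (f (restrict \<omega> {1..j}) - c)
        \<partial>uniform_measure (iid_law \<phi>) (cond_event k \<phi> a n \<delta>)) < \<epsilon>"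
      by (rule upper[OF _ \<epsilon>]) simp
    ultimately have "\<forall>\<^sub>F n in sequentially. dist (\<integral>x. f x \<partial>cond_law k \<phi> a j n \<delta>) c < \<epsilon>"
      using upper[OF abs_one \<epsilon>]
    proof eventually_elim
      case (elim n)
      let ?C = "cond_event k \<phi> a n \<delta>"
      let ?U = "uniform_measure (iid_law \<phi>) ?C"
      interpret I: prob_space "iid_law \<phi>" by (rule prob_space_iid)
      have "0 \<le> 1 / 2 * (enn2real (partfn a \<delta> p) ^ n * exp (- 1 * real n))" by simp
      then have PC: "I.prob ?C > 0" using elim(1) by linarith
      interpret U: prob_space ?U
        by (rule prob_space_uniform_measure) (use PC in \<open>auto simp: I.emeasure_eq_measure\<close>)
      have rU: "(\<lambda>\<omega>. restrict \<omega> {1..j}) \<in> measurable ?U (borel_pos_pow j)"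
        using restrict_measurable_iid by (simp cong: measurable_cong_sets)
      have iU: "integrable ?U (\<lambda>\<omega>. f (restrict \<omega> {1..j}))"
        by (rule U.integrable_const_bound[where B=B])
           (use B measurable_space[OF rU] measurable_compose[OF rU fm] in \<open>auto intro!: AE_I2\<close>)
      have cl: "(\<integral>x. f x \<partial>cond_law k \<phi> a j n \<delta>) = (\<integral>\<omega>. f (restrict \<omega> {1..j}) \<partial>?U)"
        unfolding cond_law_def by (rule integral_distr[OF rU fm])
      have lin: "(\<integral>\<omega>. s * (f (restrict \<omega> {1..j}) - c) \<partial>?U) = s * ((\<integral>\<omega>. f (restrict \<omega> {1..j}) \<partial>?U) - c)" for s
        using iU U.prob_space by simp
      have "1 * ((\<integral>\<omega>. f (restrict \<omega> {1..j}) \<partial>?U) - c) < \<epsilon>"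
        "- 1 * ((\<integral>\<omega>. f (restrict \<omega> {1..j}) \<partial>?U) - c) < \<epsilon>"
        using elim(2,3) unfolding lin[of 1] lin[of "- 1"] by (simp_all only: mult_1)
      then show ?case unfolding dist_real_def cl abs_less_iff by simp
    qed
    then show "\<forall>\<^sub>F n in sequentially. dist (\<integral>x. f x \<partial>cond_law k \<phi> a j n \<delta>) (integral\<^sup>L ?T f) < \<epsilon>"
      by (simp add: c_def)
  qed
qed

section \<open>Shrinking the window\<close>

text \<open>
  The square root of the product of the two densities is, up to normalization, at least the integrand
  of the partition function with \<open>d = 0\<close> at the midpoint of \<open>p\<close> and \<open>q\<close>, whose integral is at least its value
  at the minimizer \<open>q\<close>.  For \<open>d = 0\<close> this shows that the tilted law does not depend on the
  minimizer, for \<open>d \<rightarrow> 0\<close> that it depends continuously on \<open>d\<close>.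
\<close>
lemma minimizer_affinity:
  assumes p: "minimizer a d p" and q: "minimizer a 0 q" and d: "d \<ge> 0"
  shows "ennreal (exp (- (d * (\<Sum>i\<in>{1..k}. \<bar>q i\<bar>) / 2)))
    \<le> (\<integral>\<^sup>+x. ennreal
        (sqrt ((exp (tilt a d p x) / enn2real (partfn a d p)) * (exp (tilt a 0 q x) / enn2real (partfn a 0 q))))
            \<partial>base_law \<phi>)"
proof -
  let ?F = "enn2real (partfn a d p)" and ?G = "enn2real (partfn a 0 q)" and ?S = "\<Sum>i\<in>{1..k}. \<bar>q i\<bar>"
  note F = partfn_enn2real[OF minimizer_finite[OF p]] and G = partfn_enn2real[OF minimizer_finite[OF q]]
  have FG: "?F \<le> exp (d * ?S) * ?G"
  proof -
    have "partfn a d p \<le> partfn a d q" using p by (simp add: minimizer_def)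
    also have "\<dots> = (\<integral>\<^sup>+x. ennreal (exp (d * ?S)) * ennreal (exp (tilt a 0 q x)) \<partial>base_law \<phi>)"
      unfolding partfn_def by (intro nn_integral_cong) (simp add: tilt_eq exp_add ennreal_mult mult.commute)
    also have "\<dots> = ennreal (exp (d * ?S)) * partfn a 0 q" unfolding partfn_def by (subst nn_integral_cmult) auto
    also have "\<dots> = ennreal (exp (d * ?S) * ?G)" using G by (subst ennreal_mult) auto
    finally have "ennreal ?F \<le> ennreal (exp (d * ?S) * ?G)" using F by metis
    then show ?thesis using G by (subst (asm) ennreal_le_iff) auto
  qed
  let ?m = "\<lambda>i. (p i + q i) / 2"
  have mid: "tilt a 0 ?m x \<le> (tilt a d p x + tilt a 0 q x) / 2" for x
  proof -
    have "tilt a 0 ?m x = (tilt a 0 p x + tilt a 0 q x) / 2"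
      by (simp add: tilt_def sum.distrib[symmetric] sum_divide_distrib field_simps)
    also have "tilt a 0 p x \<le> tilt a d p x" using d by (simp add: tilt_eq sum_nonneg)
    finally show ?thesis by simp
  qed
  have sq: "sqrt ((exp (tilt a d p x) / ?F) * (exp (tilt a 0 q x) / ?G))
      = exp ((tilt a d p x + tilt a 0 q x) / 2) / sqrt (?F * ?G)" for x
  proof -
    have "exp (tilt a d p x) * exp (tilt a 0 q x) = (exp ((tilt a d p x + tilt a 0 q x) / 2))\<^sup>2"
      by (simp add: exp_add[symmetric] power2_eq_square)
    then show ?thesis by (simp add: real_sqrt_divide)
  qed
  have FGp: "sqrt (?F * ?G) > 0" using F G by simp
  have "exp (- (d * ?S / 2)) \<le> ?G / sqrt (?F * ?G)"
  proof -
    have "?F * ?G \<le> (exp (d * ?S / 2) * ?G)\<^sup>2"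
    proof -
      have "?F * ?G \<le> (exp (d * ?S) * ?G) * ?G" using FG G by (intro mult_right_mono) auto
      also have "exp (d * ?S) = (exp (d * ?S / 2))\<^sup>2" by (simp add: power2_eq_square exp_add[symmetric])
      finally show ?thesis by (simp add: power2_eq_square mult_ac)
    qed
    then have "sqrt (?F * ?G) \<le> exp (d * ?S / 2) * ?G" using G by (intro real_le_lsqrt) auto
    then have "exp (- (d * ?S / 2)) * sqrt (?F * ?G) \<le> exp (- (d * ?S / 2)) * (exp (d * ?S / 2) * ?G)"
      by (intro mult_left_mono) auto
    also have "\<dots> = ?G" by (simp add: mult.assoc[symmetric] exp_add[symmetric])
    finally show ?thesis using FGp by (simp add: pos_le_divide_eq)
  qed
  then have "ennreal (exp (- (d * ?S / 2))) \<le> ennreal (1 / sqrt (?F * ?G)) * ennreal ?G"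
    using FGp G by (subst ennreal_mult[symmetric]) (auto intro!: ennreal_leI)
  also have "\<dots> = ennreal (1 / sqrt (?F * ?G)) * partfn a 0 q" using G by simp
  also have "\<dots> \<le> ennreal (1 / sqrt (?F * ?G)) * partfn a 0 ?m"
    using q by (intro mult_left_mono) (auto simp: minimizer_def)
  also have "\<dots> = (\<integral>\<^sup>+x. ennreal (1 / sqrt (?F * ?G)) * ennreal (exp (tilt a 0 ?m x)) \<partial>base_law \<phi>)"
    unfolding partfn_def by (subst nn_integral_cmult) auto
  also have "\<dots> \<le> (\<integral>\<^sup>+x. ennreal (sqrt ((exp (tilt a d p x) / ?F) * (exp (tilt a 0 q x) / ?G))) \<partial>base_law \<phi>)"
  proof (rule nn_integral_mono)
    fix x
    have "1 / sqrt (?F * ?G) * exp (tilt a 0 ?m x) \<le> exp ((tilt a d p x + tilt a 0 q x) / 2) / sqrt (?F * ?G)"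
      using mid[of x] FGp by (simp add: divide_right_mono)
    then show "ennreal (1 / sqrt (?F * ?G)) * ennreal (exp (tilt a 0 ?m x))
      \<le> ennreal (sqrt ((exp (tilt a d p x) / ?F) * (exp (tilt a 0 q x) / ?G)))"
      unfolding sq using FGp by (subst ennreal_mult[symmetric]) (auto intro!: ennreal_leI)
  qed
  finally show ?thesis .
qed

text \<open>The Hellinger affinity of product measures is the product of the affinities of the factors.\<close>
lemma tilted_product_integral_diff:
  assumes p: "minimizer a d p" and q: "minimizer a 0 q" and d: "d \<ge> 0"
    and f: "f \<in> borel_measurable (borel_pos_pow j)"
    and B: "\<And>x. x \<in> space (borel_pos_pow j) \<Longrightarrow> \<bar>f x\<bar> \<le> B"
  shows "\<bar>(\<integral>x. f x \<partial>tilted_pow a d p j) - (\<integral>x. f x \<partial>tilted_pow a 0 q j)\<bar>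
    \<le> 2 * B * sqrt (2 - 2 * exp (- (d * (\<Sum>i\<in>{1..k}. \<bar>q i\<bar>) / 2)) ^ j)"
proof -
  interpret PM: product_sigma_finite "\<lambda>_::nat. base_law \<phi>"
    by (simp add: product_sigma_finite_def base.sigma_finite_measure_axioms)
  let ?P = "base_pow j"
  define u where "u x = exp (tilt a d p x) / enn2real (partfn a d p)" for x
  define v where "v x = exp (tilt a 0 q x) / enn2real (partfn a 0 q)" for x
  have um[measurable]: "u \<in> borel_measurable borel_pos" and vm[measurable]: "v \<in> borel_measurable borel_pos"
    unfolding u_def v_def by measurable
  have u0: "0 \<le> u x" and v0: "0 \<le> v x" for x by (auto simp: u_def v_def)
  note fp = minimizer_finite[OF p] and fq = minimizer_finite[OF q]
  have prodm: "(\<lambda>x. \<Prod>i\<in>{1..j}. w (x i)) \<in> borel_measurable ?P" if "w \<in> borel_measurable borel_pos"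
    for w :: "real \<Rightarrow> real"
    using that by (intro borel_measurable_prod base_component_measurable)
  have int1: "(\<integral>\<^sup>+x. ennreal (\<Prod>i\<in>{1..j}. w (x i)) \<partial>?P) = (\<integral>\<^sup>+x. ennreal (w x) \<partial>base_law \<phi>) ^ j"
    if w: "w \<in> borel_measurable borel_pos" "\<And>x. 0 \<le> w x" for w :: "real \<Rightarrow> real"
  proof -
    have "(\<integral>\<^sup>+x. ennreal (\<Prod>i\<in>{1..j}. w (x i)) \<partial>?P) = (\<integral>\<^sup>+x. (\<Prod>i\<in>{1..j}. ennreal (w (x i))) \<partial>?P)"
      using w(2) by (simp add: prod_ennreal)
    also have "\<dots> = (\<Prod>i\<in>{1..j}. \<integral>\<^sup>+x. ennreal (w x) \<partial>base_law \<phi>)"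
      using w(1) by (intro PM.product_nn_integral_prod) auto
    finally show ?thesis by simp
  qed
  have "ennreal (exp (- (d * (\<Sum>i\<in>{1..k}. \<bar>q i\<bar>) / 2)) ^ j) \<le> (\<integral>\<^sup>+x. ennreal (sqrt (u x * v x)) \<partial>base_law \<phi>) ^ j"
    using minimizer_affinity[OF p q d] unfolding u_def v_def by (subst ennreal_power[symmetric])
        (auto intro!: power_mono)
  also have "\<dots> = (\<integral>\<^sup>+x. ennreal (\<Prod>i\<in>{1..j}. sqrt (u (x i) * v (x i))) \<partial>?P)"
    by (subst int1) (auto simp: u0 v0)
  also have "\<dots> = (\<integral>\<^sup>+x. ennreal (sqrt ((\<Prod>i\<in>{1..j}. u (x i)) * (\<Prod>i\<in>{1..j}. v (x i)))) \<partial>?P)"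
    by (simp add: prod.distrib[symmetric] sqrt_prod)
  finally have aff: "ennreal (exp (- (d * (\<Sum>i\<in>{1..k}. \<bar>q i\<bar>) / 2)) ^ j)
    \<le> (\<integral>\<^sup>+x. ennreal (sqrt ((\<Prod>i\<in>{1..j}. u (x i)) * (\<Prod>i\<in>{1..j}. v (x i)))) \<partial>?P)" .
  have f': "f \<in> borel_measurable ?P" using f measurable_cong_sets[OF sets_PiM_base refl] by blast
  have B': "\<bar>f x\<bar> \<le> B" if "x \<in> space ?P" for x using B that sets_eq_imp_space_eq[OF sets_PiM_base] by simp
  have one: "(\<integral>\<^sup>+x. ennreal (\<Prod>i\<in>{1..j}. u (x i)) \<partial>?P) = 1" "(\<integral>\<^sup>+x. ennreal (\<Prod>i\<in>{1..j}. v (x i)) \<partial>?P) = 1"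
    using nn_integral_tilted_density[OF fp] nn_integral_tilted_density[OF fq]
    by (subst int1; auto simp: u0 v0; simp add: u_def v_def)+
  show ?thesis
    unfolding PiM_tilted_density[OF fp] PiM_tilted_density[OF fq] u_def[symmetric] v_def[symmetric]
    by (rule integral_density_diff_le[OF prodm[OF um] prodm[OF vm] f' _ _ one aff _ B'])
        (auto intro!: prod_nonneg u0 v0)
qed

lemma tilted_weak_limit:
  assumes p: "\<And>d. d > 0 \<Longrightarrow> minimizer a d (p d)" and q: "minimizer a 0 q"
  shows "weak_limit (pos_pow_top j) (\<lambda>d. tilted_pow a d (p d) j) (tilted_pow a 0 q j) (at_right 0)"
  unfolding weak_limit_def
proof (intro allI impI, elim conjE)
  fix f assume fc: "continuous_map (pos_pow_top j) euclideanreal f" and fb: "bounded (f ` topspace (pos_pow_top j))"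
  have fm: "f \<in> borel_measurable (borel_pos_pow j)" by (rule continuous_map_pos_pow_measurable[OF fc])
  obtain B where B: "\<And>x. x \<in> space (borel_pos_pow j) \<Longrightarrow> \<bar>f x\<bar> \<le> B" using bounded_pos_pow[OF fb] by blast
  let ?S = "\<Sum>i\<in>{1..k}. \<bar>q i\<bar>"
  let ?r = "\<lambda>d. 2 * B * sqrt (2 - 2 * exp (- (d * ?S / 2)) ^ j)"
  have "(?r \<longlongrightarrow> 2 * B * sqrt (2 - 2 * exp (- (0 * ?S / 2)) ^ j)) (at_right 0)"
    by (intro tendsto_intros) auto
  then have r: "(?r \<longlongrightarrow> 0) (at_right 0)" by simp
  have "((\<lambda>d. (\<integral>x. f x \<partial>tilted_pow a d (p d) j) - (\<integral>x. f x \<partial>tilted_pow a 0 q j)) \<longlongrightarrow> 0) (at_right 0)"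
  proof (rule Lim_null_comparison[OF _ r])
    show "\<forall>\<^sub>F d in at_right 0. norm ((\<integral>x. f x \<partial>tilted_pow a d (p d) j) - (\<integral>x. f x \<partial>tilted_pow a 0 q j)) \<le> ?r d"
      using eventually_at_right_less[of 0]
    proof eventually_elim
      case (elim d)
      then show ?case using tilted_product_integral_diff[OF p[OF elim] q _ fm B] by simp
    qed
  qed
  then show "((\<lambda>d. \<integral>x. f x \<partial>tilted_pow a d (p d) j) \<longlongrightarrow> (\<integral>x. f x \<partial>tilted_pow a 0 q j)) (at_right 0)"
    by (rule LIM_zero_cancel)
qed

section \<open>Subdifferentials and normalized exponential densities\<close>

lemma partfn_zero_delta:
  "partfn v 0 p = ennreal (exp (- (\<Sum>i\<in>{1..k}. p i * v i)))
      * (\<integral>\<^sup>+x. ennreal (exp (\<Sum>i\<in>{1..k}. p i * \<phi> i x)) \<partial>base_law \<phi>)"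
proof -
  have [measurable]: "(\<lambda>x. \<Sum>i\<in>{1..k}. p i * \<phi> i x) \<in> borel_measurable borel_pos"
    by (intro borel_measurable_sum borel_measurable_times borel_measurable_const phi_measurable)
  have "partfn v 0 p = (\<integral>\<^sup>+x. ennreal (exp (- (\<Sum>i\<in>{1..k}. p i * v i)))
      * ennreal (exp (\<Sum>i\<in>{1..k}. p i * \<phi> i x)) \<partial>base_law \<phi>)"
    unfolding partfn_def tilt_split
    by (intro nn_integral_cong) (simp add: exp_add[symmetric] ennreal_mult[symmetric])
  also have "\<dots> = ennreal (exp (- (\<Sum>i\<in>{1..k}. p i * v i)))
      * (\<integral>\<^sup>+x. ennreal (exp (\<Sum>i\<in>{1..k}. p i * \<phi> i x)) \<partial>base_law \<phi>)"
    by (rule nn_integral_cmult) measurable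
  finally show ?thesis .
qed

lemma partfn_finite_shift: "partfn v 0 p < \<infinity> \<Longrightarrow> partfn w 0 p < \<infinity>"
  unfolding partfn_zero_delta by (auto simp: ennreal_mult_less_top)

text \<open>
  The subgradient inequality at \<open>p\<close> says that \<open>q \<mapsto> H(q) - \<Sum>i. v\<^sub>i q\<^sub>i\<close> is minimal at \<open>p\<close>, and this is the
  logarithm of the partition function with \<open>v\<close> in place of \<open>a\<close> and \<open>d = 0\<close>.  An infinite value at \<open>p\<close> is
  excluded by the finite value at \<open>0\<close>.
\<close>
lemma subdiff_iff_minimizer:
  assumes v: "v \<in> {1..k} \<rightarrow>\<^sub>E UNIV"
  shows "v \<in> subdiff k (log_mgf k \<phi>) p \<longleftrightarrow> minimizer v 0 p"
proof -
  define m where "m q = (\<integral>\<^sup>+x. ennreal (exp (\<Sum>i\<in>{1..k}. q i * \<phi> i x)) \<partial>base_law \<phi>)" for q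
  define s where "s q = (\<Sum>i\<in>{1..k}. q i * v i)" for q :: "nat \<Rightarrow> real"
  have pm: "partfn v 0 q = ennreal (exp (- s q)) * m q" for q by (simp add: partfn_zero_delta m_def s_def)
  have H: "log_mgf k \<phi> q = (if m q = \<infinity> then \<infinity> else ereal (ln (enn2real (m q))))" for q
    by (simp add: log_mgf_def m_def Let_def)
  have m0: "m q > 0" for q using partfn_pos[of v 0 q] unfolding pm by (auto simp: zero_less_iff_neq_zero)
  have mr: "m q = ennreal (enn2real (m q))" "enn2real (m q) > 0" if "m q \<noteq> \<infinity>" for q
    using that m0[of q] by (auto simp: enn2real_positive_iff top.not_eq_extremum)
  have pinf: "partfn v 0 q = \<infinity> \<longleftrightarrow> m q = \<infinity>" for q
    unfolding pm by (auto simp: ennreal_mult_eq_top_iff ennreal_eq_0_iff not_le)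
  have key: "partfn v 0 p \<le> partfn v 0 q \<longleftrightarrow> log_mgf k \<phi> p + ereal (\<Sum>i\<in>{1..k}. v i * (q i - p i)) \<le> log_mgf k \<phi> q"
    if mp: "m p \<noteq> \<infinity>" for q
  proof (cases "m q = \<infinity>")
    case True
    then have "partfn v 0 q = \<infinity>" using pinf by blast
    then show ?thesis using True by (simp add: H)
  next
    case False
    have sm: "(\<Sum>i\<in>{1..k}. v i * (q i - p i)) = s q - s p"
      by (simp add: s_def algebra_simps sum_subtractf)
    have pr: "partfn v 0 r = ennreal (exp (- s r) * enn2real (m r))" if "m r \<noteq> \<infinity>" for r
      unfolding pm using mr[OF that] by (subst ennreal_mult) auto
    have "partfn v 0 p \<le> partfn v 0 q \<longleftrightarrow> exp (- s p) * enn2real (m p) \<le> exp (- s q) * enn2real (m q)"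
      unfolding pr[OF mp] pr[OF False] using mr(2)[OF False] by (simp add: ennreal_le_iff)
    also have "\<dots> \<longleftrightarrow> exp (- s p + ln (enn2real (m p))) \<le> exp (- s q + ln (enn2real (m q)))"
      unfolding exp_add using mr(2)[OF False] mr(2)[OF mp] by simp
    also have "\<dots> \<longleftrightarrow> log_mgf k \<phi> p + ereal (\<Sum>i\<in>{1..k}. v i * (q i - p i)) \<le> log_mgf k \<phi> q"
      unfolding sm using mp False by (auto simp: H)
    finally show ?thesis .
  qed
  show ?thesis
  proof
    assume sd: "v \<in> subdiff k (log_mgf k \<phi>) p"
    have sdq: "log_mgf k \<phi> p + ereal (\<Sum>i\<in>{1..k}. v i * (q i - p i)) \<le> log_mgf k \<phi> q" if "q \<in> {1..k} \<rightarrow>\<^sub>E UNIV" for q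
      using sd that by (simp add: subdiff_def)
    have "m p \<noteq> \<infinity>"
    proof
      assume inf: "m p = \<infinity>"
      have "m (\<lambda>i\<in>{1..k}. 0) = 1" by (simp add: m_def)
      then show False using sdq[of "\<lambda>i\<in>{1..k}. 0"] inf by (simp add: H)
    qed
    show "minimizer v 0 p"
      unfolding minimizer_def
    proof
      fix q
      have "partfn v 0 p \<le> partfn v 0 (restrict q {1..k})"
        using key[OF \<open>m p \<noteq> \<infinity>\<close>] sdq[of "restrict q {1..k}"] by auto
      also have "\<dots> = partfn v 0 q" by (rule partfn_cong) simp
      finally show "partfn v 0 p \<le> partfn v 0 q" .
    qed
  next
    assume min: "minimizer v 0 p"
    have "m p \<noteq> \<infinity>" using minimizer_finite[OF min] pinf[of p] by auto
    then show "v \<in> subdiff k (log_mgf k \<phi>) p"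
      using min key v unfolding subdiff_def minimizer_def by auto
  qed
qed

lemma normalized_eqI:
  assumes w: "\<And>x. 0 < w x" "w \<in> borel_measurable borel_pos" and c: "c > 0"
    and \<mu>: "\<mu> = density leb_pos (\<lambda>x. ennreal (c * w x))" "prob_space \<mu>"
  shows "\<mu> = normalized w"
proof -
  interpret prob_space \<mu> by (rule \<mu>(2))
  have wm: "w \<in> borel_measurable leb_pos" by (rule leb_pos_measurable[OF w(2)])
  have "1 = emeasure \<mu> (space \<mu>)" by (simp add: emeasure_space_1)
  also have "\<dots> = (\<integral>\<^sup>+x. ennreal (c * w x) \<partial>leb_pos)"
    unfolding \<mu>(1) using wm by (subst emeasure_density) (auto intro!: nn_integral_cong)
  finally have one: "(\<integral>\<^sup>+x. ennreal (c * w x) \<partial>leb_pos) = 1" by simp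
  have "(\<integral>x. c * w x \<partial>leb_pos) = 1"
    using one w(1) c wm by (subst integral_eq_nn_integral) (auto intro!: AE_I2 mult_nonneg_nonneg less_imp_le)
  then have "c * (\<integral>x. w x \<partial>leb_pos) = 1" by simp
  then have "w x / (\<integral>y. w y \<partial>leb_pos) = c * w x" for x
    using c by (metis mult.commute nonzero_eq_divide_eq mult.assoc mult_1 mult_zero_right zero_neq_one)
  then show ?thesis unfolding normalized_def \<mu>(1) by simp
qed

text \<open>
  The first parameter is shifted by \<open>1\<close> because the base law already contributes the factor
  \<open>exp (- \<phi>\<^sub>1)\<close>.
\<close>
lemma tilted_eq_normalized:
  assumes fin: "partfn a d p < \<infinity>"
  shows "tilted a d p = normalized (\<lambda>x. exp (\<Sum>i\<in>{1..k}. (p(1 := p 1 - 1)) i * \<phi> i x))"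
proof (rule normalized_eqI)
  let ?F = "enn2real (partfn a d p)"
  \<comment> \<open>Collects all factors that do not depend on \<open>x\<close>.\<close>
  define c where "c = exp (- (\<Sum>i\<in>{1..k}. p i * a i) + d * (\<Sum>i\<in>{1..k}. \<bar>p i\<bar>)) / (Z * ?F)"
  have F: "?F > 0" using partfn_enn2real[OF fin] by simp
  show "c > 0" using F Z_pos by (simp add: c_def)
  show "(\<lambda>x. exp (\<Sum>i\<in>{1..k}. (p(1 := p 1 - 1)) i * \<phi> i x)) \<in> borel_measurable borel_pos"
    by (intro measurable_compose[OF _ borel_measurable_exp] borel_measurable_sum borel_measurable_times
        borel_measurable_const phi_measurable)
  show "prob_space (tilted a d p)" by (rule prob_space_tilted[OF fin])
  have sp: "{1..k} = insert 1 {2..k}" using k by auto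
  have sh: "(\<Sum>i\<in>{1..k}. (p(1 := p 1 - 1)) i * \<phi> i x) = (\<Sum>i\<in>{1..k}. p i * \<phi> i x) - \<phi> 1 x" for x
    unfolding sp by (simp add: algebra_simps)
  have m1: "(\<lambda>x. ennreal (exp (- \<phi> 1 x) / Z)) \<in> borel_measurable leb_pos"
    by (intro leb_pos_measurable) measurable
  have m2: "(\<lambda>x. ennreal (exp (tilt a d p x) / ?F)) \<in> borel_measurable leb_pos"
    by (intro leb_pos_measurable) measurable
  have "tilted a d p = density leb_pos (\<lambda>x. ennreal (exp (- \<phi> 1 x) / Z) * ennreal (exp (tilt a d p x) / ?F))"
    unfolding tilted_def base_law_eq by (rule density_density_eq[OF m1 m2])
  also have "\<dots> = density leb_pos (\<lambda>x. ennreal (c * exp (\<Sum>i\<in>{1..k}. (p(1 := p 1 - 1)) i * \<phi> i x)))"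
  proof (intro arg_cong[where f="density leb_pos"] ext)
    fix x
    have "exp (- \<phi> 1 x) / Z * (exp (tilt a d p x) / ?F) = exp (- \<phi> 1 x + tilt a d p x) / (Z * ?F)"
      by (simp only: exp_add) simp
    also have "- \<phi> 1 x + tilt a d p x = (- (\<Sum>i\<in>{1..k}. p i * a i) + d * (\<Sum>i\<in>{1..k}. \<bar>p i\<bar>))
        + (\<Sum>i\<in>{1..k}. (p(1 := p 1 - 1)) i * \<phi> i x)"
      unfolding sh tilt_split by simp
    also have "exp \<dots> / (Z * ?F) = c * exp (\<Sum>i\<in>{1..k}. (p(1 := p 1 - 1)) i * \<phi> i x)"
      unfolding exp_add c_def by simp
    finally show "ennreal (exp (- \<phi> 1 x) / Z) * ennreal (exp (tilt a d p x) / ?F)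
      = ennreal (c * exp (\<Sum>i\<in>{1..k}. (p(1 := p 1 - 1)) i * \<phi> i x))"
      using F Z_pos by (subst ennreal_mult[symmetric]) auto
  qed
  finally show "tilted a d p = density leb_pos (\<lambda>x. ennreal (c * exp (\<Sum>i\<in>{1..k}. (p(1 := p 1 - 1)) i * \<phi> i x)))" .
qed simp

text \<open>The vector \<open>v\<close> enters the exponent only through an additive constant, which the normalization cancels.\<close>
lemma tilted_shift: "partfn v 0 p < \<infinity> \<Longrightarrow> tilted v 0 p = tilted w 0 p"
  using tilted_eq_normalized partfn_finite_shift by metis

lemma tilted_mean_shift: "partfn v 0 p < \<infinity> \<Longrightarrow> tilted_mean v 0 p = tilted_mean w 0 p"
  using tilted_shift[of v p w] by (simp add: tilted_mean_def fun_eq_iff)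

text \<open>
  The logarithm of the density of one law with respect to the other is a linear combination of the
  \<open>\<phi>\<^sub>i\<close> and a constant, so equal moments give it the same mean under both laws, and \<open>density_exp_eqI\<close> applies.
\<close>
lemma normalized_exp_unique:
  assumes I: "I \<subseteq> {1..k}"
    and \<mu>: "normalized (\<lambda>x. exp (\<Sum>i\<in>I. p i * \<phi> i x)) \<in> probs borel_pos" (is "?\<mu> \<in> _")
    and \<nu>: "normalized (\<lambda>x. exp (\<Sum>i\<in>I. q i * \<phi> i x)) \<in> probs borel_pos" (is "?\<nu> \<in> _")
    and a: "\<And>i. i \<in> I \<Longrightarrow> has_bochner_integral (normalized (\<lambda>x. exp (\<Sum>i\<in>I. p i * \<phi> i x))) (\<phi> i) (a i)"
      "\<And>i. i \<in> I \<Longrightarrow> has_bochner_integral (normalized (\<lambda>x. exp (\<Sum>i\<in>I. q i * \<phi> i x))) (\<phi> i) (a i)"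
  shows "normalized (\<lambda>x. exp (\<Sum>i\<in>I. q i * \<phi> i x)) = normalized (\<lambda>x. exp (\<Sum>i\<in>I. p i * \<phi> i x))"
proof -
  interpret \<mu>: prob_space ?\<mu> using \<mu> by (simp add: probs_def)
  interpret \<nu>: prob_space ?\<nu> using \<nu> by (simp add: probs_def)
  define w where "w r x = exp (\<Sum>i\<in>I. r i * \<phi> i x)" for r x
  define N where "N r = (\<integral>y. w r y \<partial>leb_pos)" for r
  have wm: "w r \<in> borel_measurable borel_pos" for r unfolding w_def[abs_def] using I
    by (intro measurable_compose[OF _ borel_measurable_exp] borel_measurable_sum borel_measurable_times
        borel_measurable_const phi_measurable) auto
  have nd: "normalized (w r) = density leb_pos (\<lambda>x. ennreal (w r x / N r))" for r
    by (simp add: normalized_def N_def)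
  have Npos: "N r > 0" if P: "prob_space (normalized (w r))" for r
  proof -
    interpret P: prob_space "normalized (w r)" by (rule P)
    have "N r \<ge> 0" unfolding N_def w_def by (intro integral_nonneg_AE) auto
    moreover have "N r \<noteq> 0"
    proof
      assume "N r = 0"
      then have "emeasure (normalized (w r)) (space (normalized (w r))) = 0"
        unfolding nd by (subst emeasure_density) auto
      then show False using P.emeasure_space_1 by simp
    qed
    ultimately show ?thesis by simp
  qed
  have Np: "N p > 0" and Nq: "N q > 0"
    using Npos[of p] Npos[of q] \<mu>.prob_space_axioms \<nu>.prob_space_axioms by (auto simp: w_def[abs_def])
  \<comment> \<open>The log-density of the second law with respect to the first.\<close>
  define Y where "Y x = (\<Sum>i\<in>I. (q i - p i) * \<phi> i x) + ln (N p / N q)" for x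
  have Ym: "Y \<in> borel_measurable borel_pos" unfolding Y_def[abs_def] using I
    by (intro borel_measurable_add borel_measurable_sum borel_measurable_times borel_measurable_const
        phi_measurable) auto
  have smu: "sets ?\<mu> = sets borel_pos" using \<mu> by (simp add: probs_def)
  show ?thesis
  proof (rule density_exp_eqI)
    show "prob_space ?\<mu>" "prob_space ?\<nu>" by unfold_locales
    show "Y \<in> borel_measurable ?\<mu>" using Ym measurable_cong_sets[OF smu refl] by blast
    have "density (normalized (w p)) (\<lambda>x. ennreal (exp (Y x)))
        = density leb_pos (\<lambda>x. ennreal (w p x / N p) * ennreal (exp (Y x)))"
      unfolding nd
    proof (rule density_density_eq)
      show "(\<lambda>x. ennreal (w p x / N p)) \<in> borel_measurable leb_pos"
        using leb_pos_measurable[OF wm] by auto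
      show "(\<lambda>x. ennreal (exp (Y x))) \<in> borel_measurable leb_pos"
        using leb_pos_measurable[OF Ym] by auto
    qed
    also have "(\<lambda>x. ennreal (w p x / N p) * ennreal (exp (Y x))) = (\<lambda>x. ennreal (w q x / N q))"
    proof
      fix x
      have "w p x / N p * exp (Y x) = exp ((\<Sum>i\<in>I. p i * \<phi> i x) + (\<Sum>i\<in>I. (q i - p i) * \<phi> i x)) * (N p / N q) / N p"
        using Np Nq by (simp add: Y_def w_def exp_add)
      also have "(\<Sum>i\<in>I. p i * \<phi> i x) + (\<Sum>i\<in>I. (q i - p i) * \<phi> i x) = (\<Sum>i\<in>I. q i * \<phi> i x)"
        by (simp add: sum.distrib[symmetric] algebra_simps)
      also have "exp (\<Sum>i\<in>I. q i * \<phi> i x) * (N p / N q) / N p = w q x / N q" using Np by (simp add: w_def)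
      finally show "ennreal (w p x / N p) * ennreal (exp (Y x)) = ennreal (w q x / N q)"
        using Np by (subst ennreal_mult[symmetric]) (auto simp: w_def)
    qed
    also have "density leb_pos (\<lambda>x. ennreal (w q x / N q)) = normalized (w q)" by (rule nd[symmetric])
    finally show "?\<nu> = density ?\<mu> (\<lambda>x. ennreal (exp (Y x)))"
      unfolding w_def[abs_def] by (rule sym)
    have int: "integrable ?\<mu> (\<phi> i)" "integrable ?\<nu> (\<phi> i)" "integral\<^sup>L ?\<mu> (\<phi> i) = a i" "integral\<^sup>L ?\<nu> (\<phi> i) = a i"
      if "i \<in> I" for i using a(1)[OF that] a(2)[OF that] by (auto simp: has_bochner_integral_iff)
    show "integrable ?\<mu> Y" unfolding Y_def
      using int by (intro Bochner_Integration.integrable_add Bochner_Integration.integrable_sum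
          integrable_mult_right) auto
    show "integrable ?\<nu> Y" unfolding Y_def
      using int by (intro Bochner_Integration.integrable_add Bochner_Integration.integrable_sum
          integrable_mult_right) auto
    have "integral\<^sup>L ?\<mu> Y = (\<Sum>i\<in>I. (q i - p i) * a i) + ln (N p / N q)"
      unfolding Y_def using int by (simp add: \<mu>.prob_space Bochner_Integration.integral_sum)
    moreover have "integral\<^sup>L ?\<nu> Y = (\<Sum>i\<in>I. (q i - p i) * a i) + ln (N p / N q)"
      unfolding Y_def using int by (simp add: \<nu>.prob_space Bochner_Integration.integral_sum)
    ultimately show "integral\<^sup>L ?\<mu> Y = integral\<^sup>L ?\<nu> Y" by simp
  qed
qed

section \<open>Which minimizer has a vanishing last parameter\<close>

lemma tilted_unique:
  assumes p: "minimizer a 0 p" and q: "minimizer a 0 q"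
  shows "tilted a 0 p = tilted a 0 q"
proof -
  interpret p: prob_space "tilted a 0 p" by (rule prob_space_tilted[OF minimizer_finite[OF p]])
  interpret q: prob_space "tilted a 0 q" by (rule prob_space_tilted[OF minimizer_finite[OF q]])
  show ?thesis
  proof (rule measure_eqI)
    fix A assume A: "A \<in> sets (tilted a 0 p)"
    let ?u = "\<lambda>p x. exp (tilt a 0 p x) / enn2real (partfn a 0 p)"
    have "\<bar>(\<integral>x. indicator A x \<partial>tilted a 0 p) - (\<integral>x. indicator A x \<partial>tilted a 0 q)\<bar> \<le> 2 * 1 * sqrt (2 - 2 * (1::real))"
      unfolding tilted_def
    proof (rule integral_density_diff_le)
      show "(\<integral>\<^sup>+x. ennreal (?u p x) \<partial>base_law \<phi>) = 1" "(\<integral>\<^sup>+x. ennreal (?u q x) \<partial>base_law \<phi>) = 1"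
        by (intro nn_integral_tilted_density minimizer_finite p q)+
      show "ennreal 1 \<le> (\<integral>\<^sup>+x. ennreal (sqrt (?u p x * ?u q x)) \<partial>base_law \<phi>)"
        using minimizer_affinity[OF p q] by simp
      show "indicator A \<in> borel_measurable (base_law \<phi>)" using A by auto
    qed (auto simp: indicator_def)
    then have "measure (tilted a 0 p) A = measure (tilted a 0 q) A"
      using A sets.sets_into_space[OF A] by (simp add: Int_absorb2)
    then show "emeasure (tilted a 0 p) A = emeasure (tilted a 0 q) A"
      by (simp add: p.emeasure_eq_measure q.emeasure_eq_measure)
  qed simp
qed

text \<open>
  With a vanishing last parameter, the last coordinate of \<open>v\<close> can be moved to any value not below the
  last tilted mean.
\<close>
lemma minimizer_raise:
  assumes v: "minimizer v 0 p" and pk: "p k = 0"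
    and eq: "\<And>i. i \<in> {1..<k} \<Longrightarrow> w i = v i" and le: "tilted_mean v 0 p k \<le> w k"
  shows "minimizer w 0 p"
proof (rule minimizer_of_moments)
  note fin = minimizer_finite[OF v]
  show "partfn w 0 p < \<infinity>" by (rule partfn_finite_shift[OF fin])
  show "integrable (tilted w 0 p) (\<phi> i)" if "i \<in> {1..k}" for i
    using minimizer_moments(1)[OF v order_refl that] tilted_shift[OF fin, of w] by simp
  show "tilted_mean w 0 p i = w i" if "i \<in> {1..<k}" for i
    using tilted_mean_le[OF v order_refl that] tilted_mean_shift[OF fin, of w] eq[OF that] by simp
  show "tilted_mean w 0 p k \<le> w k" using le tilted_mean_shift[OF fin, of w] by simp
qed (rule pk)

lemma proj1_eqD: "proj1 k v = proj1 k w \<Longrightarrow> i \<in> {1..<k} \<Longrightarrow> v i = w i"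
  unfolding proj1_def by (metis restrict_apply')

lemma S1_witness:
  assumes S1: "proj1 k a \<in> S1_set k \<phi>"
  defines "P \<equiv> (SOME p. p \<in> S1_params k \<phi> (proj1 k a))(k := 0)"
  shows "\<exists>v. v \<in> subdiff k (log_mgf k \<phi>) P \<and> minimizer v 0 P \<and> (\<forall>i\<in>{1..<k}. v i = a i)"
    and "g2 k \<phi> (proj1 k a) = Inf (proj2 k ` subdiff k (log_mgf k \<phi>) P)"
proof -
  have "S1_params k \<phi> (proj1 k a) \<noteq> {}" using S1 by (simp add: S1_set_def)
  then have "(SOME p. p \<in> S1_params k \<phi> (proj1 k a)) \<in> S1_params k \<phi> (proj1 k a)"
    by (simp add: some_in_eq)
  then have "proj1 k a \<in> proj1 k ` subdiff k (log_mgf k \<phi>) P"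
    unfolding S1_params_def P_def by blast
  then obtain v where v: "v \<in> subdiff k (log_mgf k \<phi>) P" "proj1 k a = proj1 k v" by blast
  moreover have "v \<in> {1..k} \<rightarrow>\<^sub>E UNIV" using v(1) by (simp add: subdiff_def)
  ultimately show "\<exists>v. v \<in> subdiff k (log_mgf k \<phi>) P \<and> minimizer v 0 P \<and> (\<forall>i\<in>{1..<k}. v i = a i)"
    using subdiff_iff_minimizer[of v P] proj1_eqD[of a v] by metis
  show "g2 k \<phi> (proj1 k a) = Inf (proj2 k ` subdiff k (log_mgf k \<phi>) P)"
    by (simp add: g2_def P_def Let_def)
qed

lemma subdiff_top_ge_tilted_mean:
  assumes v: "minimizer v 0 p" and u: "u \<in> subdiff k (log_mgf k \<phi>) p"
  shows "tilted_mean v 0 p k \<le> proj2 k u"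
proof -
  have "u \<in> {1..k} \<rightarrow>\<^sub>E UNIV" using u by (simp add: subdiff_def)
  then have "minimizer u 0 p" using subdiff_iff_minimizer u by blast
  then have "tilted_mean u 0 p k \<le> u k" using tilted_mean_top[of u 0 p] by simp
  then show ?thesis using tilted_mean_shift[OF minimizer_finite[OF v], of u] by (simp add: proj2_def)
qed

text \<open>
  The first \<open>k - 1\<close> coordinates of a suitable subgradient at the parameters defining \<open>g2\<close> are those of
  \<open>a\<close>, and every subgradient there has a last coordinate not below the last tilted mean.  Hence that mean is
  at most \<open>g2\<close>, and the last coordinate can be moved to \<open>a\<^sub>k\<close>.
\<close>
lemma minimizer_if_above_g2:
  assumes S1: "proj1 k a \<in> S1_set k \<phi>" and g2: "g2 k \<phi> (proj1 k a) \<le> a k"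
  shows "\<exists>p. minimizer a 0 p \<and> p k = 0"
proof -
  let ?P = "(SOME p. p \<in> S1_params k \<phi> (proj1 k a))(k := 0)"
  obtain v where v: "v \<in> subdiff k (log_mgf k \<phi>) ?P" "minimizer v 0 ?P" "\<forall>i\<in>{1..<k}. v i = a i"
    using S1_witness(1)[OF S1] by blast
  have "tilted_mean v 0 ?P k \<le> Inf (proj2 k ` subdiff k (log_mgf k \<phi>) ?P)"
    using v(1) subdiff_top_ge_tilted_mean[OF v(2)] by (intro cInf_greatest) auto
  also have "\<dots> \<le> a k" using g2 S1_witness(2)[OF S1] by simp
  finally have "minimizer a 0 ?P" using v(3) by (intro minimizer_raise[OF v(2)]) auto
  then show ?thesis by (metis fun_upd_same)
qed

text \<open>
  The parameters \<open>P\<close> chosen in the definition of \<open>g2\<close> need not a priori be those of the minimizer \<open>p\<close>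
  for \<open>a\<close>.  Raising the last coordinate makes both of them minimizers for a common vector \<open>w\<close>, so their tilted
  laws, and with them the last tilted means, coincide.
\<close>
lemma above_g2_if_minimizer:
  assumes a: "a \<in> {1..k} \<rightarrow>\<^sub>E UNIV" and A1: "proj1 k a \<in> A1_set k \<phi>"
    and p: "minimizer a 0 p" and pk: "p k = 0"
  shows "proj1 k a \<in> S1_set k \<phi> \<and> g2 k \<phi> (proj1 k a) \<le> a k"
proof
  let ?p = "restrict p {1..<k}"
  have "partfn a 0 (?p(k := 0)) = partfn a 0 p" using pk by (intro partfn_cong) auto
  then have "minimizer a 0 (?p(k := 0))" using p by (simp add: minimizer_def)
  then have "a \<in> subdiff k (log_mgf k \<phi>) (?p(k := 0))" using subdiff_iff_minimizer[OF a] by blast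
  then have "?p \<in> S1_params k \<phi> (proj1 k a)" by (simp add: S1_params_def)
  then show S1: "proj1 k a \<in> S1_set k \<phi>" using A1 by (auto simp: S1_set_def)
  let ?P = "(SOME p. p \<in> S1_params k \<phi> (proj1 k a))(k := 0)"
  obtain v where v: "v \<in> subdiff k (log_mgf k \<phi>) ?P" "minimizer v 0 ?P" "\<forall>i\<in>{1..<k}. v i = a i"
    using S1_witness(1)[OF S1] by blast
  \<comment> \<open>Both minimizers admit this common last coordinate by \<open>minimizer_raise\<close>.\<close>
  define w where "w = a(k := max (a k) (v k))"
  have wP: "minimizer w 0 ?P"
    using v(3) tilted_mean_top[OF v(2)] by (intro minimizer_raise[OF v(2)]) (auto simp: w_def)
  have wp: "minimizer w 0 p"
    using tilted_mean_top[OF p] by (intro minimizer_raise[OF p pk]) (auto simp: w_def)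
  have "tilted_mean v 0 ?P k = tilted_mean w 0 ?P k" using tilted_mean_shift[OF minimizer_finite[OF v(2)]] by metis
  also have "\<dots> = tilted_mean w 0 p k" using tilted_unique[OF wP wp] by (simp add: tilted_mean_def)
  also have "\<dots> = tilted_mean a 0 p k" using tilted_mean_shift[OF minimizer_finite[OF p]] by metis
  also have "\<dots> \<le> a k" using tilted_mean_top[OF p] by simp
  finally have "minimizer a 0 ?P" using v(3) by (intro minimizer_raise[OF v(2)]) auto
  then have "a \<in> subdiff k (log_mgf k \<phi>) ?P" using subdiff_iff_minimizer[OF a] by blast
  moreover have "bdd_below (proj2 k ` subdiff k (log_mgf k \<phi>) ?P)"
    using subdiff_top_ge_tilted_mean[OF v(2)] by (intro bdd_belowI2)
  ultimately have "Inf (proj2 k ` subdiff k (log_mgf k \<phi>) ?P) \<le> proj2 k a" by (intro cInf_lower) auto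
  then show "g2 k \<phi> (proj1 k a) \<le> a k" using S1_witness(2)[OF S1] by (simp add: proj2_def)
qed

section \<open>The limit law\<close>

text \<open>
  In the first case the minimizer is taken with vanishing last parameter.  In the second case no
  minimizer has this property, so the last parameter is negative and complementary slackness pins the
  last mean to \<open>a\<^sub>k\<close>.
\<close>
lemma limit_law_exists:
  assumes a: "a \<in> admissible k \<phi>" and co: "coercive a K"
  shows "\<exists>p. minimizer a 0 p \<and> is_limit_law k \<phi> a (tilted a 0 p)"
proof -
  have aE: "a \<in> {1..k} \<rightarrow>\<^sub>E UNIV" and A1: "proj1 k a \<in> A1_set k \<phi>" using a by (auto simp: admissible_def)
  let ?A = "proj1 k a \<in> S1_set k \<phi> \<and> g2 k \<phi> (proj1 k a) \<le> a k"
  obtain p where p: "minimizer a 0 p" and pA: "?A \<longleftrightarrow> p k = 0"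
  proof (cases ?A)
    case True
    then show ?thesis using minimizer_if_above_g2 that by blast
  next
    case False
    obtain p where "minimizer a 0 p" using minimizer_exists[OF co order_refl] by blast
    then show ?thesis using above_g2_if_minimizer[OF aE A1] False that by blast
  qed
  note fin = minimizer_finite[OF p]
  let ?q = "p(1 := p 1 - 1)"
  have norm: "tilted a 0 p = normalized (\<lambda>x. exp (\<Sum>i\<in>{1..k}. ?q i * \<phi> i x))" by (rule tilted_eq_normalized[OF fin])
  have low: "has_bochner_integral (tilted a 0 p) (\<phi> i) (a i)" if "i \<in> {1..<k}" for i
    using minimizer_moments(1)[OF p order_refl, of i] tilted_mean_le[OF p order_refl that] that
    by (auto simp: has_bochner_integral_iff tilted_mean_def)
  have "is_limit_law k \<phi> a (tilted a 0 p)"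
    unfolding is_limit_law_def
  proof (intro conjI impI)
    show "tilted a 0 p \<in> probs borel_pos" using prob_space_tilted[OF fin] by (simp add: probs_def)
    assume "proj1 k a \<in> S1_set k \<phi> \<and> g2 k \<phi> (proj1 k a) \<le> a k"
    then have "?q k = 0" using pA k by auto
    then have "tilted a 0 p = normalized (\<lambda>x. exp (\<Sum>i\<in>{1..<k}. ?q i * \<phi> i x))"
      unfolding norm sum_split_top by simp
    then show "\<exists>q. tilted a 0 p = normalized (\<lambda>x. exp (\<Sum>i\<in>{1..<k}. q i * \<phi> i x)) \<and>
        (\<forall>i\<in>{1..<k}. has_bochner_integral (tilted a 0 p) (\<phi> i) (a i))" using low by blast
  next
    assume B: "proj1 k a \<in> S2_set k \<phi> \<or> proj1 k a \<in> S1_set k \<phi> \<and> a k < g2 k \<phi> (proj1 k a)"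
    then have "p k \<noteq> 0" using pA by (auto simp: S2_set_def)
    then have pk: "p k < 0" using minimizer_top_nonpos[OF p] by simp
    then have qk: "?q k < 0" using k by simp
    have "tilted_mean a 0 p k = a k" using tilted_mean_slack[OF p order_refl k_mem(2)] pk by simp
    then have "has_bochner_integral (tilted a 0 p) (\<phi> k) (a k)"
      using minimizer_moments(1)[OF p order_refl k_mem(2)] by (simp add: has_bochner_integral_iff tilted_mean_def)
    then have "\<forall>i\<in>{1..k}. has_bochner_integral (tilted a 0 p) (\<phi> i) (a i)"
      using low by (metis atLeastAtMost_iff atLeastLessThan_iff le_neq_implies_less)
    then show "\<exists>q. q k < 0 \<and> tilted a 0 p = normalized (\<lambda>x. exp (\<Sum>i\<in>{1..k}. q i * \<phi> i x)) \<and>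
        (\<forall>i\<in>{1..k}. has_bochner_integral (tilted a 0 p) (\<phi> i) (a i))" using norm qk by blast
  qed
  then show ?thesis using p by blast
qed

lemma limit_law_unique:
  assumes a: "a \<in> admissible k \<phi>" and \<mu>: "is_limit_law k \<phi> a \<mu>" and \<nu>: "is_limit_law k \<phi> a \<nu>"
  shows "\<nu> = \<mu>"
proof -
  have probs: "\<mu> \<in> probs borel_pos" "\<nu> \<in> probs borel_pos"
    using \<mu> \<nu> unfolding is_limit_law_def by blast+
  show ?thesis
  proof (cases "proj1 k a \<in> S1_set k \<phi> \<and> a k \<ge> g2 k \<phi> (proj1 k a)")
    case True
    obtain p where p: "\<mu> = normalized (\<lambda>x. exp (\<Sum>i\<in>{1..<k}. p i * \<phi> i x))"
      "\<forall>i\<in>{1..<k}. has_bochner_integral \<mu> (\<phi> i) (a i)"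
      using \<mu> True unfolding is_limit_law_def by blast
    obtain q where q: "\<nu> = normalized (\<lambda>x. exp (\<Sum>i\<in>{1..<k}. q i * \<phi> i x))"
      "\<forall>i\<in>{1..<k}. has_bochner_integral \<nu> (\<phi> i) (a i)"
      using \<nu> True unfolding is_limit_law_def by blast
    show ?thesis
      unfolding p(1) q(1)
      by (rule normalized_exp_unique[OF _ probs(1)[unfolded p(1)] probs(2)[unfolded q(1)]
            p(2)[unfolded p(1), rule_format] q(2)[unfolded q(1), rule_format]]) auto
  next
    case False
    then have B: "proj1 k a \<in> S2_set k \<phi> \<or> proj1 k a \<in> S1_set k \<phi> \<and> a k < g2 k \<phi> (proj1 k a)"
      using a by (auto simp: S2_set_def admissible_def)
    obtain p where p: "\<mu> = normalized (\<lambda>x. exp (\<Sum>i\<in>{1..k}. p i * \<phi> i x))"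
      "\<forall>i\<in>{1..k}. has_bochner_integral \<mu> (\<phi> i) (a i)"
      using \<mu> B unfolding is_limit_law_def by blast
    obtain q where q: "\<nu> = normalized (\<lambda>x. exp (\<Sum>i\<in>{1..k}. q i * \<phi> i x))"
      "\<forall>i\<in>{1..k}. has_bochner_integral \<nu> (\<phi> i) (a i)"
      using \<nu> B unfolding is_limit_law_def by blast
    show ?thesis
      unfolding p(1) q(1)
      by (rule normalized_exp_unique[OF _ probs(1)[unfolded p(1)] probs(2)[unfolded q(1)]
            p(2)[unfolded p(1), rule_format] q(2)[unfolded q(1), rule_format]]) auto
  qed
qed

lemma iterated_limit:
  assumes co: "coercive a K" and p: "minimizer a 0 p" and j: "j \<ge> 1"
  shows "iterated_weak_limit j (\<lambda>n \<delta>. cond_law k \<phi> a j n \<delta>) (tilted_pow a 0 p j)"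
proof -
  have "\<forall>d. \<exists>q. d > 0 \<longrightarrow> minimizer a d q" using minimizer_exists[OF co] by (meson less_imp_le)
  then obtain q where q: "\<And>d. d > 0 \<Longrightarrow> minimizer a d (q d)" by metis
  define \<nu> where "\<nu> d = tilted_pow a d (q d) j" for d
  have "\<forall>\<^sub>F \<delta> in at_right 0. \<nu> \<delta> \<in> probs (borel_pos_pow j) \<and>
      weak_limit (pos_pow_top j) (\<lambda>n. cond_law k \<phi> a j n \<delta>) (\<nu> \<delta>) sequentially"
    using eventually_at_right_less[of 0]
  proof eventually_elim
    case (elim \<delta>)
    have "prob_space (\<nu> \<delta>)" unfolding \<nu>_def
      by (intro prob_space_PiM prob_space_tilted minimizer_finite q elim)
    then have "\<nu> \<delta> \<in> probs (borel_pos_pow j)" by (simp add: probs_def \<nu>_def sets_PiM_tilted)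
    then show ?case using cond_law_weak_limit[OF co elim q[OF elim] j] by (simp add: \<nu>_def)
  qed
  moreover have "weak_limit (pos_pow_top j) \<nu> (tilted_pow a 0 p j) (at_right 0)"
    unfolding \<nu>_def[abs_def] by (rule tilted_weak_limit[OF q p])
  ultimately show ?thesis unfolding iterated_weak_limit_def by blast
qed

end

theorem theorem2p3:
  fixes k j :: nat and \<phi> :: "nat \<Rightarrow> real \<Rightarrow> real" and a :: "nat \<Rightarrow> real"
  assumes k: "k \<ge> 2"
    and pos: "\<And>i x. i \<in> {1..k} \<Longrightarrow> x > 0 \<Longrightarrow> \<phi> i x > 0"
    and C1: "\<And>i. i \<in> {1..k} \<Longrightarrow>
      \<phi> i C1_differentiable_on {0<..} \<and> mono_on {0<..} (\<phi> i) \<and> filterlim (\<phi> i) at_top at_top"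
    and C2: "\<And>i c. i \<in> {1..k} \<Longrightarrow> c > 0 \<Longrightarrow> integrable leb_pos (\<lambda>x. exp (- c * \<phi> i x))"
    and C3: "\<exists>\<kappa>>1. \<forall>i\<in>{1..k-1}. \<forall>\<^sub>F x in at_top. \<phi> i x powr \<kappa> < \<phi> (i+1) x"
    and C4: "\<exists>C>0. \<exists>M>0. \<forall>x>C. \<forall>i\<in>{1..k}.
      1 / C * \<phi> i x powr (- M) < deriv (\<phi> i) x \<and> deriv (\<phi> i) x < C * \<phi> i x powr M"
    and g1_cont:
      "continuous_map (subtopology (euclid {1..<k}) (A1_set k \<phi>)) euclideanreal (g1 k \<phi>)"
    and a: "a \<in> admissible k \<phi>"
    and j: "j \<ge> 1"
  shows "\<exists>\<mu>. is_limit_law k \<phi> a \<mu> \<and>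
             (\<forall>\<mu>'. is_limit_law k \<phi> a \<mu>' \<longrightarrow> \<mu>' = \<mu>) \<and>
             iterated_weak_limit j (\<lambda>n \<delta>. cond_law k \<phi> a j n \<delta>) (PiM {1..j} (\<lambda>_. \<mu>))"
proof -
  interpret growth_family k \<phi>
    by unfold_locales (fact k, fact pos, fact C1, fact C2, fact C3, fact C4)
  obtain K where co: "coercive a K" using admissible_coercive[OF g1_cont a] by blast
  obtain p where p: "minimizer a 0 p" and lim: "is_limit_law k \<phi> a (tilted a 0 p)"
    using limit_law_exists[OF a co] by blast
  show ?thesis
    using lim limit_law_unique[OF a lim] iterated_limit[OF co p j] by blast
qed

end
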